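(* Let $m\ge 1$ be an integer and let $k_1,\dots,k_m$ be positive integers. Let $\phi$ be a function on $[0,\infty)^m$ satisfying $$\int_{[0,\infty)^m}\prod_{j=1}^m(1+r_j)^{2k_j+1}\,|\phi(r_1,\dots,r_m)|\,dr_1\cdots dr_m<\infty .$$ Then for all $r_1,\dots,r_m>0$ the following identities are valid: $$\mathcal F_{2k_1+1,\dots,2k_m+1}(\phi)(r_1,\dots,r_m)=\frac{1}{(2\pi)^{k_1+\cdots+k_m}}\sum_{\ell_m=1}^{k_m}\cdots\sum_{\ell_1=1}^{k_1}\left(\prod_{j=1}^m\frac{(-1)^{\ell_j}(2k_j-\ell_j-1)!}{2^{k_j-\ell_j}(k_j-\ell_j)!(\ell_j-1)!}\frac{1}{r_j^{2k_j-\ell_j}}\right)\frac{\partial^{\ell_1+\cdots+\ell_m}\mathcal F_{1,\dots,1}(\phi)}{\partial r_m^{\ell_m}\cdots\partial r_1^{\ell_1}}(r_1,\dots,r_m)$$ and $$\mathcal F_{2k_1+2,\dots,2k_m+2}(\phi)(r_1,\dots,r_m)=\frac{1}{(2\pi)^{k_1+\cdots+k_m}}\sum_{\ell_m=1}^{k_m}\cdots\sum_{\ell_1=1}^{k_1}\left(\prod_{j=1}^m\frac{(-1)^{\ell_j}(2k_j-\ell_j-1)!}{2^{k_j-\ell_j}(k_j-\ell_j)!(\ell_j-1)!}\frac{1}{r_j^{2k_j-\ell_j}}\right)\frac{\partial^{\ell_1+\cdots+\ell_m}\mathcal F_{2,\dots,2}(\phi)}{\partial r_m^{\ell_m}\cdots\partial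 r_1^{\ell_1}}(r_1,\dots,r_m).$$
   Context: For positive integers $n_1,\dots,n_m$ and $\Phi\in L^1(\mathbf R^{n_1+\cdots+n_m})$, write $$F_{n_1,\dots,n_m}(\Phi)(\xi_1,\dots,\xi_m)=\int_{\mathbf R^{n_m}}\cdots\int_{\mathbf R^{n_1}}\Phi(x_1,\dots,x_m)e^{-2\pi i(x_1\cdot\xi_1+\cdots+x_m\cdot\xi_m)}\,dx_1\cdots dx_m,\qquad \xi_i\in\mathbf R^{n_i}.$$ Given a function $\phi$ on $[0,\infty)^m$, let $\Phi$ be the multiradial function $\Phi(x_1,\dots,x_m)=\phi(|x_1|,\dots,|x_m|)$, $x_i\in\mathbf R^{n_i}$, where $|\cdot|$ is the Euclidean norm. When $\Phi$ is integrable on $\mathbf R^{n_1+\cdots+n_m}$, its Fourier transform is also multiradial, and one defines $$\mathcal F_{n_1,\dots,n_m}(\phi)(r_1,\dots,r_m):=F_{n_1,\dots,n_m}(\Phi)(\xi_1,\dots,\xi_m)\quad\text{where } r_i=|\xi_i|.$$ In particular $\mathcal F_{1,\dots,1}(\phi)$ uses $n_1=\cdots=n_m=1$ and $\mathcal F_{2,\dots,2}(\phi)$ uses $n_1=\cdots=n_m=2$. *)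

theory Defs
  imports "HOL-Analysis.Analysis"
begin

text \<open>
  A point of the product of the spaces \<open>\<real>\<^bsup>n j\<^esup>\<close>, \<open>j < m\<close>, is an extensional function \<open>x\<close>, where \<open>x j i\<close>
  (\<open>j < m\<close>, \<open>i < n j\<close>) is the \<open>i\<close>-th coordinate of the \<open>j\<close>-th block; blocks are numbered
  from \<open>0\<close>. The product of the Borel-Lebesgue measures is completed, so that
  measurability means Lebesgue measurability.
\<close>

definition block_lebesgue :: "nat \<Rightarrow> (nat \<Rightarrow> nat) \<Rightarrow> (nat \<Rightarrow> nat \<Rightarrow> real) measure" where
  "block_lebesgue m n =
     completion (\<Pi>\<^sub>M j\<in>{..<m}. \<Pi>\<^sub>M i\<in>{..<n j}. (lborel :: real measure))"

definition fourier ::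
  "nat \<Rightarrow> (nat \<Rightarrow> nat) \<Rightarrow> ((nat \<Rightarrow> nat \<Rightarrow> real) \<Rightarrow> complex) \<Rightarrow> (nat \<Rightarrow> nat \<Rightarrow> real) \<Rightarrow> complex" where
  "fourier m n \<Phi> \<xi> =
     (LINT x|block_lebesgue m n.
        \<Phi> x * exp (- 2 * complex_of_real pi * \<i> * complex_of_real (\<Sum>j<m. \<Sum>i<n j. x j i * \<xi> j i)))"

definition block_norms :: "nat \<Rightarrow> (nat \<Rightarrow> nat) \<Rightarrow> (nat \<Rightarrow> nat \<Rightarrow> real) \<Rightarrow> nat \<Rightarrow> real" where
  "block_norms m n x = (\<lambda>j\<in>{..<m}. L2_set (x j) {..<n j})"

definition multiradial ::
  "nat \<Rightarrow> (nat \<Rightarrow> nat) \<Rightarrow> ((nat \<Rightarrow> real) \<Rightarrow> complex) \<Rightarrow> (nat \<Rightarrow> nat \<Rightarrow> real) \<Rightarrow> complex" where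
  "multiradial m n \<phi> x = \<phi> (block_norms m n x)"

text \<open>
  The common value of the Fourier transform of the multiradial extension of \<open>\<phi>\<close> at all
  frequencies \<open>\<xi>\<close> with \<open>\<bar>\<xi>\<^sub>j\<bar> = r\<^sub>j\<close>. It exists and is unique if all \<open>n j\<close> are positive and
  all \<open>r j\<close> are nonnegative.
\<close>

definition multiradial_fourier ::
  "nat \<Rightarrow> (nat \<Rightarrow> nat) \<Rightarrow> ((nat \<Rightarrow> real) \<Rightarrow> complex) \<Rightarrow> (nat \<Rightarrow> real) \<Rightarrow> complex" where
  "multiradial_fourier m n \<phi> r =
     (THE c. \<forall>\<xi>\<in>space (block_lebesgue m n).
        (\<forall>j<m. r j = block_norms m n \<xi> j) \<longrightarrow> fourier m n (multiradial m n \<phi>) \<xi> = c)"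

definition closed_orthant :: "nat \<Rightarrow> (nat \<Rightarrow> real) set" where
  "closed_orthant m = (\<Pi>\<^sub>E j\<in>{..<m}. {0..})"

definition open_orthant :: "nat \<Rightarrow> (nat \<Rightarrow> real) set" where
  "open_orthant m = (\<Pi>\<^sub>E j\<in>{..<m}. {0<..})"

definition partial_deriv ::
  "nat \<Rightarrow> ((nat \<Rightarrow> real) \<Rightarrow> complex) \<Rightarrow> (nat \<Rightarrow> real) \<Rightarrow> complex" where
  "partial_deriv j f r = vector_derivative (\<lambda>t. f (r(j := t))) (at (r j))"

text \<open>The derivatives in coordinate \<open>0\<close> are taken first, those in coordinate \<open>m - 1\<close> last.\<close>

primrec mixed_deriv ::
  "nat \<Rightarrow> (nat \<Rightarrow> nat) \<Rightarrow> ((nat \<Rightarrow> real) \<Rightarrow> complex) \<Rightarrow> (nat \<Rightarrow> real) \<Rightarrow> complex" where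
  "mixed_deriv 0 l f = f"
| "mixed_deriv (Suc m) l f = (partial_deriv m ^^ l m) (mixed_deriv m l f)"

text \<open>
  Since \<^const>\<open>vector_derivative\<close> is total, this states separately that each of the
  successive differentiations in \<^const>\<open>mixed_deriv\<close> is legitimate at every point of \<open>S\<close>.
\<close>

definition mixed_differentiable_on ::
  "nat \<Rightarrow> (nat \<Rightarrow> nat) \<Rightarrow> ((nat \<Rightarrow> real) \<Rightarrow> complex) \<Rightarrow> (nat \<Rightarrow> real) set \<Rightarrow> bool" where
  "mixed_differentiable_on m l f S \<longleftrightarrow>
     (\<forall>r\<in>S. \<forall>j<m. \<forall>i<l j.
        (\<lambda>t. (partial_deriv j ^^ i) (mixed_deriv j l f) (r(j := t))) differentiable at (r j))"

definition coeff :: "nat \<Rightarrow> nat \<Rightarrow> real" where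
  "coeff k l = (-1) ^ l * fact (2 * k - l - 1) / (2 ^ (k - l) * fact (k - l) * fact (l - 1))"

end

theory Submission
  imports Defs
begin

text \<open>
  For a radial function on \<open>\<real>\<^bsup>n+2\<^esup>\<close> with profile \<open>h\<close>, integrating over the last two coordinates
  leaves a radial function on \<open>\<real>\<^bsup>n\<^esup>\<close> with profile \<open>s \<mapsto> 2\<pi> \<integral>\<^sub>s\<^sup>\<infinity> h(v) v dv\<close>, and the Fourier transform at
  \<open>r e\<^sub>0\<close> does not change. After \<open>k\<close> such steps the transform in dimension \<open>2k + 1\<close> is the integral over the
  line of \<open>h(\<bar>y\<bar>)\<close> against \<open>(2\<pi>)\<^sup>-\<^sup>k (-r\<^sup>-\<^sup>1 d/dr)\<^sup>k e\<^bsup>-2\<pi>iry\<^esup>\<close>; expanding the power of the operator gives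
  the coefficients. Dimension \<open>2k + 2\<close> is the same identity with one additional coordinate as a parameter.
  Several blocks are treated one at a time by Fubini's theorem, and the derivatives of the low-dimensional
  transform are taken under the integral sign.
\<close>

subsection \<open>Radial and rotation invariance of Lebesgue measure\<close>

text \<open>The reduction step needs calculus in the space variable only. Integrating out two
  coordinates replaces \<open>h\<close> by an integral over \<open>v \<ge> \<bar>y\<bar>\<close>;
  after an exchange of integrals the kernel is integrated over \<open>{-v..v}\<close>, and
  \<open>y\<close> times an antiderivative of one kernel is, up to a constant, the next kernel.
  Derivatives in \<open>r\<close> are taken only in dimension 1 or 2. Coordinates are removed in
  pairs because the area of the plane, seen through
  \<open>sqrt (s\<^sup>2 + \<bar>z\<bar>\<^sup>2)\<close>, has density \<open>2 * pi * v\<close> on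
  \<open>v \<ge> s\<close>, a formula free of \<open>s\<close>. The exponent
  \<open>2 * k + 1\<close> is that of the radial density in dimension \<open>2 * k + 2\<close>; the
  lower-dimensional integrands, including the derivatives of order at most \<open>k\<close> in
  dimension 1 or 2, grow no faster. Two obstacles shape the proof. With the other coordinates or
  blocks frozen, a profile is known to be integrable only for almost every frozen point, so
  one-block identities are applied almost everywhere. And \<open>\<phi>\<close> is only Lebesgue
  measurable and arbitrary off the orthant, so it is replaced by a Borel representative, for which
  the map to radii must pull null sets back to null sets.\<close>

lemma measure_eqI_atMost:
  fixes M N :: "real measure"
  assumes sets: "sets M = sets borel" "sets N = sets borel"
  assumes fin: "\<And>x. emeasure M {..x} < \<infinity>"
  assumes eq: "\<And>x. emeasure M {..x} = emeasure N {..x}"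
  shows "M = N"
proof (rule measure_eqI_generator_eq_countable)
  let ?E = "range (\<lambda>a::real. {..a})"
  show "Int_stable ?E"
    by (auto simp: Int_stable_def)
  show "sets M = sigma_sets UNIV ?E" "sets N = sigma_sets UNIV ?E"
    unfolding sets borel_eq_atMost by auto
  show "(\<lambda>a::real. {..a}) ` \<rat> \<subseteq> ?E" "countable ((\<lambda>a::real. {..a}) ` \<rat>)"
    using countable_rat by auto
  show "(\<Union>a\<in>\<rat>. {..a::real}) = UNIV"
  proof -
    have "\<exists>q\<in>\<rat>. x \<le> q" for x :: real
      using Rats_dense_in_real[of x "x+1"] by (auto intro: less_imp_le)
    then show ?thesis by auto
  qed
  show "\<And>X. X \<in> ?E \<Longrightarrow> emeasure M X = emeasure N X" using eq by auto
  show "\<And>a. a \<in> (\<lambda>a::real. {..a}) ` \<rat> \<Longrightarrow> emeasure M a \<noteq> \<infinity>"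
    using fin by (auto simp: less_top)
qed auto

interpretation lborel_product: product_sigma_finite "\<lambda>_::nat. lborel::real measure"
  by unfold_locales

text \<open>Pushforwards are identified by their distribution functions. This lemma computes the one
  on the density side, with \<open>F\<close> an antiderivative from the left end \<open>a\<close> of
  the support.\<close>

lemma emeasure_density_FTC:
  fixes f F :: "real \<Rightarrow> real"
  assumes f[measurable]: "f \<in> borel_measurable borel"
    and F: "\<And>x. a \<le> x \<Longrightarrow> (F has_real_derivative f x) (at x)"
    and nonneg: "\<And>x. a \<le> x \<Longrightarrow> 0 \<le> f x"
  shows "emeasure (density lborel (\<lambda>v. ennreal (f v * indicator {a..} v))) {..b} =
    (if a \<le> b then ennreal (F b - F a) else 0)"
proof -
  have "emeasure (density lborel (\<lambda>v. ennreal (f v * indicator {a..} v))) {..b} =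
     (\<integral>\<^sup>+v. ennreal (f v * indicator {a..} v) * indicator {..b} v \<partial>lborel)"
    by (subst emeasure_density) auto
  also have "\<dots> = (\<integral>\<^sup>+v. ennreal (f v) * indicator {a..b} v \<partial>lborel)"
    by (intro nn_integral_cong) (auto simp: indicator_def)
  also have "\<dots> = (if a \<le> b then ennreal (F b - F a) else 0)"
  proof (cases "a \<le> b")
    case True
    then show ?thesis
      by (subst nn_integral_FTC_Icc[where F=F]) (auto intro!: F nonneg)
  next
    case False
    then show ?thesis by simp
  qed
  finally show ?thesis .
qed

text \<open>For \<open>r \<le> 0\<close> the set lies in balls of arbitrarily small volume, hence is
  null. Covering these radii makes the distribution function of the radius explicit on the whole
  line.\<close>

lemma emeasure_PiM_lborel_cball:
  fixes A :: "nat set"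
  assumes "finite A" "A \<noteq> {}"
  shows "emeasure (\<Pi>\<^sub>M i\<in>A. (lborel::real measure)) {x \<in> space (\<Pi>\<^sub>M i\<in>A. lborel). L2_set x A \<le> r} =
    ennreal (unit_ball_vol (card A) * (max 0 r) ^ card A)"
proof -
  let ?M = "\<Pi>\<^sub>M i\<in>A. (lborel::real measure)"
  let ?B = "\<lambda>r. {x \<in> space ?M. L2_set x A \<le> r}"
  have [measurable]: "(\<lambda>x. L2_set x A) \<in> borel_measurable ?M"
    unfolding L2_set_def by measurable
  have pos: "emeasure ?M (?B s) = ennreal (unit_ball_vol (card A) * s ^ card A)" if "s > 0" for s
    using emeasure_cball_aux[OF assms(1) that] by (simp add: L2_set_def Int_def conj_commute)
  have card: "card A > 0" using assms by (simp add: card_gt_0_iff)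
  show ?thesis
  proof (cases "r > 0")
    case True
    then show ?thesis using pos[of r] by simp
  next
    case False
    have "emeasure ?M (?B r) \<le> ennreal e" if e: "e > 0" for e :: real
    proof -
      \<comment> \<open>The radius at which the ball has volume exactly \<open>e\<close>.\<close>
      define s where "s = root (card A) (e / (unit_ball_vol (card A)))"
      have s: "s > 0" "unit_ball_vol (card A) * s ^ card A = e"
        using card e by (auto simp: s_def unit_ball_vol_pos less_imp_neq[symmetric])
      have "emeasure ?M (?B r) \<le> emeasure ?M (?B s)"
        using False s by (intro emeasure_mono) auto
      with pos[OF s(1)] s show ?thesis by simp
    qed
    then have "emeasure ?M (?B r) \<le> 0"
      by - (rule ennreal_le_epsilon, simp)
    then have "emeasure ?M (?B r) = 0" by simp
    then show ?thesis using False card by simp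
  qed
qed

lemma measurable_PiM_lborel_coord:
  "i \<in> A \<Longrightarrow> (\<lambda>x. x i) \<in> borel_measurable (\<Pi>\<^sub>M i\<in>A. (lborel::real measure))"
  using measurable_component_singleton[of i A "\<lambda>_. lborel::real measure"] by simp

lemma measurable_L2_set_PiM[measurable]:
  "(\<lambda>x. L2_set x A) \<in> borel_measurable (\<Pi>\<^sub>M i\<in>A. (lborel::real measure))"
  unfolding L2_set_def by measurable

text \<open>Polar coordinates without a surface measure: the density of the radius is the derivative
  of the ball volume.\<close>

lemma distr_radius:
  fixes A :: "nat set"
  assumes A: "finite A" "A \<noteq> {}"
  shows "distr (\<Pi>\<^sub>M i\<in>A. lborel) borel (\<lambda>x. L2_set x A) =
    density lborel (\<lambda>v. ennreal ((unit_ball_vol (card A) * (card A * v ^ (card A - 1))) * indicator {0..} v))"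
    (is "?L = ?R")
proof (rule measure_eqI_atMost)
  fix b :: real
  have card: "card A > 0" using assms by (simp add: card_gt_0_iff)
  have "emeasure ?L {..b} = emeasure (\<Pi>\<^sub>M i\<in>A. lborel) {x \<in> space (\<Pi>\<^sub>M i\<in>A. lborel). L2_set x A \<le> b}"
    by (subst emeasure_distr) (auto intro!: arg_cong2[where f=emeasure])
  also have "\<dots> = ennreal (unit_ball_vol (card A) * (max 0 b) ^ card A)"
    by (rule emeasure_PiM_lborel_cball[OF A])
  finally have L: "emeasure ?L {..b} = ennreal (unit_ball_vol (card A) * (max 0 b) ^ card A)" .
  have "emeasure ?R {..b} = (if 0 \<le> b then ennreal (unit_ball_vol (card A) * b ^ card A
      - unit_ball_vol (card A) * 0 ^ card A) else 0)"
    by (intro emeasure_density_FTC) (auto intro!: derivative_eq_intros simp: unit_ball_vol_pos less_imp_le)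
  also have "\<dots> = ennreal (unit_ball_vol (card A) * (max 0 b) ^ card A)"
    using card by auto
  finally show "emeasure ?L {..b} = emeasure ?R {..b}" "emeasure ?L {..b} < \<infinity>"
    using L by auto
qed auto

text \<open>The sublevel set at height \<open>b\<close> is a disc of area
  \<open>pi * (b\<^sup>2 - s\<^sup>2)\<close>. In two dimensions the parameter \<open>s\<close>
  enters this area additively, so it disappears from the density and survives only in the
  support.\<close>

lemma distr_radius_plane:
  fixes A :: "nat set"
  assumes A: "card A = 2" and s: "s \<ge> 0"
  shows "distr (\<Pi>\<^sub>M i\<in>A. lborel) borel (\<lambda>x. sqrt (s\<^sup>2 + (L2_set x A)\<^sup>2)) =
    density lborel (\<lambda>v. ennreal (2 * pi * v * indicator {s..} v))"
    (is "?L = ?R")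
proof (rule measure_eqI_atMost)
  fix b :: real
  have A': "finite A" "A \<noteq> {}" using A by (auto intro: card_ge_0_finite)
  have eq: "sqrt (s\<^sup>2 + (L2_set x A)\<^sup>2) \<le> b \<longleftrightarrow> s \<le> b \<and> L2_set x A \<le> sqrt (b\<^sup>2 - s\<^sup>2)" for x
  proof -
    have "s \<le> sqrt (s\<^sup>2 + (L2_set x A)\<^sup>2)"
      using s by (intro real_le_rsqrt) auto
    moreover have "sqrt (s\<^sup>2 + (L2_set x A)\<^sup>2) \<le> b \<longleftrightarrow> L2_set x A \<le> sqrt (b\<^sup>2 - s\<^sup>2)" if "s \<le> b"
    proof -
      have "sqrt (s\<^sup>2 + (L2_set x A)\<^sup>2) \<le> b \<longleftrightarrow> s\<^sup>2 + (L2_set x A)\<^sup>2 \<le> b\<^sup>2"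
        using that s by (metis real_sqrt_abs abs_of_nonneg order_trans real_sqrt_le_iff)
      also have "\<dots> \<longleftrightarrow> L2_set x A \<le> sqrt (b\<^sup>2 - s\<^sup>2)"
        by (metis L2_set_nonneg abs_of_nonneg le_diff_eq add.commute real_sqrt_abs real_sqrt_le_iff)
      finally show ?thesis .
    qed
    ultimately show ?thesis by linarith
  qed
  have "emeasure ?L {..b} = emeasure (\<Pi>\<^sub>M i\<in>A. lborel)
      {x \<in> space (\<Pi>\<^sub>M i\<in>A. lborel). sqrt (s\<^sup>2 + (L2_set x A)\<^sup>2) \<le> b}"
    by (subst emeasure_distr) (auto intro!: arg_cong2[where f=emeasure])
  also have "\<dots> = (if s \<le> b then ennreal (pi * b^2 - pi * s^2) else 0)"
  proof (cases "s \<le> b")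
    case True
    have "emeasure (\<Pi>\<^sub>M i\<in>A. lborel)
      {x \<in> space (\<Pi>\<^sub>M i\<in>A. lborel). sqrt (s\<^sup>2 + (L2_set x A)\<^sup>2) \<le> b} = 
      emeasure (\<Pi>\<^sub>M i\<in>A. lborel) {x \<in> space (\<Pi>\<^sub>M i\<in>A. lborel). L2_set x A \<le> sqrt (b\<^sup>2 - s\<^sup>2)}"
      using True by (simp add: eq)
    also have "\<dots> = ennreal (pi * b^2 - pi * s^2)"
      using True s by (subst emeasure_PiM_lborel_cball[OF A']) (simp add: A unit_ball_vol_2 algebra_simps)
    finally show ?thesis using True by simp
  qed (simp add: eq)
  finally have L: "emeasure ?L {..b} = (if s \<le> b then ennreal (pi * b^2 - pi * s^2) else 0)" .
  moreover have "emeasure ?R {..b} = (if s \<le> b then ennreal (pi * b^2 - pi * s^2) else 0)"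
    using s by (intro emeasure_density_FTC) (auto intro!: derivative_eq_intros)
  ultimately show "emeasure ?L {..b} = emeasure ?R {..b}" "emeasure ?L {..b} < \<infinity>"
    by auto
qed auto

section \<open>Invariance under rotations\<close>

text \<open>
  The rotation is the composite of two affine substitutions in one variable each, with the
  other variable as a parameter; the first one divides by \<open>a\<close>.
\<close>

lemma nn_integral_rotate_aux:
  fixes g :: "real \<times> real \<Rightarrow> ennreal"
  assumes [measurable]: "g \<in> borel_measurable (borel \<Otimes>\<^sub>M borel)" and a: "a \<noteq> 0"
  shows "(\<integral>\<^sup>+x. \<integral>\<^sup>+y. g (x\<^sup>2 + y\<^sup>2, a * x + b * y) \<partial>lborel \<partial>lborel) =
    (\<integral>\<^sup>+x. \<integral>\<^sup>+y. g (x\<^sup>2 + y\<^sup>2, sqrt (a\<^sup>2 + b\<^sup>2) * x) \<partial>lborel \<partial>lborel)"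
proof -
  define \<rho> where "\<rho> = sqrt (a\<^sup>2 + b\<^sup>2)"
  have \<rho>: "\<rho> > 0" "\<rho>\<^sup>2 = a\<^sup>2 + b\<^sup>2"
    using a by (auto simp: \<rho>_def sum_power2_gt_zero_iff)
  have "(\<integral>\<^sup>+x. \<integral>\<^sup>+y. g (x\<^sup>2 + y\<^sup>2, a * x + b * y) \<partial>lborel \<partial>lborel) =
    (\<integral>\<^sup>+y. \<integral>\<^sup>+x. g (x\<^sup>2 + y\<^sup>2, a * x + b * y) \<partial>lborel \<partial>lborel)"
    by (rule lborel_pair.Fubini') measurable
  \<comment> \<open>The substitution for \<open>x\<close> is chosen so that the linear form
    \<open>a * x + b * y\<close> becomes \<open>\<rho> * u\<close>.\<close>
  also have "\<dots> = (\<integral>\<^sup>+y. ennreal \<bar>\<rho>/a\<bar> * (\<integral>\<^sup>+u. g ((- b / a * y + \<rho> / a * u)\<^sup>2 + y\<^sup>2, a * (- b / a * y + \<rho> / a * u) + b * y) \<partial>lborel) \<partial>lborel)"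
    using a \<rho> by (intro nn_integral_cong nn_integral_real_affine) auto
  also have "\<dots> = (\<integral>\<^sup>+y. ennreal \<bar>\<rho>/a\<bar> * (\<integral>\<^sup>+u. g ((- b / a * y + \<rho> / a * u)\<^sup>2 + y\<^sup>2, \<rho> * u) \<partial>lborel) \<partial>lborel)"
    using a by (simp add: algebra_simps)
  also have "\<dots> = ennreal \<bar>\<rho>/a\<bar> * (\<integral>\<^sup>+y. \<integral>\<^sup>+u. g ((- b / a * y + \<rho> / a * u)\<^sup>2 + y\<^sup>2, \<rho> * u) \<partial>lborel \<partial>lborel)"
    by (intro nn_integral_cmult lborel.borel_measurable_nn_integral) measurable
  also have "(\<integral>\<^sup>+y. \<integral>\<^sup>+u. g ((- b / a * y + \<rho> / a * u)\<^sup>2 + y\<^sup>2, \<rho> * u) \<partial>lborel \<partial>lborel) =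
     (\<integral>\<^sup>+u. \<integral>\<^sup>+y. g ((- b / a * y + \<rho> / a * u)\<^sup>2 + y\<^sup>2, \<rho> * u) \<partial>lborel \<partial>lborel)"
    by (rule lborel_pair.Fubini') measurable
  \<comment> \<open>With this \<open>y\<close> the pair \<open>(x, y)\<close> is the rotated point
    \<open>((a * u - b * v) / \<rho>, (b * u + a * v) / \<rho>)\<close>, so the sum of squares
    becomes \<open>u\<^sup>2 + v\<^sup>2\<close>. The two Jacobians are reciprocal.\<close>
  also have "\<dots> = (\<integral>\<^sup>+u. ennreal \<bar>a / \<rho>\<bar> * (\<integral>\<^sup>+v. g ((- b / a * (b / \<rho> * u + a / \<rho> * v) + \<rho> / a * u)\<^sup>2 + 
       (b / \<rho> * u + a / \<rho> * v)\<^sup>2, \<rho> * u) \<partial>lborel) \<partial>lborel)"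
    using a \<rho> by (intro nn_integral_cong nn_integral_real_affine) auto
  also have "\<dots> = (\<integral>\<^sup>+u. ennreal \<bar>a / \<rho>\<bar> * (\<integral>\<^sup>+v. g (u\<^sup>2 + v\<^sup>2, \<rho> * u) \<partial>lborel) \<partial>lborel)"
  proof -
    have "(- b / a * (b / \<rho> * u + a / \<rho> * v) + \<rho> / a * u)\<^sup>2 + (b / \<rho> * u + a / \<rho> * v)\<^sup>2 = u\<^sup>2 + v\<^sup>2" for u v
    proof -
      have "- b / a * (b / \<rho> * u + a / \<rho> * v) + \<rho> / a * u = (a * u - b * v) / \<rho>"
      proof -
        have "\<rho> / a = (a\<^sup>2 + b\<^sup>2) / (a * \<rho>)"
          unfolding \<rho>(2)[symmetric] using a \<rho>(1) by (simp add: power2_eq_square)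
        then have "- b / a * (b / \<rho> * u + a / \<rho> * v) + \<rho> / a * u =
            - b / a * (b / \<rho> * u + a / \<rho> * v) + (a\<^sup>2 + b\<^sup>2) / (a * \<rho>) * u" by simp
        also have "\<dots> = (a * u - b * v) / \<rho>"
          using a \<rho>(1) by (simp add: divide_simps) (simp add: algebra_simps power2_eq_square)
        finally show ?thesis .
      qed
      moreover have "b / \<rho> * u + a / \<rho> * v = (b * u + a * v) / \<rho>"
        by (simp add: add_divide_distrib)
      moreover have "((a * u - b * v) / \<rho>)\<^sup>2 + ((b * u + a * v) / \<rho>)\<^sup>2 = ((a\<^sup>2+b\<^sup>2) * (u\<^sup>2+v\<^sup>2)) / \<rho>\<^sup>2"
        by (simp add: power_divide add_divide_distrib[symmetric]) (simp add: power2_eq_square algebra_simps)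
      moreover have "((a\<^sup>2+b\<^sup>2) * (u\<^sup>2+v\<^sup>2)) / \<rho>\<^sup>2 = u\<^sup>2+v\<^sup>2"
        unfolding \<rho>(2)[symmetric] using \<rho>(1) by simp
      ultimately show ?thesis by (simp only:)
    qed
    then show ?thesis by simp
  qed
  also have "\<dots> = ennreal \<bar>a / \<rho>\<bar> * (\<integral>\<^sup>+u. (\<integral>\<^sup>+v. g (u\<^sup>2 + v\<^sup>2, \<rho> * u) \<partial>lborel) \<partial>lborel)"
    by (intro nn_integral_cmult lborel.borel_measurable_nn_integral) measurable
  also have "ennreal \<bar>\<rho>/a\<bar> * \<dots> = (\<integral>\<^sup>+u. (\<integral>\<^sup>+v. g (u\<^sup>2 + v\<^sup>2, \<rho> * u) \<partial>lborel) \<partial>lborel)"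
    using a \<rho> by (simp add: mult.assoc[symmetric] ennreal_mult[symmetric])
  finally show ?thesis unfolding \<rho>_def .
qed

lemma nn_integral_rotate:
  fixes g :: "real \<times> real \<Rightarrow> ennreal"
  assumes [measurable]: "g \<in> borel_measurable (borel \<Otimes>\<^sub>M borel)"
  shows "(\<integral>\<^sup>+x. \<integral>\<^sup>+y. g (x\<^sup>2 + y\<^sup>2, a * x + b * y) \<partial>lborel \<partial>lborel) =
    (\<integral>\<^sup>+x. \<integral>\<^sup>+y. g (x\<^sup>2 + y\<^sup>2, sqrt (a\<^sup>2 + b\<^sup>2) * x) \<partial>lborel \<partial>lborel)"
proof (cases "a = 0")
  case False
  then show ?thesis by (rule nn_integral_rotate_aux[OF assms])
next
  case a: True
  show ?thesis
  proof (cases "b = 0")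
    case True
    then show ?thesis using a by simp
  next
    case False
    \<comment> \<open>When only \<open>b\<close> is nonzero, interchanging the two variables brings
      the nonzero coefficient to the first place.\<close>
    have "(\<integral>\<^sup>+x. \<integral>\<^sup>+y. g (x\<^sup>2 + y\<^sup>2, a * x + b * y) \<partial>lborel \<partial>lborel) =
      (\<integral>\<^sup>+y. \<integral>\<^sup>+x. g (x\<^sup>2 + y\<^sup>2, a * x + b * y) \<partial>lborel \<partial>lborel)"
      by (rule lborel_pair.Fubini') measurable
    also have "\<dots> = (\<integral>\<^sup>+y. \<integral>\<^sup>+x. g (y\<^sup>2 + x\<^sup>2, b * y + 0 * x) \<partial>lborel \<partial>lborel)"
      using a by (simp add: add.commute)
    also have "\<dots> = (\<integral>\<^sup>+y. \<integral>\<^sup>+x. g (y\<^sup>2 + x\<^sup>2, sqrt (b\<^sup>2 + 0\<^sup>2) * y) \<partial>lborel \<partial>lborel)"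
      by (rule nn_integral_rotate_aux[OF assms False])
    finally show ?thesis using a by simp
  qed
qed

lemma nn_integral_PiM_rotate:
  fixes g :: "real \<times> real \<Rightarrow> ennreal" and \<xi> :: "nat \<Rightarrow> real"
  assumes n: "n \<ge> 1"
    and g: "g \<in> borel_measurable (borel \<Otimes>\<^sub>M borel)"
  shows "(\<integral>\<^sup>+x. g (\<Sum>i<n. (x i)\<^sup>2, \<Sum>i<n. x i * \<xi> i) \<partial>(\<Pi>\<^sub>M i\<in>{..<n}. lborel)) =
    (\<integral>\<^sup>+x. g (\<Sum>i<n. (x i)\<^sup>2, sqrt (\<Sum>i<n. (\<xi> i)\<^sup>2) * x 0) \<partial>(\<Pi>\<^sub>M i\<in>{..<n}. lborel))"
  using n g
proof (induction n arbitrary: g rule: nat_induct_at_least)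
  case base
  note [measurable] = base
  have single: "(\<integral>\<^sup>+x. f (x 0) \<partial>(\<Pi>\<^sub>M i\<in>{..<Suc 0}. lborel)) = (\<integral>\<^sup>+y. f y \<partial>lborel)"
    if [measurable]: "f \<in> borel_measurable borel" for f :: "real \<Rightarrow> ennreal"
    using lborel_product.product_nn_integral_singleton[of f 0] by (simp add: lessThan_Suc)
  have "(\<integral>\<^sup>+y. g (y\<^sup>2, y * \<xi> 0) \<partial>lborel) = (\<integral>\<^sup>+y. g (y\<^sup>2, \<bar>\<xi> 0\<bar> * y) \<partial>lborel)"
  proof (cases "\<xi> 0 \<ge> 0")
    case False
    \<comment> \<open>In dimension one the only rotation available is the reflection, which changes
      the sign of the frequency.\<close>
    then show ?thesis
      by (subst nn_integral_real_affine[where c="-1" and t=0]) (auto simp: mult.commute)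
  qed (simp add: mult.commute)
  then show ?case
    using single[of "\<lambda>y. g (y\<^sup>2, y * \<xi> 0)"] single[of "\<lambda>y. g (y\<^sup>2, \<bar>\<xi> 0\<bar> * y)"]
    by (simp add: real_sqrt_abs)
next
  case (Suc n)
  note [measurable] = Suc.prems
  define \<rho> where "\<rho> = sqrt (\<Sum>i<n. (\<xi> i)\<^sup>2)"
  have \<rho>: "\<rho>\<^sup>2 = (\<Sum>i<n. (\<xi> i)\<^sup>2)"
    unfolding \<rho>_def by (simp add: sum_nonneg)
  let ?R = "\<lambda>n. \<Pi>\<^sub>M i\<in>{..<n::nat}. (lborel::real measure)"
  have upd: "(\<Sum>i<n. f i ((x(n := y)) i)) = (\<Sum>i<n. f i (x i))" for f :: "nat \<Rightarrow> real \<Rightarrow> real" and x y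
    by (intro sum.cong) auto
  have upd': "(\<Sum>i<n. (if i = n then u i else v i)) = (\<Sum>i<n. v i)" for u v :: "nat \<Rightarrow> real"
    by (intro sum.cong) auto
  have "(\<integral>\<^sup>+x. g (\<Sum>i<Suc n. (x i)\<^sup>2, \<Sum>i<Suc n. x i * \<xi> i) \<partial>?R (Suc n)) =
    (\<integral>\<^sup>+y. \<integral>\<^sup>+x. g ((\<Sum>i<n. (x i)\<^sup>2) + y\<^sup>2, (\<Sum>i<n. x i * \<xi> i) + y * \<xi> n) \<partial>?R n \<partial>lborel)"
    unfolding lessThan_Suc
    by (subst lborel_product.product_nn_integral_insert_rev)
       (auto simp: upd upd' if_distrib if_distribR add.commute cong: if_cong)
  also have "\<dots> = (\<integral>\<^sup>+y. \<integral>\<^sup>+x. g ((\<Sum>i<n. (x i)\<^sup>2) + y\<^sup>2, \<rho> * x 0 + y * \<xi> n) \<partial>?R n \<partial>lborel)"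
  proof (rule nn_integral_cong)
    fix y
    have "(\<lambda>p. g (fst p + y\<^sup>2, snd p + y * \<xi> n)) \<in> borel_measurable (borel \<Otimes>\<^sub>M borel)"
      by measurable
    from Suc.IH[OF this] show "(\<integral>\<^sup>+x. g ((\<Sum>i<n. (x i)\<^sup>2) + y\<^sup>2, (\<Sum>i<n. x i * \<xi> i) + y * \<xi> n) \<partial>?R n) =
      (\<integral>\<^sup>+x. g ((\<Sum>i<n. (x i)\<^sup>2) + y\<^sup>2, \<rho> * x 0 + y * \<xi> n) \<partial>?R n)"
      by (simp add: \<rho>_def)
  qed
  also have "\<dots> = (\<integral>\<^sup>+x. g (\<Sum>i<Suc n. (x i)\<^sup>2, \<rho> * x 0 + x n * \<xi> n) \<partial>?R (Suc n))"
    unfolding lessThan_Suc using Suc.hyps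
    by (subst lborel_product.product_nn_integral_insert_rev)
       (auto simp: upd upd' if_distrib if_distribR add.commute cong: if_cong)
  finally have 1: "(\<integral>\<^sup>+x. g (\<Sum>i<Suc n. (x i)\<^sup>2, \<Sum>i<Suc n. x i * \<xi> i) \<partial>?R (Suc n)) =
      (\<integral>\<^sup>+x. g (\<Sum>i<Suc n. (x i)\<^sup>2, \<rho> * x 0 + x n * \<xi> n) \<partial>?R (Suc n))" .
  let ?I = "{1..<n}" and ?J = "insert n {1..<n}"
  let ?Q = "\<lambda>x. \<Sum>i\<in>?I. (x i)\<^sup>2 :: real"
  have sets: "{..<Suc n} = insert 0 ?J" "0 \<notin> ?J" "n \<notin> ?I" "finite ?I" "finite ?J"
    using Suc.hyps by auto
  \<comment> \<open>Isolates the coordinates 0 and \<open>n\<close>. The remaining ones enter only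
    through \<open>?Q\<close>, a constant during the rotation in the plane.\<close>
  have split: "(\<integral>\<^sup>+x. f (x 0) (x n) (\<Sum>i<Suc n. (x i)\<^sup>2) \<partial>?R (Suc n)) =
      (\<integral>\<^sup>+x. \<integral>\<^sup>+y. \<integral>\<^sup>+z. f z y (z\<^sup>2 + y\<^sup>2 + ?Q x) \<partial>lborel \<partial>lborel \<partial>(\<Pi>\<^sub>M i\<in>?I. lborel))"
    if [measurable]: "(\<lambda>(u,v,w). f u v w) \<in> borel_measurable (borel \<Otimes>\<^sub>M borel \<Otimes>\<^sub>M borel)" 
    for f :: "real \<Rightarrow> real \<Rightarrow> real \<Rightarrow> ennreal"
  proof -
    have [measurable]: "(\<lambda>x. f (p x) (q x) (r x)) \<in> borel_measurable M"
      if "p \<in> borel_measurable M" "q \<in> borel_measurable M" "r \<in> borel_measurable M" for p q r M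
      using measurable_compose[of "\<lambda>x. (p x, q x, r x)" M, OF _ \<open>(\<lambda>(u,v,w). f u v w) \<in> _\<close>] that by simp
    have updQ: "?Q (x(n := y)) = ?Q x" "?Q (x(0 := y)) = ?Q x" for x y
      by (auto intro!: sum.cong)
    have "(\<integral>\<^sup>+x. f (x 0) (x n) (\<Sum>i<Suc n. (x i)\<^sup>2) \<partial>?R (Suc n)) =
       (\<integral>\<^sup>+x. f (x 0) (x n) ((x 0)\<^sup>2 + (x n)\<^sup>2 + ?Q x) \<partial>(\<Pi>\<^sub>M i\<in>insert 0 ?J. lborel))"
      unfolding sets(1) using sets by (simp add: add.assoc)
    also have "\<dots> = (\<integral>\<^sup>+x. \<integral>\<^sup>+z. f z (x n) (z\<^sup>2 + (x n)\<^sup>2 + ?Q x) \<partial>lborel \<partial>(\<Pi>\<^sub>M i\<in>?J. lborel))"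
      using sets Suc.hyps
      by (subst lborel_product.product_nn_integral_insert) (auto simp: updQ)
    also have "\<dots> = (\<integral>\<^sup>+x. \<integral>\<^sup>+y. \<integral>\<^sup>+z. f z y (z\<^sup>2 + y\<^sup>2 + ?Q x) \<partial>lborel \<partial>lborel \<partial>(\<Pi>\<^sub>M i\<in>?I. lborel))"
      using sets Suc.hyps
      by (subst lborel_product.product_nn_integral_insert) (auto simp: updQ)
    finally show ?thesis .
  qed
  have "(\<integral>\<^sup>+x. g (\<Sum>i<Suc n. (x i)\<^sup>2, \<rho> * x 0 + x n * \<xi> n) \<partial>?R (Suc n)) =
    (\<integral>\<^sup>+x. \<integral>\<^sup>+y. \<integral>\<^sup>+z. g (z\<^sup>2 + y\<^sup>2 + ?Q x, \<rho> * z + y * \<xi> n) \<partial>lborel \<partial>lborel \<partial>(\<Pi>\<^sub>M i\<in>?I. lborel))"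
    by (rule split) measurable
  also have "\<dots> = (\<integral>\<^sup>+x. \<integral>\<^sup>+y. \<integral>\<^sup>+z. g (z\<^sup>2 + y\<^sup>2 + ?Q x, sqrt (\<rho>\<^sup>2 + (\<xi> n)\<^sup>2) * z) \<partial>lborel \<partial>lborel \<partial>(\<Pi>\<^sub>M i\<in>?I. lborel))"
  proof (rule nn_integral_cong)
    fix x
    define q where "q = ?Q x"
    have "(\<integral>\<^sup>+y. \<integral>\<^sup>+z. g (z\<^sup>2 + y\<^sup>2 + q, \<rho> * z + y * \<xi> n) \<partial>lborel \<partial>lborel) =
      (\<integral>\<^sup>+z. \<integral>\<^sup>+y. g (z\<^sup>2 + y\<^sup>2 + q, \<rho> * z + y * \<xi> n) \<partial>lborel \<partial>lborel)"
      by (rule lborel_pair.Fubini') measurable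
    also have "\<dots> = (\<integral>\<^sup>+z. \<integral>\<^sup>+y. g (z\<^sup>2 + y\<^sup>2 + q, sqrt (\<rho>\<^sup>2 + (\<xi> n)\<^sup>2) * z) \<partial>lborel \<partial>lborel)"
      using nn_integral_rotate[of "\<lambda>p. g (fst p + q, snd p)" \<rho> "\<xi> n"] by (simp add: mult.commute)
    also have "\<dots> = (\<integral>\<^sup>+y. \<integral>\<^sup>+z. g (z\<^sup>2 + y\<^sup>2 + q, sqrt (\<rho>\<^sup>2 + (\<xi> n)\<^sup>2) * z) \<partial>lborel \<partial>lborel)"
      by (rule lborel_pair.Fubini'[symmetric]) measurable
    finally show "(\<integral>\<^sup>+y. \<integral>\<^sup>+z. g (z\<^sup>2 + y\<^sup>2 + ?Q x, \<rho> * z + y * \<xi> n) \<partial>lborel \<partial>lborel) =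
      (\<integral>\<^sup>+y. \<integral>\<^sup>+z. g (z\<^sup>2 + y\<^sup>2 + ?Q x, sqrt (\<rho>\<^sup>2 + (\<xi> n)\<^sup>2) * z) \<partial>lborel \<partial>lborel)"
      unfolding q_def .
  qed
  also have "\<dots> = (\<integral>\<^sup>+x. g (\<Sum>i<Suc n. (x i)\<^sup>2, sqrt (\<rho>\<^sup>2 + (\<xi> n)\<^sup>2) * x 0) \<partial>?R (Suc n))"
    by (rule split[symmetric]) measurable
  finally show ?case
    using 1 by (simp add: \<rho>)
qed

text \<open>Equality of the joint laws of radius and linear form carries the identity for
  nonnegative integrands over to complex ones.\<close>

lemma distr_PiM_rotate:
  fixes \<xi> :: "nat \<Rightarrow> real"
  assumes n: "n \<ge> 1"
  shows "distr (\<Pi>\<^sub>M i\<in>{..<n}. lborel) (borel \<Otimes>\<^sub>M borel) (\<lambda>x. (L2_set x {..<n}, \<Sum>i<n. x i * \<xi> i)) =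
    distr (\<Pi>\<^sub>M i\<in>{..<n}. lborel) (borel \<Otimes>\<^sub>M borel) (\<lambda>x. (L2_set x {..<n}, L2_set \<xi> {..<n} * x 0))"
    (is "?L = ?R")
proof (rule measure_eqI)
  have [measurable]: "(\<lambda>x. x 0) \<in> borel_measurable (\<Pi>\<^sub>M i\<in>{..<n}. (lborel::real measure))"
    using n by simp
  have [measurable]: "(\<lambda>x. \<Sum>i<n. x i * \<xi> i) \<in> borel_measurable (\<Pi>\<^sub>M i\<in>{..<n}. (lborel::real measure))"
    by (intro borel_measurable_sum borel_measurable_times measurable_PiM_lborel_coord) auto
  fix X assume "X \<in> sets ?L"
  then have [measurable]: "X \<in> sets (borel \<Otimes>\<^sub>M borel)" by simp
  have emeasure: "emeasure (distr M N f) X = (\<integral>\<^sup>+x. indicator X (f x) \<partial>M)"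
    if [measurable]: "f \<in> M \<rightarrow>\<^sub>M N" "X \<in> sets N" for M :: "(nat \<Rightarrow> real) measure" and N f
  proof -
    have "(\<integral>\<^sup>+x. indicator X (f x) \<partial>M) = (\<integral>\<^sup>+y. indicator X y \<partial>distr M N f)"
      by (rule nn_integral_distr[symmetric]) measurable
    then show ?thesis by simp
  qed
  have "(\<lambda>p. indicator X (sqrt (fst p), snd p) :: ennreal) \<in> borel_measurable (borel \<Otimes>\<^sub>M borel)"
    by measurable
  from nn_integral_PiM_rotate[OF n this, of \<xi>] show "emeasure ?L X = emeasure ?R X"
    by (subst (1 2) emeasure) (measurable, simp add: L2_set_def)
qed simp

text \<open>With the exponential for \<open>e\<close> this says that the Fourier transform of a
  radial function depends on the frequency only through its norm, the reason why
  \<open>multiradial_fourier\<close> has a well-defined value. It also allows every frequency to be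
  placed on the axis 0.\<close>

lemma integral_radial_plane_wave:
  fixes h :: "real \<Rightarrow> complex" and \<xi> :: "nat \<Rightarrow> real"
  assumes n: "n \<ge> 1" and [measurable]: "h \<in> borel_measurable borel"
    and [measurable]: "e \<in> borel_measurable borel"
  shows "(LINT x|(\<Pi>\<^sub>M i\<in>{..<n}. lborel). h (L2_set x {..<n}) * e (\<Sum>i<n. x i * \<xi> i)) =
    (LINT x|(\<Pi>\<^sub>M i\<in>{..<n}. lborel). h (L2_set x {..<n}) * e (L2_set \<xi> {..<n} * x 0))"
proof -
  have [measurable]: "(\<lambda>x. x 0) \<in> borel_measurable (\<Pi>\<^sub>M i\<in>{..<n}. (lborel::real measure))"
    using n by simp
  have [measurable]: "(\<lambda>x. \<Sum>i<n. x i * \<xi> i) \<in> borel_measurable (\<Pi>\<^sub>M i\<in>{..<n}. (lborel::real measure))"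
    by (intro borel_measurable_sum borel_measurable_times measurable_PiM_lborel_coord) auto
  have "(LINT x|(\<Pi>\<^sub>M i\<in>{..<n}. lborel). h (L2_set x {..<n}) * e (\<Sum>i<n. x i * \<xi> i)) =
    (LINT p|distr (\<Pi>\<^sub>M i\<in>{..<n}. lborel) (borel \<Otimes>\<^sub>M borel) (\<lambda>x. (L2_set x {..<n}, \<Sum>i<n. x i * \<xi> i)).
      h (fst p) * e (snd p))"
    by (subst integral_distr) auto
  also have "\<dots> = (LINT p|distr (\<Pi>\<^sub>M i\<in>{..<n}. lborel) (borel \<Otimes>\<^sub>M borel) (\<lambda>x. (L2_set x {..<n}, L2_set \<xi> {..<n} * x 0)).
      h (fst p) * e (snd p))"
    using distr_PiM_rotate[OF n, of \<xi>] by simp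
  also have "\<dots> = (LINT x|(\<Pi>\<^sub>M i\<in>{..<n}. lborel). h (L2_set x {..<n}) * e (L2_set \<xi> {..<n} * x 0))"
    by (subst integral_distr) auto
  finally show ?thesis .
qed

subsection \<open>The kernel of the dimension reduction\<close>

text \<open>Powers of \<open>1 + s\<close> instead of \<open>s\<close> control the radial density
  and all lower polynomial factors at once and increase with the exponent. The cut-off at 0 confines
  integrals over the whole line to the range of radii.\<close>

definition radial_weight :: "nat \<Rightarrow> real \<Rightarrow> ennreal" where
  "radial_weight p s = ennreal ((1 + s) ^ p * indicator {0..} s)"

lemma measurable_radial_weight[measurable]: "radial_weight p \<in> borel_measurable borel"
  unfolding radial_weight_def by measurable

lemma radial_weight_mono: "p \<le> q \<Longrightarrow> radial_weight p s \<le> radial_weight q s"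
  unfolding radial_weight_def by (intro ennreal_leI) (auto simp: indicator_def intro: power_increasing)

text \<open>The exponent budget of one block: \<open>n - 1\<close> is used by the radial density,
  \<open>a\<close> by the growth of the factor \<open>u\<close>.\<close>

lemma nn_integral_block_le:
  fixes f :: "real \<Rightarrow> ennreal" and u :: "(nat \<Rightarrow> real) \<Rightarrow> complex"
  assumes n: "n \<ge> 1" and p: "n - 1 + a \<le> p"
    and u: "\<And>x. norm (u x) \<le> C * (1 + L2_set x {..<n}) ^ a"
    and [measurable]: "f \<in> borel_measurable borel"
  shows "(\<integral>\<^sup>+x. f (L2_set x {..<n}) * ennreal (norm (u x)) \<partial>(\<Pi>\<^sub>M i\<in>{..<n}. lborel)) \<le>
    ennreal (C * (unit_ball_vol n * n)) * (\<integral>\<^sup>+s. f s * radial_weight p s \<partial>lborel)"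
proof -
  \<comment> \<open>The growth bound at the origin forces \<open>C\<close> to be
    nonnegative.\<close>
  have "norm (u (\<lambda>_. 0)) \<le> C" using u[of "\<lambda>_. 0"] by (simp add: L2_set_def)
  then have C: "C \<ge> 0" by (rule order_trans[OF norm_ge_zero])
  let ?R = "\<Pi>\<^sub>M i\<in>{..<n}. (lborel :: real measure)"
  let ?v = "unit_ball_vol (card {..<n})"
  have v: "?v \<ge> 0" by simp
  have "(\<integral>\<^sup>+x. f (L2_set x {..<n}) * ennreal (norm (u x)) \<partial>?R) \<le>
    (\<integral>\<^sup>+x. f (L2_set x {..<n}) * ennreal (C * (1 + L2_set x {..<n}) ^ a) \<partial>?R)"
    by (intro nn_integral_mono mult_left_mono ennreal_leI u) auto
  also have "\<dots> = (\<integral>\<^sup>+s. f s * ennreal (C * (1 + s) ^ a) \<partial>distr ?R borel (\<lambda>x. L2_set x {..<n}))"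
    by (subst nn_integral_distr) auto
  also have "\<dots> = (\<integral>\<^sup>+s. ennreal ((?v * (card {..<n} * s ^ (card {..<n} - 1))) * indicator {0..} s) *
      (f s * ennreal (C * (1 + s) ^ a)) \<partial>lborel)"
    using n by (subst distr_radius) (auto simp: nn_integral_density lessThan_empty_iff)
  also have "\<dots> \<le> (\<integral>\<^sup>+s. ennreal (C * (unit_ball_vol n * n)) * (f s * radial_weight p s) \<partial>lborel)"
  proof (rule nn_integral_mono)
    fix s :: real
    have "((?v * (card {..<n} * s ^ (card {..<n} - 1))) * indicator {0..} s) * (C * (1 + s) ^ a) \<le> 
      C * (unit_ball_vol n * n) * ((1 + s) ^ p * indicator {0..} s)"
    proof (cases "s \<ge> 0")
      case True
      have "s ^ (n - 1) * (1 + s) ^ a \<le> (1 + s) ^ (n - 1) * (1 + s) ^ a"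
        using True by (intro mult_right_mono power_mono) auto
      also have "\<dots> = (1 + s) ^ (n - 1 + a)" by (simp add: power_add)
      also have "\<dots> \<le> (1 + s) ^ p" using p True by (intro power_increasing) auto
      finally have "C * (unit_ball_vol n * n) * (s ^ (n - 1) * (1 + s) ^ a) \<le> C * (unit_ball_vol n * n) * (1 + s) ^ p"
        using C by (intro mult_left_mono) auto
      then show ?thesis using True by (simp add: mult_ac)
    qed simp
    then have "ennreal (((?v * (card {..<n} * s ^ (card {..<n} - 1))) * indicator {0..} s) * (C * (1 + s) ^ a)) \<le>
      ennreal (C * (unit_ball_vol n * n) * ((1 + s) ^ p * indicator {0..} s))"
      by (rule ennreal_leI)
    then have "ennreal ((?v * (card {..<n} * s ^ (card {..<n} - 1))) * indicator {0..} s) * ennreal (C * (1 + s) ^ a) \<le>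
      ennreal (C * (unit_ball_vol n * n)) * radial_weight p s"
      unfolding radial_weight_def using C
      by (auto simp: ennreal_mult'[symmetric] ennreal_mult''[symmetric] indicator_def split: if_splits)
    from mult_left_mono[OF this, of "f s"]
    show "ennreal ((?v * (card {..<n} * s ^ (card {..<n} - 1))) * indicator {0..} s) *
      (f s * ennreal (C * (1 + s) ^ a)) \<le> ennreal (C * (unit_ball_vol n * n)) * (f s * radial_weight p s)"
      by (simp add: mult_ac)
  qed
  also have "\<dots> = ennreal (C * (unit_ball_vol n * n)) * (\<integral>\<^sup>+s. f s * radial_weight p s \<partial>lborel)"
    by (rule nn_integral_cmult) measurable
  finally show ?thesis .
qed

lemma integrable_block:
  fixes h :: "real \<Rightarrow> complex" and u :: "(nat \<Rightarrow> real) \<Rightarrow> complex"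
  assumes n: "n \<ge> 1" and p: "n - 1 + a \<le> p"
    and u: "\<And>x. norm (u x) \<le> C * (1 + L2_set x {..<n}) ^ a"
    and [measurable]: "h \<in> borel_measurable borel" "u \<in> borel_measurable (\<Pi>\<^sub>M i\<in>{..<n}. lborel)"
    and fin: "(\<integral>\<^sup>+s. ennreal (norm (h s)) * radial_weight p s \<partial>lborel) < \<infinity>"
  shows "integrable (\<Pi>\<^sub>M i\<in>{..<n}. lborel) (\<lambda>x. h (L2_set x {..<n}) * u x)"
proof (rule integrableI_bounded)
  have "(\<integral>\<^sup>+x. ennreal (norm (h (L2_set x {..<n}) * u x)) \<partial>(\<Pi>\<^sub>M i\<in>{..<n}. lborel)) \<le>
    ennreal (C * (unit_ball_vol n * n)) * (\<integral>\<^sup>+s. ennreal (norm (h s)) * radial_weight p s \<partial>lborel)"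
    using nn_integral_block_le[OF n p u, of "\<lambda>s. ennreal (norm (h s))"]
    by (simp add: norm_mult ennreal_mult)
  also have "\<dots> < \<infinity>" using fin by (simp add: ennreal_mult_less_top)
  finally show "(\<integral>\<^sup>+x. ennreal (norm (h (L2_set x {..<n}) * u x)) \<partial>(\<Pi>\<^sub>M i\<in>{..<n}. lborel)) < \<infinity>" .
qed measurable

text \<open>The factor \<open>(-2 pi i y) ^ l\<close> is what the \<open>l\<close>-th derivative in
  \<open>r\<close> brings down from the exponential, so for positive \<open>k\<close> this is the
  differential expression of the theorem, without the powers of \<open>2 pi\<close>, applied to
  \<open>exp (-2 pi i r y)\<close>. The case \<open>k = 0\<close> is separate because the sum would
  be empty.\<close>

definition radial_kernel :: "nat \<Rightarrow> real \<Rightarrow> real \<Rightarrow> complex" where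
  "radial_kernel k r y = (if k = 0 then 1
     else \<Sum>l=1..k. complex_of_real (coeff k l / r ^ (2 * k - l)) * (- 2 * complex_of_real pi * \<i> * complex_of_real y) ^ l) *
     exp (- 2 * complex_of_real pi * \<i> * complex_of_real (r * y))"

lemma norm_exp_imaginary[simp]: "norm (exp (- 2 * complex_of_real pi * \<i> * complex_of_real x)) = 1"
  by (simp add: norm_exp_eq_Re)

lemma measurable_radial_kernel[measurable]: "radial_kernel k r \<in> borel_measurable borel"
  unfolding radial_kernel_def by (cases "k = 0"; simp; measurable)

lemma norm_radial_kernel_le:
  obtains C where "\<And>y. norm (radial_kernel k r y) \<le> C * (1 + \<bar>y\<bar>) ^ k"
proof
  fix y
  \<comment> \<open>The summand 1 serves \<open>k = 0\<close>, where the sum is empty and the kernel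
    has modulus one.\<close>
  let ?C = "1 + (\<Sum>l=1..k. \<bar>coeff k l / r ^ (2 * k - l)\<bar> * (2 * pi) ^ l)"
  show "norm (radial_kernel k r y) \<le> ?C * (1 + \<bar>y\<bar>) ^ k"
  proof (cases "k = 0")
    case True
    then show ?thesis by (simp add: radial_kernel_def)
  next
    case False
    have "norm (radial_kernel k r y) = norm (\<Sum>l=1..k. complex_of_real (coeff k l / r ^ (2 * k - l)) *
        (- 2 * complex_of_real pi * \<i> * complex_of_real y) ^ l)"
      using False by (simp only: radial_kernel_def norm_mult norm_exp_imaginary if_False mult_1_right)
    also have "\<dots> \<le> (\<Sum>l=1..k. norm (complex_of_real (coeff k l / r ^ (2 * k - l)) *
        (- 2 * complex_of_real pi * \<i> * complex_of_real y) ^ l))"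
      by (rule norm_sum)
    also have "\<dots> \<le> (\<Sum>l=1..k. (\<bar>coeff k l / r ^ (2 * k - l)\<bar> * (2 * pi) ^ l) * (1 + \<bar>y\<bar>) ^ k)"
    proof (rule sum_mono)
      fix l assume l: "l \<in> {1..k}"
      have "\<bar>y\<bar> ^ l \<le> (1 + \<bar>y\<bar>) ^ l" by (intro power_mono) auto
      also have "\<dots> \<le> (1 + \<bar>y\<bar>) ^ k" using l by (intro power_increasing) auto
      finally have "(\<bar>coeff k l / r ^ (2 * k - l)\<bar> * (2 * pi) ^ l) * \<bar>y\<bar> ^ l \<le>
        (\<bar>coeff k l / r ^ (2 * k - l)\<bar> * (2 * pi) ^ l) * (1 + \<bar>y\<bar>) ^ k"
        by (intro mult_left_mono) auto
      then show "norm (complex_of_real (coeff k l / r ^ (2 * k - l)) *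
        (- 2 * complex_of_real pi * \<i> * complex_of_real y) ^ l) \<le>
        (\<bar>coeff k l / r ^ (2 * k - l)\<bar> * (2 * pi) ^ l) * (1 + \<bar>y\<bar>) ^ k"
        by (simp add: norm_mult norm_power norm_divide power_mult_distrib power_abs mult_ac)
    qed
    also have "\<dots> \<le> ?C * (1 + \<bar>y\<bar>) ^ k"
      unfolding sum_distrib_right[symmetric] by (intro mult_right_mono) auto
    finally show ?thesis .
  qed
qed

section \<open>Recurrences for the coefficients\<close>

text \<open>This compares the terms of degree \<open>l\<close> in the derivative of polynomial times
  exponential: the first summand comes from differentiating \<open>y ^ (l + 1)\<close>, the second
  from the exponential. After cancelling factorials it reduces to
  \<open>2 * k - l = 2 * (k - l) + l\<close>.\<close>

lemma coeff_Suc_Suc: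
  assumes "1 \<le> l" "l < k"
  shows "real (l + 1) * coeff (Suc k) (l + 2) + coeff (Suc k) (l + 1) = - coeff k l"
proof -
  obtain d where k: "k = Suc (l + d)" using assms(2) less_imp_Suc_add by blast
  obtain i where l: "l = Suc i" using assms(1) by (cases l) auto
  define F where "F = (fact (2 * k - l - 1) :: real)"
  have e: "2 * Suc k - (l + 2) - 1 = 2 * k - l - 1" "2 * Suc k - (l + 1) - 1 = Suc (2 * k - l - 1)"
    "Suc k - (l + 2) = d" "Suc k - (l + 1) = Suc d" "k - l = Suc d" "l + 2 - 1 = Suc l" "l + 1 - 1 = l" "l - 1 = i"
    using assms k l by auto
  have f: "(fact (Suc (2 * k - l - 1)) :: real) = real (2 * k - l) * F"
    using assms unfolding F_def fact_Suc by simp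
  have g: "real (2 * k - l) = 2 * real (Suc d) + real l" using k by simp
  have [simp]: "fact (Suc d) = real (Suc d) * (fact d :: real)" "fact (Suc l) = real (Suc l) * (fact l :: real)"
     "fact l = real l * (fact i :: real)"
    using l by simp_all
  have pos: "real (Suc l) \<noteq> 0" "real l \<noteq> 0" "real (Suc d) \<noteq> 0" using l by auto
  have p1: "(-1::real) ^ (l + 2) = (-1) ^ l" "(-1::real) ^ (l + 1) = - ((-1) ^ l)" by simp_all
  define s where "s = (-1::real) ^ l"
  have t1: "coeff (Suc k) (l + 2) = s * F / (2 ^ d * fact d * fact (Suc l))"
    unfolding coeff_def e p1 F_def s_def ..
  have t2: "coeff (Suc k) (l + 1) = - (s * (real (2 * k - l) * F)) / (2 ^ Suc d * fact (Suc d) * fact l)"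
    unfolding coeff_def e p1 s_def f by (simp only: mult_minus_left)
  have t3: "coeff k l = s * F / (2 ^ Suc d * fact (Suc d) * fact i)"
    unfolding coeff_def e s_def F_def ..
  show ?thesis unfolding t1 t2 t3 g
    using pos by (simp del: of_nat_Suc fact_Suc add: divide_simps) (simp add: algebra_simps)
qed

text \<open>The term of degree 0: for \<open>k \<ge> 1\<close> the polynomial of the kernel has no
  constant term, so the two contributions must cancel.\<close>

lemma coeff_Suc_1:
  assumes "k \<ge> 1"
  shows "coeff (Suc k) 2 + coeff (Suc k) 1 = 0"
proof -
  obtain d where d: "k = Suc d" using assms by (cases k) auto
  define F where "F = (fact (Suc (2 * d)) :: real)"
  have e: "2 * Suc k - 2 - 1 = Suc (2 * d)" "2 * Suc k - 1 - 1 = Suc (Suc (2 * d))" "Suc k - 2 = d" "Suc k - 1 = Suc d"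
    using d by auto
  have f: "fact (Suc (Suc (2 * d))) = real (Suc (Suc (2 * d))) * F" unfolding F_def fact_Suc[of "Suc (2 * d)"] by simp
  show ?thesis unfolding coeff_def e f F_def[symmetric]
    by (simp add: divide_simps)
qed

text \<open>The term of degree \<open>k\<close>, the highest one: here only the derivative of the
  exponential contributes.\<close>

lemma coeff_Suc_top:
  assumes "k \<ge> 1"
  shows "coeff (Suc k) (Suc k) = - coeff k k"
proof -
  obtain d where d: "k = Suc d" using assms by (cases k) auto
  show ?thesis unfolding coeff_def d by (simp del: fact_Suc)
qed

text \<open>The next kernel divided by \<open>y\<close>, with the division carried out in the
  polynomial so that \<open>y = 0\<close> is not exceptional. Up to the constant
  \<open>(2 * pi)\<^sup>2\<close> it is an antiderivative of
  \<open>radial_kernel k r\<close>.\<close>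

definition radial_primitive :: "nat \<Rightarrow> real \<Rightarrow> real \<Rightarrow> complex" where
  "radial_primitive k r y =
     (\<Sum>l<Suc k. complex_of_real (coeff (Suc k) (Suc l) / r ^ (2 * Suc k - Suc l)) *
        (- 2 * complex_of_real pi * \<i>) ^ Suc l * complex_of_real y ^ l) *
     exp (- 2 * complex_of_real pi * \<i> * complex_of_real (r * y))"

lemma radial_kernel_Suc: "radial_kernel (Suc k) r y = complex_of_real y * radial_primitive k r y"
proof -
  have "(\<Sum>l=1..Suc k. complex_of_real (coeff (Suc k) l / r ^ (2 * Suc k - l)) *
      (- 2 * complex_of_real pi * \<i> * complex_of_real y) ^ l) =
    (\<Sum>l<Suc k. complex_of_real (coeff (Suc k) (Suc l) / r ^ (2 * Suc k - Suc l)) *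
      (- 2 * complex_of_real pi * \<i> * complex_of_real y) ^ Suc l)"
    by (rule sum.reindex_bij_witness[of _ Suc "\<lambda>l. l - 1"]) auto
  also have "\<dots> = complex_of_real y * (\<Sum>l<Suc k. complex_of_real (coeff (Suc k) (Suc l) / r ^ (2 * Suc k - Suc l)) *
        (- 2 * complex_of_real pi * \<i>) ^ Suc l * complex_of_real y ^ l)"
    unfolding sum_distrib_left power_mult_distrib[of "- 2 * complex_of_real pi * \<i>" "complex_of_real y"]
    by (intro sum.cong) (simp_all only: power_Suc mult_ac)
  finally show ?thesis
    unfolding radial_kernel_def radial_primitive_def by (simp only: nat.simps if_False mult.assoc)
qed

text \<open>
  The differential operator \<open>-r\<^sup>-\<^sup>1 d/dr\<close>, whose \<open>k\<close>-th power turns the exponential into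
  \<^const>\<open>radial_kernel\<close>, commutes with \<open>d/dy\<close>; on coefficients this is \<open>coeff_Suc_Suc\<close>.
\<close>

lemma has_vector_derivative_radial_primitive:
  assumes r: "r > 0"
  shows "(radial_primitive k r has_vector_derivative
    complex_of_real ((2 * pi)\<^sup>2) * radial_kernel k r y) (at y within S)"
proof -
  define c where "c = - 2 * complex_of_real pi * \<i>"
  define a where "a l = complex_of_real (coeff (Suc k) l / r ^ (2 * Suc k - l)) * c ^ l" for l
  define b where "b l = complex_of_real (coeff k l / r ^ (2 * k - l)) * c ^ l" for l
  define Y where "Y = complex_of_real y"
  define K where "K = (if k = 0 then 1 else \<Sum>l=1..k. b l * Y ^ l)"
  define P where "P = (\<lambda>z. \<Sum>l<Suc k. a (Suc l) * z ^ l)"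
  define P' where "P' = (\<Sum>l<Suc k. a (Suc l) * (of_nat l * Y ^ (l - 1)))"
  have c2: "c\<^sup>2 = - complex_of_real ((2 * pi)\<^sup>2)"
    unfolding c_def by (simp add: power2_eq_square)
  have prim: "radial_primitive k r = (\<lambda>z. P (complex_of_real z) * exp (c * complex_of_real r * complex_of_real z))"
    unfolding radial_primitive_def P_def a_def c_def by (rule ext) (simp add: mult_ac)
  have kern: "radial_kernel k r y = K * exp (c * complex_of_real r * Y)"
    unfolding radial_kernel_def K_def b_def Y_def c_def[symmetric] power_mult_distrib[of c]
    by (simp add: mult_ac)
  \<comment> \<open>With the exponential cancelled, the claim is an identity of polynomials in
    \<open>y\<close>. For \<open>k \<ge> 1\<close> its inner, constant and leading coefficients are
    the three recurrences.\<close>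
  have key: "P' + c * complex_of_real r * P Y = - c\<^sup>2 * K"
  proof (cases "k = 0")
    case True
    then show ?thesis
      using r unfolding P'_def P_def K_def a_def by (simp add: coeff_def power2_eq_square)
  next
    case False
    have rec: "a (l + 2) * of_nat (l + 1) + c * complex_of_real r * a (l + 1) = - c\<^sup>2 * b l"
      if l: "1 \<le> l" "l < k" for l
    proof -
      have p: "r ^ (2 * Suc k - (l + 2)) = r ^ (2 * k - l)" "r ^ (2 * Suc k - (l + 1)) = r * r ^ (2 * k - l)"
        using l by (simp_all add: power_Suc[symmetric] Suc_diff_le del: power_Suc)
      have "a (l + 2) * of_nat (l + 1) + c * complex_of_real r * a (l + 1) =
        complex_of_real ((real (l + 1) * coeff (Suc k) (l + 2) + coeff (Suc k) (l + 1)) / r ^ (2 * k - l)) * c ^ (l + 2)"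
        unfolding a_def p using r by (simp add: add_divide_distrib ring_distribs power2_eq_square mult_ac)
      also have "\<dots> = - c\<^sup>2 * b l"
        unfolding coeff_Suc_Suc[OF l] b_def by (simp add: power_add power2_eq_square)
      finally show ?thesis .
    qed
    have rec0: "a 2 + c * complex_of_real r * a 1 = 0"
    proof -
      have p: "r ^ (2 * Suc k - 2) = r ^ (2 * k)" "r ^ (2 * Suc k - 1) = r * r ^ (2 * k)"
        by simp_all
      have "a 2 + c * complex_of_real r * a 1 =
        complex_of_real ((coeff (Suc k) 2 + coeff (Suc k) 1) / r ^ (2 * k)) * c ^ 2"
        unfolding a_def p using r by (simp add: add_divide_distrib ring_distribs power2_eq_square mult_ac)
      then show ?thesis using False by (subst (asm) coeff_Suc_1) simp_all
    qed
    have top: "c * complex_of_real r * a (Suc k) = - c\<^sup>2 * b k"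
    proof -
      have p: "r ^ (2 * Suc k - Suc k) = r * r ^ (2 * k - k)"
        by (simp add: power_Suc[symmetric] del: power_Suc)
      show ?thesis unfolding a_def b_def p using r False
        by (simp add: coeff_Suc_top power2_eq_square mult_ac)
    qed
    have P': "P' = (\<Sum>l<k. a (l + 2) * of_nat (l + 1) * Y ^ l)"
      unfolding P'_def by (subst sum.lessThan_Suc_shift) (simp add: mult_ac)
    have "P' + c * complex_of_real r * P Y =
      (\<Sum>l<k. (a (l + 2) * of_nat (l + 1) + c * complex_of_real r * a (l + 1)) * Y ^ l) +
      c * complex_of_real r * a (Suc k) * Y ^ k"
      unfolding P' P_def by (simp add: sum_distrib_left sum.distrib[symmetric] ring_distribs mult_ac)
    also have "{..<k} = insert 0 {1..<k}" using False by auto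
    also have "(\<Sum>l\<in>\<dots>. (a (l + 2) * of_nat (l + 1) + c * complex_of_real r * a (l + 1)) * Y ^ l) =
      (\<Sum>l\<in>{1..<k}. (a (l + 2) * of_nat (l + 1) + c * complex_of_real r * a (l + 1)) * Y ^ l)"
      using rec0 by (simp add: numeral_2_eq_2)
    also have "\<dots> = (\<Sum>l\<in>{1..<k}. - c\<^sup>2 * b l * Y ^ l)"
      by (intro sum.cong refl arg_cong2[where f="(*)"] rec) auto
    also have "\<dots> + c * complex_of_real r * a (Suc k) * Y ^ k = (\<Sum>l=1..k. - c\<^sup>2 * b l * Y ^ l)"
    proof -
      have "{1..k} = insert k {1..<k}" using False by auto
      then show ?thesis by (simp add: top)
    qed
    also have "\<dots> = - c\<^sup>2 * K"
      using False unfolding K_def by (simp add: sum_distrib_left mult_ac)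
    finally show ?thesis .
  qed
  have "((\<lambda>z. P z * exp (c * complex_of_real r * z)) has_field_derivative
      (P' + c * complex_of_real r * P Y) * exp (c * complex_of_real r * Y)) (at Y)"
    unfolding P_def P'_def
    by (auto intro!: derivative_eq_intros simp: sum_distrib_left sum_distrib_right sum.distrib algebra_simps)
  then have "((\<lambda>z. P (complex_of_real z) * exp (c * complex_of_real r * complex_of_real z)) has_vector_derivative
      (P' + c * complex_of_real r * P Y) * exp (c * complex_of_real r * Y)) (at y within S)"
    unfolding Y_def by (rule has_vector_derivative_real_field[THEN has_vector_derivative_at_within])
  then show ?thesis
    unfolding prim kern key c2 by (simp add: mult.assoc)
qed

lemma integral_radial_kernel:
  assumes r: "r > 0" and v: "v \<ge> 0"
  shows "(LINT y|lborel. indicator {-v..v} y *\<^sub>R radial_kernel k r y) =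
    (radial_primitive k r v - radial_primitive k r (- v)) / complex_of_real ((2 * pi)\<^sup>2)"
proof -
  have "continuous_on {-v..v} (\<lambda>y. complex_of_real ((2 * pi)\<^sup>2) * radial_kernel k r y)"
    unfolding radial_kernel_def using r by (cases "k = 0") (auto intro!: continuous_intros)
  then have "(LINT y|lborel. indicator {-v..v} y *\<^sub>R (complex_of_real ((2 * pi)\<^sup>2) * radial_kernel k r y)) =
    radial_primitive k r v - radial_primitive k r (- v)"
    using v by (intro integral_FTC_Icc has_vector_derivative_radial_primitive r) auto
  moreover have "(LINT y|lborel. indicator {-v..v} y *\<^sub>R (complex_of_real ((2 * pi)\<^sup>2) * radial_kernel k r y)) =
    complex_of_real ((2 * pi)\<^sup>2) * (LINT y|lborel. indicator {-v..v} y *\<^sub>R radial_kernel k r y)"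
    by (subst integral_mult_right_zero[symmetric]) (simp add: mult_ac scaleR_conv_of_real)
  ultimately show ?thesis
    by (simp add: field_simps)
qed

section \<open>Folding the line onto the half-line\<close>

lemma distr_abs_lborel:
  "distr lborel borel (\<lambda>x::real. \<bar>x\<bar>) = density lborel (\<lambda>v. ennreal (2 * indicator {0..} v))"
    (is "?L = ?R")
proof (rule measure_eqI_atMost)
  fix b :: real
  have "emeasure ?L {..b} = emeasure lborel {-b..b}"
    by (subst emeasure_distr) (auto intro!: arg_cong2[where f=emeasure])
  moreover have "emeasure ?R {..b} = (if 0 \<le> b then ennreal (2 * b - 2 * 0) else 0)"
    by (intro emeasure_density_FTC) (auto intro!: derivative_eq_intros)
  ultimately show "emeasure ?L {..b} = emeasure ?R {..b}" "emeasure ?L {..b} < \<infinity>"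
    by (auto simp: emeasure_lborel_Icc_eq)
qed auto

text \<open>Averaging with the reflected integrand leaves a function of
  \<open>\<bar>y\<bar>\<close>. The combination \<open>g v + g (- v)\<close> is the form in which
  the exchange of integrals in the descent step delivers the next kernel.\<close>

lemma integral_abs_symmetrize:
  fixes h g :: "real \<Rightarrow> complex"
  assumes [measurable]: "h \<in> borel_measurable borel" "g \<in> borel_measurable borel"
    and int: "integrable lborel (\<lambda>y. h \<bar>y\<bar> * g y)"
  shows "(LINT y|lborel. h \<bar>y\<bar> * g y) = (LINT v|lborel. indicator {0..} v *\<^sub>R (h v * (g v + g (- v))))"
proof -
  have int': "integrable lborel (\<lambda>y. h \<bar>y\<bar> * g (- y))"
    using lborel_integrable_real_affine[OF int, of "-1" 0] by simp
  have "(LINT y|lborel. h \<bar>y\<bar> * g y) = (LINT y|lborel. h \<bar>y\<bar> * g (- y))"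
    using lborel_integral_real_affine[of "-1" "\<lambda>y. h \<bar>y\<bar> * g y" 0] by simp
  then have "2 * (LINT y|lborel. h \<bar>y\<bar> * g y) = (LINT y|lborel. h \<bar>y\<bar> * g y + h \<bar>y\<bar> * g (- y))"
    using int int' by simp
  also have "\<dots> = (LINT y|lborel. h \<bar>y\<bar> * (g \<bar>y\<bar> + g (- \<bar>y\<bar>)))"
    by (intro Bochner_Integration.integral_cong) (auto simp: abs_if ring_distribs)
  also have "\<dots> = (LINT v|distr lborel borel (\<lambda>x::real. \<bar>x\<bar>). h v * (g v + g (- v)))"
    by (subst integral_distr) auto
  also have "\<dots> = (LINT v|lborel. (2 * indicator {0..} v) *\<^sub>R (h v * (g v + g (- v))))"
    unfolding distr_abs_lborel by (subst integral_density) auto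
  also have "\<dots> = 2 * (LINT v|lborel. indicator {0..} v *\<^sub>R (h v * (g v + g (- v))))"
    by (subst integral_mult_right_zero[symmetric]) (simp add: scaleR_conv_of_real mult_ac)
  finally show ?thesis by simp
qed

subsection \<open>Dimension reduction in one block\<close>

lemma L2_set_merge:
  assumes "I \<inter> J = {}" "finite I" "finite J"
  shows "L2_set (merge I J (x, y)) (I \<union> J) = sqrt ((L2_set x I)\<^sup>2 + (L2_set y J)\<^sup>2)"
proof -
  have "(\<Sum>i\<in>I \<union> J. (merge I J (x, y) i)\<^sup>2) = (\<Sum>i\<in>I. (x i)\<^sup>2) + (\<Sum>i\<in>J. (y i)\<^sup>2)"
    using assms by (subst sum.union_disjoint) (auto intro!: arg_cong2[where f="(+)"] sum.cong simp: merge_def)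
  then show ?thesis by (simp add: L2_set_def sum_nonneg)
qed

text \<open>
  The profile in \<open>n\<close> variables that remains when a radial function of \<open>n + 2\<close> variables is
  integrated over two of them.
\<close>

definition descent :: "(real \<Rightarrow> complex) \<Rightarrow> real \<Rightarrow> complex" where
  "descent h s = (LINT v|lborel. (2 * pi * v * indicator {s..} v) *\<^sub>R h v)"

lemma measurable_descent_integrand:
  "(\<lambda>p. 2 * pi * snd p * indicator {fst p..} (snd p) :: real) \<in> borel_measurable (borel \<Otimes>\<^sub>M borel)"
proof -
  have "(\<lambda>p. 2 * pi * snd p * indicator {fst p..} (snd p) :: real) =
    (\<lambda>p. if fst p \<le> snd p then 2 * pi * snd p else 0)"
    by (auto simp: indicator_def)
  then show ?thesis by simp
qed

lemma measurable_descent[measurable]: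
  assumes [measurable]: "h \<in> borel_measurable borel"
  shows "descent h \<in> borel_measurable borel"
  unfolding descent_def
proof (rule lborel.borel_measurable_lebesgue_integral)
  have "(\<lambda>p. (2 * pi * snd p * indicator {fst p..} (snd p)) *\<^sub>R h (snd p)) \<in> borel_measurable (borel \<Otimes>\<^sub>M borel)"
    by (intro borel_measurable_scaleR measurable_descent_integrand) measurable
  then show "(\<lambda>(s, v). (2 * pi * v * indicator {s..} v) *\<^sub>R h v) \<in> borel_measurable (borel \<Otimes>\<^sub>M lborel)"
    by (simp add: split_beta' cong: measurable_cong_sets)
qed

lemma integral_plane_descent:
  fixes A :: "nat set"
  assumes A: "card A = 2" and s: "s \<ge> 0" and [measurable]: "h \<in> borel_measurable borel"
  shows "(LINT z|(\<Pi>\<^sub>M i\<in>A. lborel). h (sqrt (s\<^sup>2 + (L2_set z A)\<^sup>2))) = descent h s"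
proof -
  have "(LINT z|(\<Pi>\<^sub>M i\<in>A. lborel). h (sqrt (s\<^sup>2 + (L2_set z A)\<^sup>2))) =
    (LINT v|distr (\<Pi>\<^sub>M i\<in>A. lborel) borel (\<lambda>z. sqrt (s\<^sup>2 + (L2_set z A)\<^sup>2)). h v)"
    by (subst integral_distr) auto
  also have "\<dots> = descent h s"
    unfolding distr_radius_plane[OF A s] descent_def using s
    by (subst integral_density) (auto simp: indicator_def)
  finally show ?thesis .
qed

text \<open>With the frequency on the axis 0, the factor \<open>u (x 0)\<close> is untouched when
  the last two coordinates are integrated out; \<open>n \<ge> 1\<close> keeps coordinate 0 among the
  remaining ones.\<close>

lemma integral_block_descent:
  fixes n :: nat and h :: "real \<Rightarrow> complex" and u :: "real \<Rightarrow> complex"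
  assumes n: "n \<ge> 1" and [measurable]: "h \<in> borel_measurable borel" "u \<in> borel_measurable borel"
    and int: "integrable (\<Pi>\<^sub>M i\<in>{..<n+2}. lborel) (\<lambda>x. h (L2_set x {..<n+2}) * u (x 0))"
  shows "(LINT x|(\<Pi>\<^sub>M i\<in>{..<n+2}. lborel). h (L2_set x {..<n+2}) * u (x 0)) =
    (LINT x|(\<Pi>\<^sub>M i\<in>{..<n}. lborel). descent h (L2_set x {..<n}) * u (x 0))"
proof -
  let ?A = "{n, Suc n}"
  have U: "{..<n+2} = {..<n} \<union> ?A" "{..<n} \<inter> ?A = {}" by auto
  have "(LINT x|(\<Pi>\<^sub>M i\<in>{..<n+2}. lborel). h (L2_set x {..<n+2}) * u (x 0)) =
    (LINT x|(\<Pi>\<^sub>M i\<in>{..<n}. lborel). LINT z|(\<Pi>\<^sub>M i\<in>?A. lborel).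
      h (L2_set (merge {..<n} ?A (x, z)) ({..<n} \<union> ?A)) * u (merge {..<n} ?A (x, z) 0))"
    unfolding U(1) using int unfolding U(1)
    by (intro lborel_product.product_integral_fold) auto
  also have "\<dots> = (LINT x|(\<Pi>\<^sub>M i\<in>{..<n}. lborel). LINT z|(\<Pi>\<^sub>M i\<in>?A. lborel).
      h (sqrt ((L2_set x {..<n})\<^sup>2 + (L2_set z ?A)\<^sup>2)) * u (x 0))"
    using n by (subst L2_set_merge) (auto simp: merge_def)
  also have "\<dots> = (LINT x|(\<Pi>\<^sub>M i\<in>{..<n}. lborel). descent h (L2_set x {..<n}) * u (x 0))"
  proof (intro Bochner_Integration.integral_cong refl)
    fix x :: "nat \<Rightarrow> real"
    have "(LINT z|(\<Pi>\<^sub>M i\<in>?A. lborel). h (sqrt ((L2_set x {..<n})\<^sup>2 + (L2_set z ?A)\<^sup>2))) = descent h (L2_set x {..<n})"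
      by (rule integral_plane_descent) auto
    then show "(LINT z|(\<Pi>\<^sub>M i\<in>?A. lborel). h (sqrt ((L2_set x {..<n})\<^sup>2 + (L2_set z ?A)\<^sup>2)) * u (x 0)) =
      descent h (L2_set x {..<n}) * u (x 0)"
      unfolding integral_mult_left_zero by (simp only:)
  qed
  finally show ?thesis .
qed

text \<open>A descent costs two powers of the weight: one for the area factor \<open>v\<close>, one
  for the length of the interval of those \<open>s\<close> that lie below \<open>v\<close>.\<close>

lemma nn_integral_descent_le:
  assumes [measurable]: "h \<in> borel_measurable borel"
  shows "(\<integral>\<^sup>+s. ennreal (norm (descent h s)) * radial_weight p s \<partial>lborel) \<le>
    ennreal (2 * pi) * (\<integral>\<^sup>+v. ennreal (norm (h v)) * radial_weight (p + 2) v \<partial>lborel)"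
proof -
  let ?K = "\<lambda>s v. ennreal (2 * pi * v * indicator {s..} v) * ennreal (norm (h v)) * radial_weight p s"
  have [measurable]: "(\<lambda>(s, v). ?K s v) \<in> borel_measurable (lborel \<Otimes>\<^sub>M lborel)"
    using measurable_descent_integrand by (simp add: split_beta' cong: measurable_cong_sets)
  have "(\<integral>\<^sup>+s. ennreal (norm (descent h s)) * radial_weight p s \<partial>lborel) \<le> (\<integral>\<^sup>+s. \<integral>\<^sup>+v. ?K s v \<partial>lborel \<partial>lborel)"
  proof (rule nn_integral_mono)
    fix s :: real
    show "ennreal (norm (descent h s)) * radial_weight p s \<le> (\<integral>\<^sup>+v. ?K s v \<partial>lborel)"
    proof (cases "s \<ge> 0")
      case True
      have "ennreal (norm (descent h s)) \<le> (\<integral>\<^sup>+v. ennreal (norm ((2 * pi * v * indicator {s..} v) *\<^sub>R h v)) \<partial>lborel)"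
        unfolding descent_def
      \<comment> \<open>Without integrability the integral is 0 by convention and the bound is
        trivial.\<close>
      proof (cases "integrable lborel (\<lambda>v. (2 * pi * v * indicator {s..} v) *\<^sub>R h v)")
        case True
        then show "ennreal (norm (LINT v|lborel. (2 * pi * v * indicator {s..} v) *\<^sub>R h v)) \<le>
          (\<integral>\<^sup>+v. ennreal (norm ((2 * pi * v * indicator {s..} v) *\<^sub>R h v)) \<partial>lborel)"
          by (rule integral_norm_bound_ennreal)
      qed (simp add: not_integrable_integral_eq)
      also have "\<dots> = (\<integral>\<^sup>+v. ennreal (2 * pi * v * indicator {s..} v) * ennreal (norm (h v)) \<partial>lborel)"
        using True by (intro nn_integral_cong) (auto simp: indicator_def ennreal_mult' abs_mult)
      finally have "ennreal (norm (descent h s)) * radial_weight p s \<le>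
        (\<integral>\<^sup>+v. ennreal (2 * pi * v * indicator {s..} v) * ennreal (norm (h v)) \<partial>lborel) * radial_weight p s"
        by (rule mult_right_mono) simp
      also have "\<dots> = (\<integral>\<^sup>+v. ?K s v \<partial>lborel)"
        by (subst nn_integral_multc) auto
      finally show ?thesis .
    qed (simp add: radial_weight_def)
  qed
  also have "\<dots> = (\<integral>\<^sup>+v. \<integral>\<^sup>+s. ?K s v \<partial>lborel \<partial>lborel)"
    by (rule lborel_pair.Fubini'[symmetric]) measurable
  also have "\<dots> \<le> (\<integral>\<^sup>+v. ennreal (2 * pi) * (ennreal (norm (h v)) * radial_weight (p + 2) v) \<partial>lborel)"
  proof (rule nn_integral_mono)
    fix v :: real
    let ?c = "ennreal (2 * pi) * (ennreal (norm (h v)) * ennreal ((1 + v) ^ (p + 1) * indicator {0..} v))"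
    have "(\<integral>\<^sup>+s. ?K s v \<partial>lborel) \<le> (\<integral>\<^sup>+s. ?c * indicator {0..v} s \<partial>lborel)"
    proof (rule nn_integral_mono)
      fix s :: real
      show "?K s v \<le> ?c * indicator {0..v} s"
      proof (cases "0 \<le> s \<and> s \<le> v")
        case True
        have "v * (1 + s) ^ p \<le> (1 + v) * (1 + v) ^ p"
          using True by (intro mult_mono power_mono) auto
        then have "2 * pi * v * (norm (h v) * (1 + s) ^ p) \<le> 2 * pi * (norm (h v) * (1 + v) ^ (p + 1))"
          using mult_left_mono[of "v * (1 + s) ^ p" "(1 + v) * (1 + v) ^ p" "2 * pi * norm (h v)"]
          by (simp add: mult_ac)
        then show ?thesis using True
          by (simp add: radial_weight_def ennreal_mult[symmetric] mult.assoc ennreal_leI)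
      qed (auto simp: radial_weight_def indicator_def)
    qed
    also have "\<dots> = ?c * emeasure lborel {0..v}"
      by (rule nn_integral_cmult_indicator) simp
    also have "\<dots> \<le> ennreal (2 * pi) * (ennreal (norm (h v)) * radial_weight (p + 2) v)"
    proof (cases "v \<ge> 0")
      case True
      have "(1 + v) ^ (p + 1) * v \<le> (1 + v) ^ (p + 2)"
        using True mult_left_mono[of v "1 + v" "(1 + v) ^ (p + 1)"] by (simp add: mult_ac)
      then have "2 * pi * (norm (h v) * ((1 + v) ^ (p + 1) * v)) \<le> 2 * pi * (norm (h v) * (1 + v) ^ (p + 2))"
        by (intro mult_left_mono) auto
      then show ?thesis using True
        by (simp add: radial_weight_def ennreal_mult[symmetric] mult.assoc ennreal_leI del: power_Suc)
    qed simp
    finally show "(\<integral>\<^sup>+s. ?K s v \<partial>lborel) \<le> ennreal (2 * pi) * (ennreal (norm (h v)) * radial_weight (p + 2) v)" .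
  qed
  also have "\<dots> = ennreal (2 * pi) * (\<integral>\<^sup>+v. ennreal (norm (h v)) * radial_weight (p + 2) v \<partial>lborel)"
    by (rule nn_integral_cmult) measurable
  finally show ?thesis .
qed

lemma integrable_abs_line:
  fixes h u :: "real \<Rightarrow> complex"
  assumes u: "\<And>y. norm (u y) \<le> C * (1 + \<bar>y\<bar>) ^ p"
    and [measurable]: "h \<in> borel_measurable borel" "u \<in> borel_measurable borel"
    and fin: "(\<integral>\<^sup>+s. ennreal (norm (h s)) * radial_weight p s \<partial>lborel) < \<infinity>"
  shows "integrable lborel (\<lambda>y. h \<bar>y\<bar> * u y)"
proof -
  have "integrable (\<Pi>\<^sub>M i\<in>{..<1::nat}. lborel) (\<lambda>x. h (L2_set x {..<1}) * u (x 0))"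
    using u fin
    by (intro integrable_block[where a=p and C=C and p=p and u="\<lambda>x. u (x 0)"])
       (auto simp: L2_set_def intro!: measurable_compose[OF measurable_PiM_lborel_coord])
  then have "integrable (\<Pi>\<^sub>M i\<in>{0::nat}. lborel) (\<lambda>x. h \<bar>x 0\<bar> * u (x 0))"
    by (simp add: L2_set_def lessThan_Suc)
  then have "integrable (distr (\<Pi>\<^sub>M i\<in>{0::nat}. lborel) lborel (\<lambda>x. x 0)) (\<lambda>y. h \<bar>y\<bar> * u y)"
    by (subst integrable_distr_eq) auto
  then show ?thesis
    using lborel_product.distr_singleton[of 0] by simp
qed

lemma integral_line_radial:
  fixes h u :: "real \<Rightarrow> complex"
  assumes [measurable]: "h \<in> borel_measurable borel" "u \<in> borel_measurable borel"
  shows "(LINT x|(\<Pi>\<^sub>M i\<in>{..<1::nat}. lborel). h (L2_set x {..<1}) * u (x 0)) = (LINT y|lborel. h \<bar>y\<bar> * u y)"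
  using lborel_product.product_integral_singleton[of "\<lambda>y. h \<bar>y\<bar> * u y" 0]
  by (simp add: L2_set_def lessThan_Suc)

text \<open>After Fubini the profile \<open>h v\<close> is multiplied by \<open>2 * pi * v\<close>
  times the integral of the kernel over \<open>{-v..v}\<close>, which the antiderivative evaluates
  with the divisor \<open>(2 * pi)\<^sup>2\<close>. Hence each descent raises the index of the
  kernel by one and leaves one factor \<open>1 / (2 * pi)\<close>.\<close>

lemma integral_descent_radial_kernel:
  fixes h :: "real \<Rightarrow> complex"
  assumes r: "r > 0" and [measurable]: "h \<in> borel_measurable borel"
    and fin: "(\<integral>\<^sup>+s. ennreal (norm (h s)) * radial_weight (2 * Suc k) s \<partial>lborel) < \<infinity>"
  shows "(LINT y|lborel. descent h \<bar>y\<bar> * radial_kernel k r y) =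
    (LINT y|lborel. h \<bar>y\<bar> * radial_kernel (Suc k) r y) / complex_of_real (2 * pi)"
proof -
  obtain C where C: "\<And>y. norm (radial_kernel k r y) \<le> C * (1 + \<bar>y\<bar>) ^ k"
    using norm_radial_kernel_le by blast
  have C0: "C \<ge> 0" using order_trans[OF norm_ge_zero C[of 0]] by simp
  obtain C' where C': "\<And>y. norm (radial_kernel (Suc k) r y) \<le> C' * (1 + \<bar>y\<bar>) ^ (Suc k)"
    using norm_radial_kernel_le by blast
  let ?K = "\<lambda>v y. (2 * pi * v * indicator {\<bar>y\<bar>..} v) *\<^sub>R (h v * radial_kernel k r y)"
  have [measurable]: "(\<lambda>(v, y). ?K v y) \<in> borel_measurable (lborel \<Otimes>\<^sub>M lborel)"
  proof -
    have "(\<lambda>p. 2 * pi * fst p * indicator {\<bar>snd p\<bar>..} (fst p) :: real) =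
      (\<lambda>p. if \<bar>snd p\<bar> \<le> fst p then 2 * pi * fst p else 0)"
      by (auto simp: indicator_def)
    then have "(\<lambda>p. 2 * pi * fst p * indicator {\<bar>snd p\<bar>..} (fst p) :: real) \<in> borel_measurable (borel \<Otimes>\<^sub>M borel)"
      by simp
    then show ?thesis by (simp add: split_beta' cong: measurable_cong_sets)
  qed
  \<comment> \<open>For fixed \<open>v\<close>, the kernel contributes \<open>k\<close> powers of
    \<open>1 + v\<close>, the area factor one and the length \<open>2 * v\<close> of the interval
    another; \<open>k + 2 \<le> 2 * Suc k\<close>.\<close>
  have int: "integrable (lborel \<Otimes>\<^sub>M lborel) (\<lambda>(v, y). ?K v y)"
  proof (rule integrableI_bounded)
    have "(\<integral>\<^sup>+p. ennreal (norm (case p of (v, y) \<Rightarrow> ?K v y)) \<partial>(lborel \<Otimes>\<^sub>M lborel)) =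
      (\<integral>\<^sup>+v. \<integral>\<^sup>+y. ennreal (norm (?K v y)) \<partial>lborel \<partial>lborel)"
      by (subst lborel.nn_integral_fst[symmetric]) auto
    also have "\<dots> \<le> (\<integral>\<^sup>+v. ennreal (4 * pi * C) * (ennreal (norm (h v)) * radial_weight (2 * Suc k) v) \<partial>lborel)"
    proof (rule nn_integral_mono)
      fix v :: real
      let ?c = "ennreal (2 * pi * C) * (ennreal (norm (h v)) * ennreal ((1 + v) ^ (k + 1) * indicator {0..} v))"
      have "(\<integral>\<^sup>+y. ennreal (norm (?K v y)) \<partial>lborel) \<le> (\<integral>\<^sup>+y. ?c * indicator {-v..v} y \<partial>lborel)"
      proof (rule nn_integral_mono)
        fix y :: real
        show "ennreal (norm (?K v y)) \<le> ?c * indicator {-v..v} y"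
        proof (cases "\<bar>y\<bar> \<le> v")
          case True
          have "norm (radial_kernel k r y) \<le> C * (1 + v) ^ k"
            using True C0 by (intro order_trans[OF C] mult_left_mono power_mono) auto
          then have "v * norm (radial_kernel k r y) \<le> (1 + v) * (C * (1 + v) ^ k)"
            using True by (intro mult_mono) auto
          then have "2 * pi * v * (norm (h v) * norm (radial_kernel k r y)) \<le> 2 * pi * C * (norm (h v) * (1 + v) ^ (k + 1))"
            using mult_left_mono[of "v * norm (radial_kernel k r y)" "(1 + v) * (C * (1 + v) ^ k)" "2 * pi * norm (h v)"]
            by (simp add: mult_ac)
          moreover have "norm (?K v y) = 2 * pi * v * (norm (h v) * norm (radial_kernel k r y))"
            using True by (simp add: norm_mult abs_mult)
          ultimately have "norm (?K v y) \<le> 2 * pi * C * (norm (h v) * (1 + v) ^ (k + 1))"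
            by (simp only:)
          then have "ennreal (norm (?K v y)) \<le> ennreal (2 * pi * C * (norm (h v) * (1 + v) ^ (k + 1)))"
            by (rule ennreal_leI)
          also have "\<dots> = ?c * indicator {-v..v} y"
            using True C0 by (simp add: ennreal_mult[symmetric] abs_le_iff del: power_Suc)
          finally show ?thesis .
        qed simp
      qed
      also have "\<dots> = ?c * emeasure lborel {-v..v}"
        by (rule nn_integral_cmult_indicator) simp
      also have "\<dots> \<le> ennreal (4 * pi * C) * (ennreal (norm (h v)) * radial_weight (2 * Suc k) v)"
      proof (cases "v \<ge> 0")
        case True
        have "(1 + v) ^ (k + 1) * v \<le> (1 + v) ^ (k + 1) * (1 + v)"
          using True by (intro mult_left_mono) auto
        also have "\<dots> = (1 + v) ^ (k + 2)" by simp
        also have "\<dots> \<le> (1 + v) ^ (2 * Suc k)" using True by (intro power_increasing) auto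
        finally have "4 * pi * C * (norm (h v) * ((1 + v) ^ (k + 1) * v)) \<le> 4 * pi * C * (norm (h v) * (1 + v) ^ (2 * Suc k))"
          using C0 by (intro mult_left_mono) auto
        moreover have "?c * emeasure lborel {-v..v} = ennreal (4 * pi * C * (norm (h v) * ((1 + v) ^ (k + 1) * v)))"
          using True C0 by (simp add: ennreal_mult[symmetric] mult_ac del: power_Suc)
        ultimately show ?thesis using True C0
          by (simp add: radial_weight_def ennreal_mult[symmetric] ennreal_leI del: power_Suc)
      qed simp
      finally show "(\<integral>\<^sup>+y. ennreal (norm (?K v y)) \<partial>lborel) \<le> ennreal (4 * pi * C) * (ennreal (norm (h v)) * radial_weight (2 * Suc k) v)" .
    qed
    also have "\<dots> = ennreal (4 * pi * C) * (\<integral>\<^sup>+v. ennreal (norm (h v)) * radial_weight (2 * Suc k) v \<partial>lborel)"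
      by (rule nn_integral_cmult) measurable
    also have "\<dots> < \<infinity>" using fin by (simp add: ennreal_mult_less_top)
    finally show "(\<integral>\<^sup>+p. ennreal (norm (case p of (v, y) \<Rightarrow> ?K v y)) \<partial>(lborel \<Otimes>\<^sub>M lborel)) < \<infinity>" .
  qed measurable
  have "(LINT y|lborel. descent h \<bar>y\<bar> * radial_kernel k r y) = (LINT y|lborel. LINT v|lborel. ?K v y)"
    unfolding descent_def by (subst integral_mult_left_zero[symmetric]) simp
  also have "\<dots> = (LINT v|lborel. LINT y|lborel. ?K v y)"
    by (rule lborel_pair.Fubini_integral[OF int])
  also have "\<dots> = (LINT v|lborel. indicator {0..} v *\<^sub>R (h v * (radial_kernel (Suc k) r v + radial_kernel (Suc k) r (- v)))
    / complex_of_real (2 * pi))"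
  proof (intro Bochner_Integration.integral_cong refl)
    fix v :: real
    show "(LINT y|lborel. ?K v y) = indicator {0..} v *\<^sub>R (h v * (radial_kernel (Suc k) r v + radial_kernel (Suc k) r (- v))) 
      / complex_of_real (2 * pi)"
    proof (cases "v \<ge> 0")
      case True
      have "(LINT y|lborel. ?K v y) = (LINT y|lborel. (complex_of_real (2 * pi * v) * h v) * (indicator {-v..v} y *\<^sub>R radial_kernel k r y))"
        by (intro Bochner_Integration.integral_cong) (auto simp: indicator_def scaleR_conv_of_real)
      also have "\<dots> = complex_of_real (2 * pi * v) * h v * (LINT y|lborel. indicator {-v..v} y *\<^sub>R radial_kernel k r y)"
        by (rule integral_mult_right_zero)
      also have "\<dots> = complex_of_real v * (h v * (radial_primitive k r v - radial_primitive k r (- v))) / complex_of_real (2 * pi)"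
        unfolding integral_radial_kernel[OF r True] by (simp add: power2_eq_square)
      \<comment> \<open>The difference of antiderivatives turns into a sum of kernels because the
        kernel at \<open>- v\<close> carries the factor \<open>- v\<close>.\<close>
      also have "\<dots> = indicator {0..} v *\<^sub>R (h v * (radial_kernel (Suc k) r v + radial_kernel (Suc k) r (- v)))
          / complex_of_real (2 * pi)"
        unfolding radial_kernel_Suc using True by (simp add: algebra_simps)
      finally show ?thesis .
    next
      case False
      then have "(\<lambda>y. ?K v y) = (\<lambda>y. 0)" by (auto simp: indicator_def)
      then show ?thesis using False by simp
    qed
  qed
  also have "\<dots> = (LINT y|lborel. h \<bar>y\<bar> * radial_kernel (Suc k) r y) / complex_of_real (2 * pi)"
  proof -
    have "(\<integral>\<^sup>+s. ennreal (norm (h s)) * radial_weight (Suc k) s \<partial>lborel) \<le>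
       (\<integral>\<^sup>+s. ennreal (norm (h s)) * radial_weight (2 * Suc k) s \<partial>lborel)"
      by (intro nn_integral_mono mult_left_mono radial_weight_mono) auto
    then have "integrable lborel (\<lambda>y. h \<bar>y\<bar> * radial_kernel (Suc k) r y)"
      using fin by (intro integrable_abs_line[OF C']) auto
    from integral_abs_symmetrize[OF _ _ this] show ?thesis
      by simp
  qed
  finally show ?thesis .
qed

lemma radial_weight_mult: "radial_weight p s * radial_weight q s = radial_weight (p + q) s"
  unfolding radial_weight_def by (simp add: ennreal_mult''[symmetric] power_add indicator_def)

lemma norm_radial_kernel_0[simp]: "norm (radial_kernel 0 r y) = 1"
  by (simp add: radial_kernel_def)

lemma abs_le_L2_set:
  assumes "finite A" "i \<in> A"
  shows "\<bar>x i\<bar> \<le> L2_set x A"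
proof -
  have "\<bar>x i\<bar>\<^sup>2 \<le> (\<Sum>i\<in>A. (x i)\<^sup>2)"
    unfolding power2_abs using assms by (intro member_le_sum) auto
  then show ?thesis unfolding L2_set_def by (rule real_le_rsqrt)
qed

text \<open>The profile must be arbitrary in the induction, since the hypothesis is applied to
  \<open>descent h\<close>. The weight exponent \<open>2 * k\<close> matches the radial density in
  dimension \<open>2 * k + 1\<close>, and the two powers lost in a descent are those gained from
  \<open>k\<close> to \<open>Suc k\<close>.\<close>

lemma integral_block_odd:
  assumes r: "r > 0" and "h \<in> borel_measurable borel"
    and "(\<integral>\<^sup>+s. ennreal (norm (h s)) * radial_weight (2 * k) s \<partial>lborel) < \<infinity>"
  shows "(LINT x|(\<Pi>\<^sub>M i\<in>{..<2 * k + 1}. lborel). h (L2_set x {..<2 * k + 1}) * radial_kernel 0 r (x 0)) =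
    (LINT x|(\<Pi>\<^sub>M i\<in>{..<1::nat}. lborel). h (L2_set x {..<1}) * radial_kernel k r (x 0)) / complex_of_real ((2 * pi) ^ k)"
  using assms(2,3)
proof (induction k arbitrary: h)
  case 0
  then show ?case by simp
next
  case (Suc k)
  note [measurable] = Suc.prems(1)
  let ?n = "2 * k + 1"
  have n: "2 * Suc k + 1 = ?n + 2" by simp
  have [measurable]: "(\<lambda>x. x 0) \<in> borel_measurable (\<Pi>\<^sub>M i\<in>{..<?n+2}. (lborel::real measure))"
    by (rule measurable_PiM_lborel_coord) simp
  have "(\<integral>\<^sup>+s. ennreal (norm (descent h s)) * radial_weight (2 * k) s \<partial>lborel) < \<infinity>"
    using nn_integral_descent_le[of h "2 * k"] Suc.prems(2)
    by (auto simp: ennreal_mult_less_top elim!: le_less_trans)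
  note IH = Suc.IH[OF _ this]
  have int: "integrable (\<Pi>\<^sub>M i\<in>{..<?n+2}. lborel) (\<lambda>x. h (L2_set x {..<?n+2}) * radial_kernel 0 r (x 0))"
    using Suc.prems(2) by (intro integrable_block[where a=0 and C=1 and p="2 * Suc k"])
      (auto intro!: measurable_compose[OF measurable_PiM_lborel_coord])
  have "(LINT x|(\<Pi>\<^sub>M i\<in>{..<?n+2}. lborel). h (L2_set x {..<?n+2}) * radial_kernel 0 r (x 0)) =
    (LINT x|(\<Pi>\<^sub>M i\<in>{..<?n}. lborel). descent h (L2_set x {..<?n}) * radial_kernel 0 r (x 0))"
    by (rule integral_block_descent[OF _ _ _ int]) auto
  also have "\<dots> = (LINT y|lborel. descent h \<bar>y\<bar> * radial_kernel k r y) / complex_of_real ((2 * pi) ^ k)"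
    by (subst IH) (simp, subst integral_line_radial, auto)
  also have "\<dots> = (LINT y|lborel. h \<bar>y\<bar> * radial_kernel (Suc k) r y) / complex_of_real ((2 * pi) ^ Suc k)"
    by (subst integral_descent_radial_kernel[OF r]) (use Suc.prems in auto)
  also have "(LINT y|lborel. h \<bar>y\<bar> * radial_kernel (Suc k) r y) =
    (LINT x|(\<Pi>\<^sub>M i\<in>{..<1::nat}. lborel). h (L2_set x {..<1}) * radial_kernel (Suc k) r (x 0))"
    by (rule integral_line_radial[symmetric]) auto
  finally show ?case unfolding n .
qed

section \<open>Even dimensions by slicing\<close>

lemma integral_block_peel:
  fixes n :: nat and h u :: "real \<Rightarrow> complex"
  assumes n: "n \<ge> 1" and [measurable]: "h \<in> borel_measurable borel" "u \<in> borel_measurable borel"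
    and int: "integrable (\<Pi>\<^sub>M i\<in>{..<n+1}. lborel) (\<lambda>x. h (L2_set x {..<n+1}) * u (x 0))"
  shows "(LINT x|(\<Pi>\<^sub>M i\<in>{..<n+1}. lborel). h (L2_set x {..<n+1}) * u (x 0)) =
    (LINT z|lborel. LINT x|(\<Pi>\<^sub>M i\<in>{..<n}. lborel). h (sqrt (z\<^sup>2 + (L2_set x {..<n})\<^sup>2)) * u (x 0))"
proof -
  interpret n: sigma_finite_measure "\<Pi>\<^sub>M i\<in>{..<n}. lborel :: real measure"
    by (rule lborel_product.sigma_finite) simp
  have [measurable]: "(\<lambda>x. x 0) \<in> borel_measurable (\<Pi>\<^sub>M i\<in>{..<n}. (lborel::real measure))"
    using n by (intro measurable_PiM_lborel_coord) simp
  have U: "{..<n+1} = {n} \<union> {..<n}" "{n} \<inter> {..<n} = {}" by auto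
  have "(LINT x|(\<Pi>\<^sub>M i\<in>{..<n+1}. lborel). h (L2_set x {..<n+1}) * u (x 0)) =
    (LINT z|(\<Pi>\<^sub>M i\<in>{n}. lborel). LINT x|(\<Pi>\<^sub>M i\<in>{..<n}. lborel).
      h (L2_set (merge {n} {..<n} (z, x)) ({n} \<union> {..<n})) * u (merge {n} {..<n} (z, x) 0))"
    unfolding U(1) using int unfolding U(1)
    by (intro lborel_product.product_integral_fold) auto
  also have "\<dots> = (LINT z|(\<Pi>\<^sub>M i\<in>{n}. lborel). LINT x|(\<Pi>\<^sub>M i\<in>{..<n}. lborel).
      h (sqrt ((z n)\<^sup>2 + (L2_set x {..<n})\<^sup>2)) * u (x 0))"
    using n by (subst L2_set_merge) (auto simp: merge_def)
  also have "\<dots> = (LINT z|lborel. LINT x|(\<Pi>\<^sub>M i\<in>{..<n}. lborel). h (sqrt (z\<^sup>2 + (L2_set x {..<n})\<^sup>2)) * u (x 0))"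
    by (rule lborel_product.product_integral_singleton) measurable
  finally show ?thesis .
qed

lemma nn_integral_PiM_two:
  fixes f :: "real \<Rightarrow> ennreal"
  assumes [measurable]: "f \<in> borel_measurable borel"
  shows "(\<integral>\<^sup>+x. f (L2_set x {..<2}) \<partial>(\<Pi>\<^sub>M i\<in>{..<2::nat}. lborel)) =
    (\<integral>\<^sup>+z. \<integral>\<^sup>+s. f (sqrt (z\<^sup>2 + s\<^sup>2)) \<partial>lborel \<partial>lborel)"
proof -
  have U: "{..<2} = insert 1 {0::nat}" by auto
  have "(\<integral>\<^sup>+x. f (L2_set x (insert 1 {0})) \<partial>(\<Pi>\<^sub>M i\<in>insert 1 {0::nat}. lborel)) =
    (\<integral>\<^sup>+z. \<integral>\<^sup>+x. f (L2_set (x(1 := z)) (insert 1 {0})) \<partial>(\<Pi>\<^sub>M i\<in>{0::nat}. lborel) \<partial>lborel)"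
    by (rule lborel_product.product_nn_integral_insert_rev) auto
  also have "\<dots> = (\<integral>\<^sup>+z. \<integral>\<^sup>+x. f (sqrt (z\<^sup>2 + (x 0)\<^sup>2)) \<partial>(\<Pi>\<^sub>M i\<in>{0::nat}. lborel) \<partial>lborel)"
    by (simp add: L2_set_def)
  also have "\<dots> = (\<integral>\<^sup>+z. \<integral>\<^sup>+s. f (sqrt (z\<^sup>2 + s\<^sup>2)) \<partial>lborel \<partial>lborel)"
    by (intro nn_integral_cong lborel_product.product_nn_integral_singleton) auto
  finally show ?thesis unfolding U .
qed

text \<open>Fixing the last coordinate \<open>z\<close> leaves the radial profile
  \<open>s \<mapsto> h (sqrt (z\<^sup>2 + s\<^sup>2))\<close> in dimension \<open>2 * k + 1\<close>.
  The odd case acts on each slice, and integrating over \<open>z\<close> reassembles the resulting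
  line integrals into an integral over the plane.\<close>

lemma integral_block_even:
  assumes r: "r > 0" and [measurable]: "h \<in> borel_measurable borel"
    and fin: "(\<integral>\<^sup>+s. ennreal (norm (h s)) * radial_weight (2 * k + 1) s \<partial>lborel) < \<infinity>"
  shows "(LINT x|(\<Pi>\<^sub>M i\<in>{..<2 * k + 2}. lborel). h (L2_set x {..<2 * k + 2}) * radial_kernel 0 r (x 0)) =
    (LINT x|(\<Pi>\<^sub>M i\<in>{..<2::nat}. lborel). h (L2_set x {..<2}) * radial_kernel k r (x 0)) / complex_of_real ((2 * pi) ^ k)"
proof -
  let ?n = "2 * k + 1"
  have n: "2 * k + 2 = ?n + 1" by simp
  have coord[measurable]: "(\<lambda>x. x 0) \<in> borel_measurable (\<Pi>\<^sub>M i\<in>{..<n+1}. (lborel::real measure))" for n :: nat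
    by (rule measurable_PiM_lborel_coord) simp
  obtain C where C: "\<And>y. norm (radial_kernel k r y) \<le> C * (1 + \<bar>y\<bar>) ^ k"
    using norm_radial_kernel_le by blast
  have C0: "C \<ge> 0" using order_trans[OF norm_ge_zero C[of 0]] by simp
  have int1: "integrable (\<Pi>\<^sub>M i\<in>{..<?n+1}. lborel) (\<lambda>x. h (L2_set x {..<?n+1}) * radial_kernel 0 r (x 0))"
    using fin by (intro integrable_block[where a=0 and C=1 and p="2 * k + 1"])
      (auto intro!: measurable_compose[OF measurable_PiM_lborel_coord])
  have fin': "(\<integral>\<^sup>+s. ennreal (norm (h s)) * radial_weight (k + 1) s \<partial>lborel) < \<infinity>"
    by (rule le_less_trans[OF _ fin]) (auto intro!: nn_integral_mono mult_left_mono radial_weight_mono)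
  have int2: "integrable (\<Pi>\<^sub>M i\<in>{..<1+1::nat}. lborel) (\<lambda>x. h (L2_set x {..<1+1}) * radial_kernel k r (x 0))"
  proof (intro integrable_block[where a=k and C=C and p="k + 1"])
    fix x :: "nat \<Rightarrow> real"
    have "\<bar>x 0\<bar> \<le> L2_set x {..<1+1}"
      by (rule abs_le_L2_set) auto
    then show "norm (radial_kernel k r (x 0)) \<le> C * (1 + L2_set x {..<1+1}) ^ k"
      using C0 by (intro order_trans[OF C] mult_left_mono power_mono) auto
  qed (use fin' in \<open>auto intro!: measurable_compose[OF measurable_PiM_lborel_coord]\<close>)
  let ?W = "radial_weight (2 * k)"
  \<comment> \<open>The slices must have finite weighted integral for almost every \<open>z\<close>.
    Since \<open>s \<le> sqrt (z\<^sup>2 + s\<^sup>2)\<close>, their weights are bounded by the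
    radial weight of the plane, whose density adds one power to \<open>2 * k\<close>.\<close>
  have "(\<integral>\<^sup>+z. \<integral>\<^sup>+s. ennreal (norm (h (sqrt (z\<^sup>2 + s\<^sup>2)))) * ?W s \<partial>lborel \<partial>lborel) \<le>
    (\<integral>\<^sup>+z. \<integral>\<^sup>+s. ennreal (norm (h (sqrt (z\<^sup>2 + s\<^sup>2)))) * ?W (sqrt (z\<^sup>2 + s\<^sup>2)) \<partial>lborel \<partial>lborel)"
  proof (intro nn_integral_mono mult_left_mono)
    fix z s :: real
    have "s \<le> sqrt (z\<^sup>2 + s\<^sup>2)" by (rule real_le_rsqrt) simp
    then show "?W s \<le> ?W (sqrt (z\<^sup>2 + s\<^sup>2))"
      unfolding radial_weight_def by (intro ennreal_leI) (auto simp: indicator_def intro!: power_mono)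
  qed simp
  also have "\<dots> = (\<integral>\<^sup>+x. ennreal (norm (h (L2_set x {..<2}))) * ?W (L2_set x {..<2}) \<partial>(\<Pi>\<^sub>M i\<in>{..<2::nat}. lborel))"
    by (subst nn_integral_PiM_two[where f="\<lambda>s. ennreal (norm (h s)) * ?W s"]) auto
  also have "\<dots> \<le> ennreal (1 * (unit_ball_vol (real 2) * real 2)) *
      (\<integral>\<^sup>+s. (ennreal (norm (h s)) * ?W s) * radial_weight 1 s \<partial>lborel)"
    using nn_integral_block_le[of 2 0 1 "\<lambda>_. 1" 1 "\<lambda>s. ennreal (norm (h s)) * ?W s"] by simp
  also have "\<dots> < \<infinity>"
    using fin by (simp add: mult.assoc radial_weight_mult ennreal_mult_less_top)
  finally have "AE z in lborel. (\<integral>\<^sup>+s. ennreal (norm (h (sqrt (z\<^sup>2 + s\<^sup>2)))) * ?W s \<partial>lborel) \<noteq> \<infinity>"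
    by (intro nn_integral_PInf_AE) auto
  then have AE: "AE z in lborel. 
     (LINT x|(\<Pi>\<^sub>M i\<in>{..<?n}. lborel). h (sqrt (z\<^sup>2 + (L2_set x {..<?n})\<^sup>2)) * radial_kernel 0 r (x 0)) =
     (LINT x|(\<Pi>\<^sub>M i\<in>{..<1::nat}. lborel). h (sqrt (z\<^sup>2 + (L2_set x {..<1})\<^sup>2)) * radial_kernel k r (x 0)) / complex_of_real ((2 * pi) ^ k)"
  proof eventually_elim
    case (elim z)
    then show ?case
      using integral_block_odd[OF r, of "\<lambda>s. h (sqrt (z\<^sup>2 + s\<^sup>2))" k] by (simp add: less_top)
  qed
  have meas: "(\<lambda>z. LINT x|(\<Pi>\<^sub>M i\<in>{..<n}. lborel). h (sqrt (z\<^sup>2 + (L2_set x {..<n})\<^sup>2)) * radial_kernel l r (x 0)) \<in> borel_measurable borel"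
    if "n \<ge> 1" for n l :: nat
  proof -
    interpret n: sigma_finite_measure "\<Pi>\<^sub>M i\<in>{..<n}. lborel :: real measure"
      by (rule lborel_product.sigma_finite) simp
    have [measurable]: "(\<lambda>x. x 0) \<in> borel_measurable (\<Pi>\<^sub>M i\<in>{..<n}. (lborel::real measure))"
      using that by (intro measurable_PiM_lborel_coord) simp
    show ?thesis by measurable
  qed
  have "(LINT x|(\<Pi>\<^sub>M i\<in>{..<?n+1}. lborel). h (L2_set x {..<?n+1}) * radial_kernel 0 r (x 0)) =
    (LINT z|lborel. LINT x|(\<Pi>\<^sub>M i\<in>{..<?n}. lborel). h (sqrt (z\<^sup>2 + (L2_set x {..<?n})\<^sup>2)) * radial_kernel 0 r (x 0))"
    by (rule integral_block_peel[OF _ _ _ int1]) auto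
  also have "\<dots> = (LINT z|lborel. 
    (LINT x|(\<Pi>\<^sub>M i\<in>{..<1::nat}. lborel). h (sqrt (z\<^sup>2 + (L2_set x {..<1})\<^sup>2)) * radial_kernel k r (x 0)) / complex_of_real ((2 * pi) ^ k))"
    by (rule integral_cong_AE[OF _ _ AE]) (auto intro!: borel_measurable_divide meas)
  also have "\<dots> = (LINT z|lborel. 
    (LINT x|(\<Pi>\<^sub>M i\<in>{..<1::nat}. lborel). h (sqrt (z\<^sup>2 + (L2_set x {..<1})\<^sup>2)) * radial_kernel k r (x 0))) / complex_of_real ((2 * pi) ^ k)"
    by (rule integral_divide_zero)
  also have "(LINT z|lborel. 
    (LINT x|(\<Pi>\<^sub>M i\<in>{..<1::nat}. lborel). h (sqrt (z\<^sup>2 + (L2_set x {..<1})\<^sup>2)) * radial_kernel k r (x 0))) =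
    (LINT x|(\<Pi>\<^sub>M i\<in>{..<1+1::nat}. lborel). h (L2_set x {..<1+1}) * radial_kernel k r (x 0))"
    by (rule integral_block_peel[OF _ _ _ int2, symmetric]) auto
  finally show ?thesis by (simp only: n one_add_one)
qed

subsection \<open>Products of blocks\<close>

text \<open>The last clause says that the measure with density \<open>norm u\<close>, pushed forward
  along the radius \<open>p\<close>, is dominated by a multiple of \<open>W\<close> times Lebesgue
  measure. Integrability and almost-everywhere arguments then need no dimension, so blocks of
  different dimensions can stand in one product.\<close>

definition radial_block ::
  "(real \<Rightarrow> ennreal) \<Rightarrow> 'a measure \<Rightarrow> ('a \<Rightarrow> real) \<Rightarrow> ('a \<Rightarrow> complex) \<Rightarrow> bool" where
  "radial_block W M p u \<longleftrightarrow> p \<in> borel_measurable M \<and> u \<in> borel_measurable M \<and>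
     (\<exists>C<\<infinity>. \<forall>f\<in>borel_measurable borel.
        (\<integral>\<^sup>+x. f (p x) * ennreal (norm (u x)) \<partial>M) \<le> C * (\<integral>\<^sup>+s. f s * W s \<partial>lborel))"

text \<open>Domination passes to products by Tonelli: one block is integrated with the others
  frozen, and the induction hypothesis is applied to what remains.\<close>

lemma nn_integral_PiM_block_le:
  fixes M :: "'i \<Rightarrow> 'a measure" and f :: "('i \<Rightarrow> real) \<Rightarrow> ennreal"
  assumes "finite I" and sf: "\<And>i. sigma_finite_measure (M i)"
    and p: "\<And>i. i \<in> I \<Longrightarrow> p i \<in> borel_measurable (M i)"
    and w: "\<And>i. i \<in> I \<Longrightarrow> w i \<in> borel_measurable (M i)"
    and W: "\<And>i. i \<in> I \<Longrightarrow> W i \<in> borel_measurable borel"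
    and dom: "\<And>i f. i \<in> I \<Longrightarrow> f \<in> borel_measurable borel \<Longrightarrow>
      (\<integral>\<^sup>+x. f (p i x) * w i x \<partial>M i) \<le> C i * (\<integral>\<^sup>+s. f s * W i s \<partial>lborel)"
    and "f \<in> borel_measurable (\<Pi>\<^sub>M i\<in>I. lborel)"
  shows "(\<integral>\<^sup>+x. f (\<lambda>i\<in>I. p i (x i)) * (\<Prod>i\<in>I. w i (x i)) \<partial>(\<Pi>\<^sub>M i\<in>I. M i)) \<le>
    (\<Prod>i\<in>I. C i) * (\<integral>\<^sup>+s. f s * (\<Prod>i\<in>I. W i (s i)) \<partial>(\<Pi>\<^sub>M i\<in>I. lborel))"
  using assms(1) p w W dom assms(7)
proof (induction I arbitrary: f rule: finite_induct)
  case empty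
  interpret M: product_sigma_finite M using sf by (simp add: product_sigma_finite_def)
  interpret L: product_sigma_finite "\<lambda>_::'i. lborel::real measure" by unfold_locales
  show ?case by (simp add: PiM_empty nn_integral_count_space_finite restrict_def)
next
  case (insert i I)
  interpret M: product_sigma_finite M using sf by (simp add: product_sigma_finite_def)
  interpret L: product_sigma_finite "\<lambda>_::'i. lborel::real measure" by unfold_locales
  interpret i: sigma_finite_measure "M i" by (rule sf)
  have [measurable]: "p j \<in> borel_measurable (M j)" "w j \<in> borel_measurable (M j)" "W j \<in> borel_measurable borel"
    if "j \<in> insert i I" for j
    using insert.prems that by auto
  have [measurable]: "(\<lambda>x. x j) \<in> Pi\<^sub>M (insert i I) M \<rightarrow>\<^sub>M M j" if "j \<in> insert i I" for j
    using that by (rule measurable_component_singleton)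
  have [measurable]: "(\<lambda>x. x j) \<in> Pi\<^sub>M I M \<rightarrow>\<^sub>M M j" if "j \<in> I" for j
    using that by (rule measurable_component_singleton)
  have [measurable]: "(\<lambda>x. x j) \<in> borel_measurable (\<Pi>\<^sub>M j\<in>insert i I. (lborel::real measure))" if "j \<in> insert i I" for j
    using measurable_component_singleton[OF that, of "\<lambda>_. lborel::real measure"] by simp
  have [measurable]: "(\<lambda>x. x j) \<in> borel_measurable (\<Pi>\<^sub>M j\<in>I. (lborel::real measure))" if "j \<in> I" for j
    using measurable_component_singleton[OF that, of "\<lambda>_. lborel::real measure"] by simp
  note f = insert.prems(5)
  have restr[measurable]: "(\<lambda>x. \<lambda>i\<in>J. p i (x i)) \<in> Pi\<^sub>M J M \<rightarrow>\<^sub>M (\<Pi>\<^sub>M i\<in>J. lborel)" if "J \<subseteq> insert i I" for J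
  proof (rule measurable_restrict)
    fix j assume "j \<in> J"
    then have "(\<lambda>x. p j (x j)) \<in> borel_measurable (Pi\<^sub>M J M)"
      using that by (intro measurable_compose[OF measurable_component_singleton]) auto
    then show "(\<lambda>x. p j (x j)) \<in> Pi\<^sub>M J M \<rightarrow>\<^sub>M lborel" by simp
  qed
  have fu: "(\<lambda>(t, s). f (t(i := s))) \<in> borel_measurable ((\<Pi>\<^sub>M j\<in>I. lborel) \<Otimes>\<^sub>M lborel)"
    using measurable_compose[OF measurable_add_dim f] by (simp add: split_beta' fun_upd_def)
  have fu_t[measurable]: "(\<lambda>s. f (t(i := s))) \<in> borel_measurable borel" if "t \<in> space (\<Pi>\<^sub>M j\<in>I. lborel)" for t
    using measurable_compose[OF measurable_Pair1'[OF that] fu] by simp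
  \<comment> \<open>The integrand after radius \<open>i\<close> has been integrated against its
    weight; this is the function to which the induction hypothesis applies.\<close>
  define g where "g t = (\<integral>\<^sup>+s. f (t(i := s)) * W i s \<partial>lborel)" for t
  have g: "g \<in> borel_measurable (\<Pi>\<^sub>M j\<in>I. lborel)"
    unfolding g_def
    by (rule lborel.borel_measurable_nn_integral)
       (use fu in \<open>auto simp: split_beta' intro!: borel_measurable_times_ennreal\<close>)
  have space: "(\<lambda>j\<in>I. p j (x j)) \<in> space (\<Pi>\<^sub>M j\<in>I. lborel)" for x
    by (simp add: space_PiM)
  have "(\<integral>\<^sup>+x. f (\<lambda>i\<in>insert i I. p i (x i)) * (\<Prod>i\<in>insert i I. w i (x i)) \<partial>Pi\<^sub>M (insert i I) M) =
    (\<integral>\<^sup>+x. \<integral>\<^sup>+y. f (\<lambda>j\<in>insert i I. p j ((x(i := y)) j)) * (\<Prod>j\<in>insert i I. w j ((x(i := y)) j)) \<partial>M i \<partial>Pi\<^sub>M I M)"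
    using insert.hyps
    by (intro M.product_nn_integral_insert borel_measurable_times_ennreal borel_measurable_prod_ennreal 
        measurable_compose[OF restr f]) auto
  also have "\<dots> = (\<integral>\<^sup>+x. \<integral>\<^sup>+y. (f ((\<lambda>j\<in>I. p j (x j))(i := p i y)) * w i y) * (\<Prod>j\<in>I. w j (x j)) \<partial>M i \<partial>Pi\<^sub>M I M)"
  proof (intro nn_integral_cong)
    fix x y
    have "(\<lambda>j\<in>insert i I. p j ((x(i := y)) j)) = (\<lambda>j\<in>I. p j (x j))(i := p i y)"
      using insert.hyps by (auto simp: restrict_def)
    moreover have "(\<Prod>j\<in>I. w j ((x(i := y)) j)) = (\<Prod>j\<in>I. w j (x j))"
      using insert.hyps by (intro prod.cong) auto
    ultimately show "f (\<lambda>j\<in>insert i I. p j ((x(i := y)) j)) * (\<Prod>j\<in>insert i I. w j ((x(i := y)) j)) =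
      (f ((\<lambda>j\<in>I. p j (x j))(i := p i y)) * w i y) * (\<Prod>j\<in>I. w j (x j))"
      using insert.hyps by (simp add: mult.assoc)
  qed
  also have "\<dots> \<le> (\<integral>\<^sup>+x. C i * (g (\<lambda>j\<in>I. p j (x j)) * (\<Prod>j\<in>I. w j (x j))) \<partial>Pi\<^sub>M I M)"
  proof (rule nn_integral_mono)
    fix x
    have "(\<integral>\<^sup>+y. (f ((\<lambda>j\<in>I. p j (x j))(i := p i y)) * w i y) * (\<Prod>j\<in>I. w j (x j)) \<partial>M i) =
      (\<integral>\<^sup>+y. f ((\<lambda>j\<in>I. p j (x j))(i := p i y)) * w i y \<partial>M i) * (\<Prod>j\<in>I. w j (x j))"
      using measurable_compose[OF _ fu_t[OF space], of "p i" "M i"]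
      by (intro nn_integral_multc borel_measurable_times_ennreal) auto
    also have "\<dots> \<le> C i * g (\<lambda>j\<in>I. p j (x j)) * (\<Prod>j\<in>I. w j (x j))"
      unfolding g_def using insert.prems(4)[OF _ fu_t[OF space]] by (intro mult_right_mono) auto
    finally show "(\<integral>\<^sup>+y. (f ((\<lambda>j\<in>I. p j (x j))(i := p i y)) * w i y) * (\<Prod>j\<in>I. w j (x j)) \<partial>M i) \<le>
      C i * (g (\<lambda>j\<in>I. p j (x j)) * (\<Prod>j\<in>I. w j (x j)))"
      by (simp add: mult.assoc)
  qed
  also have "\<dots> = C i * (\<integral>\<^sup>+x. g (\<lambda>j\<in>I. p j (x j)) * (\<Prod>j\<in>I. w j (x j)) \<partial>Pi\<^sub>M I M)"
    using insert.hyps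
    by (intro nn_integral_cmult borel_measurable_times_ennreal borel_measurable_prod_ennreal 
        measurable_compose[OF restr g]) auto
  also have "\<dots> \<le> C i * ((\<Prod>j\<in>I. C j) * (\<integral>\<^sup>+t. g t * (\<Prod>j\<in>I. W j (t j)) \<partial>(\<Pi>\<^sub>M j\<in>I. lborel)))"
    using insert.prems by (intro mult_left_mono insert.IH g) auto
  also have "(\<integral>\<^sup>+t. g t * (\<Prod>j\<in>I. W j (t j)) \<partial>(\<Pi>\<^sub>M j\<in>I. lborel)) =
    (\<integral>\<^sup>+t. \<integral>\<^sup>+s. f (t(i := s)) * (\<Prod>j\<in>insert i I. W j ((t(i := s)) j)) \<partial>lborel \<partial>(\<Pi>\<^sub>M j\<in>I. lborel))"
  proof (rule nn_integral_cong)
    fix t :: "'i \<Rightarrow> real" assume t: "t \<in> space (\<Pi>\<^sub>M j\<in>I. lborel)"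
    have "(\<Prod>j\<in>I. W j ((t(i := s)) j)) = (\<Prod>j\<in>I. W j (t j))" for s
      using insert.hyps by (intro prod.cong) auto
    then show "g t * (\<Prod>j\<in>I. W j (t j)) =
      (\<integral>\<^sup>+s. f (t(i := s)) * (\<Prod>j\<in>insert i I. W j ((t(i := s)) j)) \<partial>lborel)"
      unfolding g_def using insert.hyps fu_t[OF t]
      by (subst nn_integral_multc[symmetric]) (auto simp: mult.assoc)
  qed
  also have "\<dots> = (\<integral>\<^sup>+s. f s * (\<Prod>j\<in>insert i I. W j (s j)) \<partial>(\<Pi>\<^sub>M j\<in>insert i I. lborel))"
    using insert.hyps
    by (intro L.product_nn_integral_insert[symmetric] borel_measurable_times_ennreal borel_measurable_prod_ennreal f
        measurable_compose[OF _ insert.prems(3)]) auto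
  finally show ?case using insert.hyps by (simp add: mult.assoc)
qed

lemma nn_integral_PiM_radial_block:
  fixes M :: "'i \<Rightarrow> 'a measure"
  assumes I: "finite I" and sf: "\<And>i. sigma_finite_measure (M i)"
    and W: "\<And>i. i \<in> I \<Longrightarrow> W i \<in> borel_measurable borel"
    and blk: "\<And>i. i \<in> I \<Longrightarrow> radial_block (W i) (M i) (p i) (u i)"
  obtains C :: ennreal where "C < \<infinity>"
    "\<And>f. f \<in> borel_measurable (\<Pi>\<^sub>M i\<in>I. lborel) \<Longrightarrow>
      (\<integral>\<^sup>+x. f (\<lambda>i\<in>I. p i (x i)) * ennreal (norm (\<Prod>i\<in>I. u i (x i))) \<partial>(\<Pi>\<^sub>M i\<in>I. M i)) \<le>
      C * (\<integral>\<^sup>+s. f s * (\<Prod>i\<in>I. W i (s i)) \<partial>(\<Pi>\<^sub>M i\<in>I. lborel))"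
proof -
  have "\<forall>i\<in>I. \<exists>C<\<infinity>. \<forall>f\<in>borel_measurable borel.
    (\<integral>\<^sup>+x. f (p i x) * ennreal (norm (u i x)) \<partial>M i) \<le> C * (\<integral>\<^sup>+s. f s * W i s \<partial>lborel)"
    using blk by (simp add: radial_block_def)
  then obtain C where C: "\<And>i. i \<in> I \<Longrightarrow> C i < \<infinity>" "\<And>i f. i \<in> I \<Longrightarrow> f \<in> borel_measurable borel \<Longrightarrow>
    (\<integral>\<^sup>+x. f (p i x) * ennreal (norm (u i x)) \<partial>M i) \<le> C i * (\<integral>\<^sup>+s. f s * W i s \<partial>lborel)"
    by metis
  show ?thesis
  proof
    show "(\<Prod>i\<in>I. C i) < \<infinity>"
      using C(1) I by (simp add: less_top[symmetric] ennreal_prod_eq_top)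
    have meas: "p i \<in> borel_measurable (M i)" "(\<lambda>x. ennreal (norm (u i x))) \<in> borel_measurable (M i)" if "i \<in> I" for i
    proof -
      have [measurable]: "u i \<in> borel_measurable (M i)" using blk[OF that] by (simp add: radial_block_def)
      show "(\<lambda>x. ennreal (norm (u i x))) \<in> borel_measurable (M i)" by measurable
      show "p i \<in> borel_measurable (M i)" using blk[OF that] by (simp add: radial_block_def)
    qed
    fix f :: "('i \<Rightarrow> real) \<Rightarrow> ennreal" assume "f \<in> borel_measurable (\<Pi>\<^sub>M i\<in>I. lborel)"
    then have "(\<integral>\<^sup>+x. f (\<lambda>i\<in>I. p i (x i)) * (\<Prod>i\<in>I. ennreal (norm (u i (x i)))) \<partial>(\<Pi>\<^sub>M i\<in>I. M i)) \<le>
      (\<Prod>i\<in>I. C i) * (\<integral>\<^sup>+s. f s * (\<Prod>i\<in>I. W i (s i)) \<partial>(\<Pi>\<^sub>M i\<in>I. lborel))"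
      using W by (intro nn_integral_PiM_block_le[OF I sf] C(2) meas) auto
    then show "(\<integral>\<^sup>+x. f (\<lambda>i\<in>I. p i (x i)) * ennreal (norm (\<Prod>i\<in>I. u i (x i))) \<partial>(\<Pi>\<^sub>M i\<in>I. M i)) \<le>
      (\<Prod>i\<in>I. C i) * (\<integral>\<^sup>+s. f s * (\<Prod>i\<in>I. W i (s i)) \<partial>(\<Pi>\<^sub>M i\<in>I. lborel))"
      by (simp add: prod_norm[symmetric] prod_ennreal)
  qed
qed

lemma measurable_radii:
  assumes "\<And>i. i \<in> I \<Longrightarrow> p i \<in> borel_measurable (M i)"
  shows "(\<lambda>x. \<lambda>i\<in>I. p i (x i) :: real) \<in> Pi\<^sub>M I M \<rightarrow>\<^sub>M (\<Pi>\<^sub>M i\<in>I. lborel)"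
proof (rule measurable_restrict)
  fix j assume j: "j \<in> I"
  then have "(\<lambda>x. p j (x j)) \<in> borel_measurable (Pi\<^sub>M I M)"
    using assms by (intro measurable_compose[OF measurable_component_singleton])
  then show "(\<lambda>x. p j (x j)) \<in> Pi\<^sub>M I M \<rightarrow>\<^sub>M lborel" by simp
qed

lemma measurable_block_integrand:
  fixes \<phi> :: "('i \<Rightarrow> real) \<Rightarrow> complex" and u :: "'i \<Rightarrow> 'a \<Rightarrow> complex"
  assumes "\<And>i. i \<in> I \<Longrightarrow> p i \<in> borel_measurable (M i)" "\<And>i. i \<in> I \<Longrightarrow> u i \<in> borel_measurable (M i)"
    and "\<phi> \<in> borel_measurable (\<Pi>\<^sub>M i\<in>I. lborel)"
  shows "(\<lambda>x. \<phi> (\<lambda>i\<in>I. p i (x i)) * (\<Prod>i\<in>I. u i (x i))) \<in> borel_measurable (\<Pi>\<^sub>M i\<in>I. M i)"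
  using assms
  by (intro borel_measurable_times borel_measurable_prod measurable_compose[OF measurable_radii]
      measurable_compose[OF measurable_component_singleton]) auto

lemma integrable_PiM_radial_block:
  fixes M :: "'i \<Rightarrow> 'a measure" and \<phi> :: "('i \<Rightarrow> real) \<Rightarrow> complex"
  assumes I: "finite I" and sf: "\<And>i. sigma_finite_measure (M i)"
    and W: "\<And>i. i \<in> I \<Longrightarrow> W i \<in> borel_measurable borel"
    and blk: "\<And>i. i \<in> I \<Longrightarrow> radial_block (W i) (M i) (p i) (u i)"
    and \<phi>: "\<phi> \<in> borel_measurable (\<Pi>\<^sub>M i\<in>I. lborel)"
    and fin: "(\<integral>\<^sup>+s. ennreal (norm (\<phi> s)) * (\<Prod>i\<in>I. W i (s i)) \<partial>(\<Pi>\<^sub>M i\<in>I. lborel)) < \<infinity>"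
  shows "integrable (\<Pi>\<^sub>M i\<in>I. M i) (\<lambda>x. \<phi> (\<lambda>i\<in>I. p i (x i)) * (\<Prod>i\<in>I. u i (x i)))"
proof (rule integrableI_bounded)
  show "(\<lambda>x. \<phi> (\<lambda>i\<in>I. p i (x i)) * (\<Prod>i\<in>I. u i (x i))) \<in> borel_measurable (\<Pi>\<^sub>M i\<in>I. M i)"
    using blk by (intro measurable_block_integrand \<phi>) (auto simp: radial_block_def)
  obtain C where C: "C < \<infinity>" "\<And>f. f \<in> borel_measurable (\<Pi>\<^sub>M i\<in>I. lborel) \<Longrightarrow>
      (\<integral>\<^sup>+x. f (\<lambda>i\<in>I. p i (x i)) * ennreal (norm (\<Prod>i\<in>I. u i (x i))) \<partial>(\<Pi>\<^sub>M i\<in>I. M i)) \<le>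
      C * (\<integral>\<^sup>+s. f s * (\<Prod>i\<in>I. W i (s i)) \<partial>(\<Pi>\<^sub>M i\<in>I. lborel))"
    using nn_integral_PiM_radial_block[where I=I and M=M and W=W and p=p and u=u] I sf W blk by blast
  have "(\<integral>\<^sup>+x. ennreal (norm (\<phi> (\<lambda>i\<in>I. p i (x i)) * (\<Prod>i\<in>I. u i (x i)))) \<partial>(\<Pi>\<^sub>M i\<in>I. M i)) \<le>
    C * (\<integral>\<^sup>+s. ennreal (norm (\<phi> s)) * (\<Prod>i\<in>I. W i (s i)) \<partial>(\<Pi>\<^sub>M i\<in>I. lborel))"
    using C(2)[of "\<lambda>s. ennreal (norm (\<phi> s))"] \<phi> by (simp add: norm_mult ennreal_mult)
  also have "\<dots> < \<infinity>" using C(1) fin by (simp add: ennreal_mult_less_top)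
  finally show "(\<integral>\<^sup>+x. ennreal (norm (\<phi> (\<lambda>i\<in>I. p i (x i)) * (\<Prod>i\<in>I. u i (x i)))) \<partial>(\<Pi>\<^sub>M i\<in>I. M i)) < \<infinity>" .
qed

text \<open>Freezing the blocks in \<open>J\<close> leaves a one-variable profile for block
  \<open>i\<close>. The hypothesis \<open>eq\<close> applies to it when its weighted integral is
  finite, which by the domination of the other blocks holds for almost every frozen point.\<close>

lemma integral_PiM_replace_block:
  fixes M :: "'i \<Rightarrow> 'a measure" and N :: "'a measure" and \<phi> :: "('i \<Rightarrow> real) \<Rightarrow> complex"
  assumes J: "finite J" "i \<notin> J" and sf: "\<And>j. sigma_finite_measure (M j)" "sigma_finite_measure N"
    and W: "\<And>j. j \<in> insert i J \<Longrightarrow> W j \<in> borel_measurable borel"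
    and blk: "\<And>j. j \<in> insert i J \<Longrightarrow> radial_block (W j) (M j) (p j) (u j)" "radial_block (W i) N q v"
    and eq: "\<And>h. h \<in> borel_measurable borel \<Longrightarrow> (\<integral>\<^sup>+s. ennreal (norm (h s)) * W i s \<partial>lborel) < \<infinity> \<Longrightarrow>
      (LINT x|M i. h (p i x) * u i x) = (LINT x|N. h (q x) * v x)"
    and \<phi>: "\<phi> \<in> borel_measurable (\<Pi>\<^sub>M j\<in>insert i J. lborel)"
    and fin: "(\<integral>\<^sup>+s. ennreal (norm (\<phi> s)) * (\<Prod>j\<in>insert i J. W j (s j)) \<partial>(\<Pi>\<^sub>M j\<in>insert i J. lborel)) < \<infinity>"
  shows "(LINT x|(\<Pi>\<^sub>M j\<in>insert i J. M j). \<phi> (\<lambda>j\<in>insert i J. p j (x j)) * (\<Prod>j\<in>insert i J. u j (x j))) =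
    (LINT x|(\<Pi>\<^sub>M j\<in>insert i J. (M(i := N)) j). \<phi> (\<lambda>j\<in>insert i J. (p(i := q)) j (x j)) * (\<Prod>j\<in>insert i J. (u(i := v)) j (x j)))"
proof -
  interpret L: product_sigma_finite "\<lambda>_::'i. lborel::real measure" by unfold_locales
  have fu: "(\<lambda>(t, s). \<phi> (t(i := s))) \<in> borel_measurable ((\<Pi>\<^sub>M j\<in>J. lborel) \<Otimes>\<^sub>M lborel)"
    using measurable_compose[OF measurable_add_dim \<phi>] by (simp add: split_beta' fun_upd_def)
  have fu_t: "(\<lambda>s. \<phi> (t(i := s))) \<in> borel_measurable borel" if "t \<in> space (\<Pi>\<^sub>M j\<in>J. lborel)" for t
    using measurable_compose[OF measurable_Pair1'[OF that] fu] by simp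
  have space: "(\<lambda>j\<in>J. p j (x j)) \<in> space (\<Pi>\<^sub>M j\<in>J. lborel)" for x
    by (simp add: space_PiM)
  \<comment> \<open>Stated for a general family of blocks because it is used both before and after
    the exchange.\<close>
  have split: "(LINT x|(\<Pi>\<^sub>M j\<in>insert i J. M' j). \<phi> (\<lambda>j\<in>insert i J. p' j (x j)) * (\<Prod>j\<in>insert i J. u' j (x j))) =
     (LINT x|(\<Pi>\<^sub>M j\<in>J. M' j). LINT y|M' i. (\<phi> ((\<lambda>j\<in>J. p' j (x j))(i := p' i y)) * (\<Prod>j\<in>J. u' j (x j))) * u' i y)"
    if sf': "\<And>j. sigma_finite_measure (M' j)" and blk': "\<And>j. j \<in> insert i J \<Longrightarrow> radial_block (W j) (M' j) (p' j) (u' j)"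
    for M' :: "'i \<Rightarrow> 'a measure" and p' u'
  proof -
    interpret M: product_sigma_finite M' using sf' by (simp add: product_sigma_finite_def)
    have fin': "finite (insert i J)" using J by simp
    have "(LINT x|(\<Pi>\<^sub>M j\<in>insert i J. M' j). \<phi> (\<lambda>j\<in>insert i J. p' j (x j)) * (\<Prod>j\<in>insert i J. u' j (x j))) =
      (LINT x|(\<Pi>\<^sub>M j\<in>J. M' j). LINT y|M' i. \<phi> (\<lambda>j\<in>insert i J. p' j ((x(i := y)) j)) * (\<Prod>j\<in>insert i J. u' j ((x(i := y)) j)))"
      by (rule M.product_integral_insert[OF J]) (use integrable_PiM_radial_block[where W=W and \<phi>=\<phi> and I="insert i J" and M=M' and p=p' and u=u'] fin' sf' W blk' \<phi> fin in blast)
    also have "\<dots> = (LINT x|(\<Pi>\<^sub>M j\<in>J. M' j). LINT y|M' i. (\<phi> ((\<lambda>j\<in>J. p' j (x j))(i := p' i y)) * (\<Prod>j\<in>J. u' j (x j))) * u' i y)"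
    proof (intro Bochner_Integration.integral_cong refl)
      fix x y
      have "(\<lambda>j\<in>insert i J. p' j ((x(i := y)) j)) = (\<lambda>j\<in>J. p' j (x j))(i := p' i y)"
        using J by (auto simp: restrict_def)
      moreover have "(\<Prod>j\<in>J. u' j ((x(i := y)) j)) = (\<Prod>j\<in>J. u' j (x j))"
        using J by (intro prod.cong) auto
      ultimately show "\<phi> (\<lambda>j\<in>insert i J. p' j ((x(i := y)) j)) * (\<Prod>j\<in>insert i J. u' j ((x(i := y)) j)) =
        (\<phi> ((\<lambda>j\<in>J. p' j (x j))(i := p' i y)) * (\<Prod>j\<in>J. u' j (x j))) * u' i y"
        using J by (simp add: mult_ac)
    qed
    finally show ?thesis .
  qed
  let ?h = "\<lambda>x s. \<phi> ((\<lambda>j\<in>J. p j (x j))(i := s)) * (\<Prod>j\<in>J. u j (x j))"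
  define g where "g t = (\<integral>\<^sup>+s. ennreal (norm (\<phi> (t(i := s)))) * W i s \<partial>lborel)" for t
  have g: "g \<in> borel_measurable (\<Pi>\<^sub>M j\<in>J. lborel)"
    unfolding g_def
    by (rule lborel.borel_measurable_nn_integral)
       (use fu W in \<open>auto simp: split_beta' intro!: borel_measurable_times_ennreal measurable_compose[OF measurable_snd]\<close>)
  obtain C where C: "C < \<infinity>" "\<And>f. f \<in> borel_measurable (\<Pi>\<^sub>M i\<in>J. lborel) \<Longrightarrow>
      (\<integral>\<^sup>+x. f (\<lambda>i\<in>J. p i (x i)) * ennreal (norm (\<Prod>i\<in>J. u i (x i))) \<partial>(\<Pi>\<^sub>M i\<in>J. M i)) \<le>
      C * (\<integral>\<^sup>+s. f s * (\<Prod>i\<in>J. W i (s i)) \<partial>(\<Pi>\<^sub>M i\<in>J. lborel))"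
    using nn_integral_PiM_radial_block[where I=J and M=M and W=W and p=p and u=u] J(1) sf(1) W blk(1) by blast
  have hg: "(\<integral>\<^sup>+s. ennreal (norm (?h x s)) * W i s \<partial>lborel) = g (\<lambda>j\<in>J. p j (x j)) * ennreal (norm (\<Prod>j\<in>J. u j (x j)))" for x
    unfolding g_def using fu_t[OF space[of x]] W
    by (subst nn_integral_multc[symmetric]) (auto simp: norm_mult ennreal_mult mult_ac)
  have "(\<integral>\<^sup>+x. (\<integral>\<^sup>+s. ennreal (norm (?h x s)) * W i s \<partial>lborel) \<partial>(\<Pi>\<^sub>M j\<in>J. M j)) \<le>
    C * (\<integral>\<^sup>+t. g t * (\<Prod>j\<in>J. W j (t j)) \<partial>(\<Pi>\<^sub>M j\<in>J. lborel))"
    unfolding hg by (rule C(2)[OF g])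
  also have "(\<integral>\<^sup>+t. g t * (\<Prod>j\<in>J. W j (t j)) \<partial>(\<Pi>\<^sub>M j\<in>J. lborel)) =
    (\<integral>\<^sup>+t. \<integral>\<^sup>+s. ennreal (norm (\<phi> (t(i := s)))) * (\<Prod>j\<in>insert i J. W j ((t(i := s)) j)) \<partial>lborel \<partial>(\<Pi>\<^sub>M j\<in>J. lborel))"
  proof (rule nn_integral_cong)
    fix t :: "'i \<Rightarrow> real" assume t: "t \<in> space (\<Pi>\<^sub>M j\<in>J. lborel)"
    have "(\<Prod>j\<in>J. W j ((t(i := s)) j)) = (\<Prod>j\<in>J. W j (t j))" for s
      using J by (intro prod.cong) auto
    then show "g t * (\<Prod>j\<in>J. W j (t j)) =
      (\<integral>\<^sup>+s. ennreal (norm (\<phi> (t(i := s)))) * (\<Prod>j\<in>insert i J. W j ((t(i := s)) j)) \<partial>lborel)"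
      unfolding g_def using J fu_t[OF t] W
      by (subst nn_integral_multc[symmetric]) (auto simp: mult.assoc)
  qed
  also have "\<dots> = (\<integral>\<^sup>+s. ennreal (norm (\<phi> s)) * (\<Prod>j\<in>insert i J. W j (s j)) \<partial>(\<Pi>\<^sub>M j\<in>insert i J. lborel))"
  proof (rule L.product_nn_integral_insert[symmetric, OF J])
    have "(\<lambda>s. W j (s j)) \<in> borel_measurable (\<Pi>\<^sub>M j\<in>insert i J. lborel)" if "j \<in> insert i J" for j
      using measurable_component_singleton[OF that, of "\<lambda>_. lborel::real measure"] W[OF that]
      by (intro measurable_compose[of "\<lambda>s. s j" _ borel "W j"]) simp_all
    then show "(\<lambda>s. ennreal (norm (\<phi> s)) * (\<Prod>j\<in>insert i J. W j (s j))) \<in> borel_measurable (\<Pi>\<^sub>M j\<in>insert i J. lborel)"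
      using \<phi> by (intro borel_measurable_times_ennreal borel_measurable_prod_ennreal) auto
  qed
  also have "C * \<dots> < \<infinity>" using C(1) fin by (simp add: ennreal_mult_less_top)
  finally have "AE x in (\<Pi>\<^sub>M j\<in>J. M j). (\<integral>\<^sup>+s. ennreal (norm (?h x s)) * W i s \<partial>lborel) \<noteq> \<infinity>"
  proof (intro nn_integral_PInf_AE)
    have "(\<lambda>x. \<Prod>j\<in>J. u j (x j)) \<in> borel_measurable (\<Pi>\<^sub>M j\<in>J. M j)"
      using blk(1) by (intro borel_measurable_prod measurable_compose[OF measurable_component_singleton]) (auto simp: radial_block_def)
    moreover have "(\<lambda>x. \<lambda>j\<in>J. p j (x j)) \<in> Pi\<^sub>M J M \<rightarrow>\<^sub>M (\<Pi>\<^sub>M j\<in>J. lborel)"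
      using blk(1) by (intro measurable_radii) (auto simp: radial_block_def)
    ultimately show "(\<lambda>x. \<integral>\<^sup>+s. ennreal (norm (?h x s)) * W i s \<partial>lborel) \<in> borel_measurable (\<Pi>\<^sub>M j\<in>J. M j)"
      unfolding hg by (intro borel_measurable_times_ennreal measurable_compose[OF _ g]) auto
  qed (erule less_imp_neq)
  then have AE: "AE x in (\<Pi>\<^sub>M j\<in>J. M j). (LINT y|M i. ?h x (p i y) * u i y) = (LINT y|N. ?h x (q y) * v y)"
  proof eventually_elim
    case (elim x)
    have "?h x \<in> borel_measurable borel"
      using fu_t[OF space[of x]] by simp
    moreover have "(\<integral>\<^sup>+s. ennreal (norm (?h x s)) * W i s \<partial>lborel) < \<infinity>"
      using elim unfolding infinity_ennreal_def less_top .
    ultimately show ?case by (rule eq)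
  qed
  have PJ: "(\<Pi>\<^sub>M j\<in>J. (M(i := N)) j) = (\<Pi>\<^sub>M j\<in>J. M j)"
    using J by (intro PiM_cong) auto
  have R: "(\<lambda>j\<in>J. (p(i := q)) j (x j)) = (\<lambda>j\<in>J. p j (x j))" "(\<Prod>j\<in>J. (u(i := v)) j (x j)) = (\<Prod>j\<in>J. u j (x j))" for x
    using J by (auto intro!: prod.cong simp: restrict_def)
  have meas: "(\<lambda>x. LINT y|M'. ?h x (p' y) * u' y) \<in> borel_measurable (\<Pi>\<^sub>M j\<in>J. M j)"
    if sf': "sigma_finite_measure M'" and blk': "radial_block (W i) M' p' u'" for M' p' u'
  proof (rule sigma_finite_measure.borel_measurable_lebesgue_integral[OF sf'])
    have u: "(\<lambda>x. \<Prod>j\<in>J. u j (x j)) \<in> borel_measurable (\<Pi>\<^sub>M j\<in>J. M j)"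
      using blk(1) by (intro borel_measurable_prod measurable_compose[OF measurable_component_singleton]) (auto simp: radial_block_def)
    have p: "(\<lambda>x. \<lambda>j\<in>J. p j (x j)) \<in> Pi\<^sub>M J M \<rightarrow>\<^sub>M (\<Pi>\<^sub>M j\<in>J. lborel)"
      using blk(1) by (intro measurable_radii) (auto simp: radial_block_def)
    have p': "p' \<in> M' \<rightarrow>\<^sub>M lborel" "u' \<in> borel_measurable M'"
      using blk' by (auto simp: radial_block_def)
    have "(\<lambda>z. ((\<lambda>j\<in>J. p j (fst z j)), p' (snd z))) \<in> (\<Pi>\<^sub>M j\<in>J. M j) \<Otimes>\<^sub>M M' \<rightarrow>\<^sub>M (\<Pi>\<^sub>M j\<in>J. lborel) \<Otimes>\<^sub>M lborel"
      by (intro measurable_Pair measurable_compose[OF measurable_fst p] measurable_compose[OF measurable_snd p'(1)])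
    from measurable_compose[OF this fu]
    show "(\<lambda>(x, y). ?h x (p' y) * u' y) \<in> borel_measurable ((\<Pi>\<^sub>M j\<in>J. M j) \<Otimes>\<^sub>M M')"
      using measurable_compose[OF measurable_fst u] measurable_compose[OF measurable_snd p'(2)]
      unfolding split_beta' by (intro borel_measurable_times) simp_all
  qed
  have "(LINT x|(\<Pi>\<^sub>M j\<in>insert i J. M j). \<phi> (\<lambda>j\<in>insert i J. p j (x j)) * (\<Prod>j\<in>insert i J. u j (x j))) =
    (LINT x|(\<Pi>\<^sub>M j\<in>J. M j). LINT y|M i. ?h x (p i y) * u i y)"
    by (rule split[OF sf(1) blk(1)])
  also have "\<dots> = (LINT x|(\<Pi>\<^sub>M j\<in>J. M j). LINT y|N. ?h x (q y) * v y)"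
    using AE blk sf by (intro integral_cong_AE meas) auto
  also have "\<dots> = (LINT x|(\<Pi>\<^sub>M j\<in>insert i J. (M(i := N)) j). \<phi> (\<lambda>j\<in>insert i J. (p(i := q)) j (x j)) * (\<Prod>j\<in>insert i J. (u(i := v)) j (x j)))"
  proof -
    have sf': "sigma_finite_measure ((M(i := N)) j)" for j
      using sf by (cases "j = i") auto
    have blk': "radial_block (W j) ((M(i := N)) j) ((p(i := q)) j) ((u(i := v)) j)" if "j \<in> insert i J" for j
      using that blk J by (cases "j = i") auto
    show ?thesis using split[OF sf' blk'] unfolding PJ R by (simp only: fun_upd_same)
  qed
  finally show ?thesis .
qed

text \<open>The blocks are exchanged one at a time.\<close>

lemma integral_PiM_blocks_eq:
  fixes M N :: "'i \<Rightarrow> 'a measure" and \<phi> :: "('i \<Rightarrow> real) \<Rightarrow> complex"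
  assumes I: "finite I" and sf: "\<And>j. sigma_finite_measure (M j)" "\<And>j. sigma_finite_measure (N j)"
    and W: "\<And>j. j \<in> I \<Longrightarrow> W j \<in> borel_measurable borel"
    and blk: "\<And>j. j \<in> I \<Longrightarrow> radial_block (W j) (M j) (p j) (u j)" "\<And>j. j \<in> I \<Longrightarrow> radial_block (W j) (N j) (q j) (v j)"
    and eq: "\<And>j h. j \<in> I \<Longrightarrow> h \<in> borel_measurable borel \<Longrightarrow> (\<integral>\<^sup>+s. ennreal (norm (h s)) * W j s \<partial>lborel) < \<infinity> \<Longrightarrow>
      (LINT x|M j. h (p j x) * u j x) = (LINT x|N j. h (q j x) * v j x)"
    and \<phi>: "\<phi> \<in> borel_measurable (\<Pi>\<^sub>M j\<in>I. lborel)"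
    and fin: "(\<integral>\<^sup>+s. ennreal (norm (\<phi> s)) * (\<Prod>j\<in>I. W j (s j)) \<partial>(\<Pi>\<^sub>M j\<in>I. lborel)) < \<infinity>"
  shows "(LINT x|(\<Pi>\<^sub>M j\<in>I. M j). \<phi> (\<lambda>j\<in>I. p j (x j)) * (\<Prod>j\<in>I. u j (x j))) =
    (LINT x|(\<Pi>\<^sub>M j\<in>I. N j). \<phi> (\<lambda>j\<in>I. q j (x j)) * (\<Prod>j\<in>I. v j (x j)))"
proof -
  let ?F = "\<lambda>M p u. LINT x|(\<Pi>\<^sub>M j\<in>I. M j). \<phi> (\<lambda>j\<in>I. p j (x j)) * (\<Prod>j\<in>I. u j (x j))"
  let ?mix = "\<lambda>K a b j. if j \<in> K then b j else a j"
  have mix: "?F M p u = ?F (?mix K M N) (?mix K p q) (?mix K u v)" if "finite K" "K \<subseteq> I" for K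
    using that
  proof (induction K rule: finite_induct)
    case empty
    then show ?case by simp
  next
    case (insert i K)
    define J where "J = I - {i}"
    have J: "I = insert i J" "finite J" "i \<notin> J" using insert.prems I by (auto simp: J_def)
    have upd: "(?mix K a b)(i := b i) = ?mix (insert i K) a b" for a b :: "'i \<Rightarrow> 'z"
      by auto
    have "?F M p u = ?F (?mix K M N) (?mix K p q) (?mix K u v)"
      using insert.prems by (intro insert.IH) simp
    also have "\<dots> = ?F ((?mix K M N)(i := N i)) ((?mix K p q)(i := q i)) ((?mix K u v)(i := v i))"
      unfolding J(1)
    proof (rule integral_PiM_replace_block[where W=W])
      show "sigma_finite_measure (?mix K M N j)" "sigma_finite_measure (N i)" for j
        using sf by auto
      show "radial_block (W i) (N i) (q i) (v i)"
        using blk J(1) by auto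
      show "W j \<in> borel_measurable borel"
        "radial_block (W j) (?mix K M N j) (?mix K p q j) (?mix K u v j)" if "j \<in> insert i J" for j
        using that blk W J(1) by auto
      show "(LINT x|?mix K M N i. h (?mix K p q i x) * ?mix K u v i x) = (LINT x|N i. h (q i x) * v i x)"
        if "h \<in> borel_measurable borel" "(\<integral>\<^sup>+s. ennreal (norm (h s)) * W i s \<partial>lborel) < \<infinity>" for h
        using that insert.hyps insert.prems eq by auto
    qed (use J \<phi> fin in \<open>auto simp del: fun_upd_apply\<close>)
    finally show ?case unfolding upd .
  qed
  have "?F (?mix I M N) (?mix I p q) (?mix I u v) = ?F N q v"
  proof -
    have "(\<Pi>\<^sub>M j\<in>I. ?mix I M N j) = (\<Pi>\<^sub>M j\<in>I. N j)" by (intro PiM_cong) auto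
    moreover have "(\<lambda>j\<in>I. ?mix I p q j (x j)) = (\<lambda>j\<in>I. q j (x j))" "(\<Prod>j\<in>I. ?mix I u v j (x j)) = (\<Prod>j\<in>I. v j (x j))" for x
      by (auto intro!: prod.cong)
    ultimately show ?thesis by simp
  qed
  with mix[OF I order_refl] show ?thesis by simp
qed

subsection \<open>Derivatives under the integral sign\<close>

lemma has_vector_derivative_iff_slope:
  fixes f :: "real \<Rightarrow> 'a::real_normed_vector"
  shows "(f has_vector_derivative D) (at x) \<longleftrightarrow> ((\<lambda>t. (f t - f x) /\<^sub>R (t - x)) \<longlongrightarrow> D) (at x)"
proof -
  have "norm (f t - f x - (t - x) *\<^sub>R D) / norm (t - x) = norm ((f t - f x) /\<^sub>R (t - x) - D)" if "t \<noteq> x" for t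
  proof -
    have "(f t - f x) /\<^sub>R (t - x) - D = (f t - f x - (t - x) *\<^sub>R D) /\<^sub>R (t - x)"
      using that by (simp add: scaleR_diff_right)
    then show ?thesis by (simp add: divide_inverse_commute)
  qed
  then have "((\<lambda>t. norm (f t - f x - (t - x) *\<^sub>R D) / norm (t - x)) \<longlongrightarrow> 0) (at x) \<longleftrightarrow>
    ((\<lambda>t. norm ((f t - f x) /\<^sub>R (t - x) - D)) \<longlongrightarrow> 0) (at x)"
    by (intro filterlim_cong) (auto simp: eventually_at_filter)
  then show ?thesis
    unfolding has_vector_derivative_def has_derivative_iff_norm tendsto_norm_zero_iff LIM_zero_iff
    by (simp add: bounded_linear_scaleR_left)
qed

text \<open>A chord of the unit circle is no longer than its arc. This bounds the difference
  quotients of the exponential uniformly.\<close>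

lemma norm_exp_imaginary_diff_le:
  "norm (exp (\<i> * complex_of_real a) - exp (\<i> * complex_of_real b)) \<le> \<bar>a - b\<bar>"
proof -
  have "exp (\<i> * complex_of_real a) - exp (\<i> * complex_of_real b) =
    exp (\<i> * complex_of_real b) * (exp (\<i> * complex_of_real (a - b)) - 1)"
    by (simp add: right_diff_distrib exp_add[symmetric])
  then have "norm (exp (\<i> * complex_of_real a) - exp (\<i> * complex_of_real b)) = norm (exp (\<i> * of_real (a - b)) - 1)"
    by (simp add: norm_mult)
  also have "\<dots> \<le> \<bar>a - b\<bar>"
    unfolding dist_exp_i_1 using abs_sin_x_le_abs_x[of "(a - b) / 2"] by simp
  finally show ?thesis .
qed

text \<open>Dominated convergence along sequences: by the chord estimate every difference quotient
  of the integrand is bounded by the norm of \<open>g x * y x\<close>, independently of the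
  parameter.\<close>

lemma has_vector_derivative_integral_exp:
  fixes g :: "'a \<Rightarrow> complex" and y :: "'a \<Rightarrow> real"
  assumes g: "integrable M g" and [measurable]: "y \<in> borel_measurable M"
    and gy: "integrable M (\<lambda>x. g x * complex_of_real (y x))"
  shows "((\<lambda>t. LINT x|M. g x * exp (\<i> * complex_of_real (t * y x))) has_vector_derivative
    (LINT x|M. (g x * (\<i> * complex_of_real (y x))) * exp (\<i> * complex_of_real (t0 * y x)))) (at t0)"
proof -
  have [measurable]: "g \<in> borel_measurable M" using g by auto
  have int: "integrable M (\<lambda>x. g x * exp (\<i> * complex_of_real (t * y x)))" for t
    by (rule Bochner_Integration.integrable_bound[OF g]) (auto simp: norm_mult)
  let ?e = "\<lambda>t x. exp (\<i> * complex_of_real (t * y x))"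
  have "((\<lambda>t. (LINT x|M. g x * ((?e t x - ?e t0 x) /\<^sub>R (t - t0)))) \<longlongrightarrow>
     (LINT x|M. g x * (\<i> * complex_of_real (y x)) * ?e t0 x)) (at t0)"
    unfolding tendsto_at_iff_sequentially comp_def
  proof (intro allI impI)
    fix X :: "nat \<Rightarrow> real" assume X: "\<forall>i. X i \<in> UNIV - {t0}" "X \<longlonglongrightarrow> t0"
    show "(\<lambda>n. LINT x|M. g x * ((?e (X n) x - ?e t0 x) /\<^sub>R (X n - t0))) \<longlonglongrightarrow>
      (LINT x|M. g x * (\<i> * complex_of_real (y x)) * ?e t0 x)"
    proof (rule integral_dominated_convergence[where w="\<lambda>x. norm (g x * complex_of_real (y x))"])
      show "integrable M (\<lambda>x. norm (g x * complex_of_real (y x)))" using gy by (rule integrable_norm)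
      show "AE x in M. (\<lambda>n. g x * ((?e (X n) x - ?e t0 x) /\<^sub>R (X n - t0))) \<longlonglongrightarrow> g x * (\<i> * complex_of_real (y x)) * ?e t0 x"
      proof (rule AE_I2)
        fix x
        have "((\<lambda>t. exp (\<i> * t * complex_of_real (y x))) has_field_derivative (\<i> * complex_of_real (y x)) * ?e t0 x)
          (at (complex_of_real t0))"
          by (auto intro!: derivative_eq_intros simp: mult_ac)
        then have "((\<lambda>t. exp (\<i> * complex_of_real t * complex_of_real (y x))) has_vector_derivative (\<i> * complex_of_real (y x)) * ?e t0 x) (at t0)"
          by (rule has_vector_derivative_real_field)
        then have "((\<lambda>t. (?e t x - ?e t0 x) /\<^sub>R (t - t0)) \<longlongrightarrow> (\<i> * complex_of_real (y x)) * ?e t0 x) (at t0)"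
          unfolding has_vector_derivative_iff_slope by (simp add: mult_ac)
        then have "(\<lambda>n. (?e (X n) x - ?e t0 x) /\<^sub>R (X n - t0)) \<longlonglongrightarrow> (\<i> * complex_of_real (y x)) * ?e t0 x"
          unfolding tendsto_at_iff_sequentially comp_def using X by blast
        from tendsto_mult[OF tendsto_const[of "g x"] this]
        show "(\<lambda>n. g x * ((?e (X n) x - ?e t0 x) /\<^sub>R (X n - t0))) \<longlonglongrightarrow> g x * (\<i> * complex_of_real (y x)) * ?e t0 x"
          by (simp only: mult.assoc)
      qed
      show "AE x in M. norm (g x * ((?e (X n) x - ?e t0 x) /\<^sub>R (X n - t0))) \<le> norm (g x * complex_of_real (y x))" for n
      proof (rule AE_I2)
        fix x
        have "norm (?e (X n) x - ?e t0 x) \<le> \<bar>X n * y x - t0 * y x\<bar>"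
          by (rule norm_exp_imaginary_diff_le)
        also have "\<dots> = \<bar>X n - t0\<bar> * \<bar>y x\<bar>"
          by (simp add: abs_mult[symmetric] left_diff_distrib)
        finally have "norm ((?e (X n) x - ?e t0 x) /\<^sub>R (X n - t0)) \<le> \<bar>y x\<bar>"
          using X(1)[rule_format, of n] unfolding norm_scaleR by (simp add: divide_simps mult.commute)
        then show "norm (g x * ((?e (X n) x - ?e t0 x) /\<^sub>R (X n - t0))) \<le> norm (g x * complex_of_real (y x))"
          unfolding norm_mult by (intro mult_left_mono) auto
      qed
    qed measurable
  qed
  moreover have "(LINT x|M. g x * ((?e t x - ?e t0 x) /\<^sub>R (t - t0))) =
    ((LINT x|M. g x * ?e t x) - (LINT x|M. g x * ?e t0 x)) /\<^sub>R (t - t0)" for t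
    unfolding Bochner_Integration.integral_diff[OF int int, symmetric] integral_scaleR_right[symmetric]
    by (simp add: right_diff_distrib mult_ac)
  ultimately show ?thesis
    unfolding has_vector_derivative_iff_slope by (simp only:)
qed

section \<open>Moments of multiradial functions and their derivatives\<close>

lemma radial_block_PiM:
  fixes n :: nat and u :: "(nat \<Rightarrow> real) \<Rightarrow> complex"
  assumes n: "n \<ge> 1" and p: "n - 1 + a \<le> p"
    and u: "\<And>x. norm (u x) \<le> C * (1 + L2_set x {..<n}) ^ a"
    and meas: "u \<in> borel_measurable (\<Pi>\<^sub>M i\<in>{..<n}. lborel)"
  shows "radial_block (radial_weight p) (\<Pi>\<^sub>M i\<in>{..<n}. lborel) (\<lambda>x. L2_set x {..<n}) u"
  unfolding radial_block_def
proof (intro conjI exI ballI)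
  show "ennreal (C * (unit_ball_vol n * n)) < \<infinity>" by simp
  show "(\<integral>\<^sup>+x. f (L2_set x {..<n}) * ennreal (norm (u x)) \<partial>(\<Pi>\<^sub>M i\<in>{..<n}. lborel)) \<le>
    ennreal (C * (unit_ball_vol n * n)) * (\<integral>\<^sup>+s. f s * radial_weight p s \<partial>lborel)"
    if "f \<in> borel_measurable borel" for f
    using n p u that by (rule nn_integral_block_le)
qed (use meas in auto)

lemma sigma_finite_PiM_lborel: "sigma_finite_measure (\<Pi>\<^sub>M i\<in>{..<n::nat}. lborel :: real measure)"
  by (rule lborel_product.sigma_finite) simp

text \<open>
  This is the \<open>l\<close>-th mixed derivative of the transform, evaluated at the frequencies
  \<open>r\<^sub>j e\<^sub>0\<close>.
\<close>

definition radial_moment ::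
  "nat \<Rightarrow> (nat \<Rightarrow> nat) \<Rightarrow> ((nat \<Rightarrow> real) \<Rightarrow> complex) \<Rightarrow> (nat \<Rightarrow> nat) \<Rightarrow> (nat \<Rightarrow> real) \<Rightarrow> complex" where
  "radial_moment m n \<phi> l r =
     (LINT x|(\<Pi>\<^sub>M j\<in>{..<m}. \<Pi>\<^sub>M i\<in>{..<n j}. lborel). \<phi> (block_norms m n x) *
        (\<Prod>j<m. (- 2 * complex_of_real pi * \<i> * complex_of_real (x j 0)) ^ l j *
          exp (- 2 * complex_of_real pi * \<i> * complex_of_real (r j * x j 0))))"

text \<open>The integral runs over all of the space, but the weights vanish unless every coordinate
  is nonnegative, so it measures \<open>\<phi>\<close> on the closed orthant.\<close>

definition radially_integrable :: "nat \<Rightarrow> (nat \<Rightarrow> nat) \<Rightarrow> ((nat \<Rightarrow> real) \<Rightarrow> complex) \<Rightarrow> bool" where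
  "radially_integrable m P \<phi> \<longleftrightarrow> \<phi> \<in> borel_measurable (\<Pi>\<^sub>M j\<in>{..<m}. lborel) \<and>
     (\<integral>\<^sup>+s. ennreal (norm (\<phi> s)) * (\<Prod>j<m. radial_weight (P j) (s j)) \<partial>(\<Pi>\<^sub>M j\<in>{..<m}. lborel)) < \<infinity>"

text \<open>The bounded factor \<open>e\<close> is left open: it is an exponential in general, but
  the constant 1 in the block whose frequency is being varied.\<close>

lemma radial_block_moment:
  assumes n: "n \<ge> 1" and p: "n - 1 + a \<le> p"
    and e: "e \<in> borel_measurable borel" "\<And>y. norm (e y) \<le> 1"
  shows "radial_block (radial_weight p) (\<Pi>\<^sub>M i\<in>{..<n::nat}. lborel) (\<lambda>x. L2_set x {..<n})
    (\<lambda>x. (- 2 * complex_of_real pi * \<i> * complex_of_real (x 0)) ^ a * e (x 0))"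
proof (rule radial_block_PiM[OF n p, where C="(2 * pi) ^ a"])
  fix x :: "nat \<Rightarrow> real"
  have "\<bar>x 0\<bar> \<le> 1 + L2_set x {..<n}"
    using abs_le_L2_set[of "{..<n}" 0 x] n by simp
  then have "\<bar>x 0\<bar> ^ a \<le> (1 + L2_set x {..<n}) ^ a" by (rule power_mono) simp
  then have "(2 * pi) ^ a * \<bar>x 0\<bar> ^ a * norm (e (x 0)) \<le> (2 * pi) ^ a * (1 + L2_set x {..<n}) ^ a * 1"
    using e(2) by (intro mult_mono mult_left_mono) auto
  then show "norm ((- 2 * complex_of_real pi * \<i> * complex_of_real (x 0)) ^ a * e (x 0)) \<le>
      (2 * pi) ^ a * (1 + L2_set x {..<n}) ^ a"
    by (simp add: norm_mult norm_power power_mult_distrib)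
next
  have [measurable]: "(\<lambda>x. x 0) \<in> borel_measurable (\<Pi>\<^sub>M i\<in>{..<n}. (lborel::real measure))"
    using n by (intro measurable_PiM_lborel_coord) simp
  note [measurable] = e(1)
  show "(\<lambda>x. (- 2 * complex_of_real pi * \<i> * complex_of_real (x 0)) ^ a * e (x 0)) \<in>
    borel_measurable (\<Pi>\<^sub>M i\<in>{..<n}. lborel)"
    by measurable
qed

lemma integrable_radially_integrable:
  fixes u :: "nat \<Rightarrow> (nat \<Rightarrow> real) \<Rightarrow> complex"
  assumes \<phi>: "radially_integrable m P \<phi>"
    and blk: "\<And>j. j < m \<Longrightarrow> radial_block (radial_weight (P j)) (\<Pi>\<^sub>M i\<in>{..<n j}. lborel) (\<lambda>x. L2_set x {..<n j}) (u j)"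
  shows "integrable (\<Pi>\<^sub>M j\<in>{..<m}. \<Pi>\<^sub>M i\<in>{..<n j}. lborel) (\<lambda>x. \<phi> (block_norms m n x) * (\<Prod>j<m. u j (x j)))"
  unfolding block_norms_def using \<phi> blk
  by (intro integrable_PiM_radial_block[where W="\<lambda>j. radial_weight (P j)" and p="\<lambda>j x. L2_set x {..<n j}"])
     (auto simp: radially_integrable_def sigma_finite_PiM_lborel)

lemma has_vector_derivative_radial_moment:
  assumes \<phi>: "radially_integrable m P \<phi>" and j: "j < m"
    and n: "\<And>i. i < m \<Longrightarrow> n i \<ge> 1" "\<And>i. i < m \<Longrightarrow> n i - 1 + (l(j := Suc (l j))) i \<le> P i"
  shows "((\<lambda>t. radial_moment m n \<phi> l (r(j := t))) has_vector_derivative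
    radial_moment m n \<phi> (l(j := Suc (l j))) r) (at (r j))"
proof -
  let ?M = "\<Pi>\<^sub>M j\<in>{..<m}. \<Pi>\<^sub>M i\<in>{..<n j}. (lborel :: real measure)"
  define c where "c = - 2 * complex_of_real pi * \<i>"
  define e where "e t y = exp (c * complex_of_real (t * y))" for t y :: real
  \<comment> \<open>The exponential of block \<open>j\<close> is left out, so that all dependence on
    the differentiation variable sits in one factor.\<close>
  define u where "u a i x = (c * complex_of_real (x 0)) ^ a i * (if i = j then 1 else e (r i) (x 0))" for a i and x :: "nat \<Rightarrow> real"
  define g where "g a x = \<phi> (block_norms m n x) * (\<Prod>i<m. u a i (x i))" for a x
  have coord: "(\<lambda>x. x j 0) \<in> borel_measurable ?M"
  proof (rule measurable_compose[where f="\<lambda>x. x j"])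
    show "(\<lambda>x. x j) \<in> ?M \<rightarrow>\<^sub>M (\<Pi>\<^sub>M i\<in>{..<n j}. lborel)"
      using j by (intro measurable_component_singleton) simp
    show "(\<lambda>x. x 0) \<in> borel_measurable (\<Pi>\<^sub>M i\<in>{..<n j}. (lborel :: real measure))"
      using n(1)[OF j] by (intro measurable_PiM_lborel_coord) simp
  qed
  have e_meas: "(\<lambda>y. if i = j then 1 else e (r i) y) \<in> borel_measurable borel" for i
    unfolding e_def by (cases "i = j") simp_all
  have e_norm: "norm (if i = j then 1 else e (r i) y) \<le> 1" for i y
    unfolding e_def c_def norm_exp_imaginary by (simp del: of_real_mult)
  have int: "integrable ?M (g a)" if "\<And>i. i < m \<Longrightarrow> a i \<le> (l(j := Suc (l j))) i" for a
    unfolding g_def u_def c_def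
    using order_trans[OF add_left_mono[OF that] n(2)] n(1)
    by (intro integrable_radially_integrable[OF \<phi>] radial_block_moment e_meas e_norm)
  have split: "radial_moment m n \<phi> a (r(j := t)) =
    (LINT x|?M. g a x * exp (\<i> * complex_of_real (t * (- 2 * pi * x j 0))))" for a t
  proof -
    have "(\<Prod>i<m. (c * complex_of_real (x i 0)) ^ a i * e ((r(j := t)) i) (x i 0)) = 
       (\<Prod>i<m. u a i (x i)) * e t (x j 0)" for x
    proof -
      have "(\<Prod>i<m. (c * complex_of_real (x i 0)) ^ a i * e ((r(j := t)) i) (x i 0)) = 
        (\<Prod>i<m. u a i (x i) * (if i = j then e t (x j 0) else 1))"
        unfolding u_def by (intro prod.cong) auto
      also have "\<dots> = (\<Prod>i<m. u a i (x i)) * e t (x j 0)"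
        using j by (simp add: prod.distrib)
      finally show ?thesis .
    qed
    moreover have "e t y = exp (\<i> * complex_of_real (t * (- 2 * pi * y)))" for y
      unfolding e_def c_def by (simp add: mult_ac)
    ultimately show ?thesis
      unfolding radial_moment_def g_def c_def[symmetric] e_def[symmetric] by (simp add: mult.assoc)
  qed
  have g_Suc: "g l x * (\<i> * complex_of_real (- 2 * pi * x j 0)) = g (l(j := Suc (l j))) x" for x
  proof -
    have "(\<Prod>i<m. u (l(j := Suc (l j))) i (x i)) = (\<Prod>i<m. u l i (x i) * (if i = j then c * complex_of_real (x j 0) else 1))"
      unfolding u_def by (intro prod.cong) auto
    also have "\<dots> = (\<Prod>i<m. u l i (x i)) * (c * complex_of_real (x j 0))"
      using j by (simp add: prod.distrib)
    finally show ?thesis unfolding g_def c_def by (simp add: mult_ac)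
  qed
  have "integrable ?M (\<lambda>x. (- \<i>) * g (l(j := Suc (l j))) x)"
    using int[of "l(j := Suc (l j))"] by (intro integrable_mult_right) auto
  then have "integrable ?M (\<lambda>x. g l x * complex_of_real (- 2 * pi * x j 0))"
    unfolding g_Suc[symmetric] by (simp add: mult_ac)
  moreover have "integrable ?M (g l)" by (rule int) simp
  moreover have "(\<lambda>x. - 2 * pi * x j 0) \<in> borel_measurable ?M"
    using coord by (intro borel_measurable_times) auto
  ultimately have "((\<lambda>t. LINT x|?M. g l x * exp (\<i> * complex_of_real (t * (- 2 * pi * x j 0)))) has_vector_derivative
    (LINT x|?M. (g l x * (\<i> * complex_of_real (- 2 * pi * x j 0))) * exp (\<i> * complex_of_real (r j * (- 2 * pi * x j 0))))) (at (r j))"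
    by (intro has_vector_derivative_integral_exp)
  then show ?thesis
    unfolding g_Suc split[symmetric] by simp
qed

lemma open_orthant_upd: "r \<in> open_orthant m \<Longrightarrow> j < m \<Longrightarrow> t > 0 \<Longrightarrow> r(j := t) \<in> open_orthant m"
  by (auto simp: open_orthant_def PiE_def extensional_def)

lemma open_orthant_pos: "r \<in> open_orthant m \<Longrightarrow> j < m \<Longrightarrow> r j > 0"
  by (auto simp: open_orthant_def)

text \<open>The functions being differentiated are known only on the open orthant. This is enough,
  because differentiation is local and all positive values of coordinate \<open>j\<close> stay in
  the orthant.\<close>

lemma has_vector_derivative_eq_radial_moment:
  assumes \<phi>: "radially_integrable m P \<phi>" and j: "j < m"
    and n: "\<And>i. i < m \<Longrightarrow> n i \<ge> 1" "\<And>i. i < m \<Longrightarrow> n i - 1 + (l(j := Suc (l j))) i \<le> P i"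
    and F: "\<And>r. r \<in> open_orthant m \<Longrightarrow> F r = radial_moment m n \<phi> l r"
    and r: "r \<in> open_orthant m"
  shows "((\<lambda>t. F (r(j := t))) has_vector_derivative radial_moment m n \<phi> (l(j := Suc (l j))) r) (at (r j))"
proof (rule has_vector_derivative_transform_within_open[where S="{0<..}"])
  show "((\<lambda>t. radial_moment m n \<phi> l (r(j := t))) has_vector_derivative
    radial_moment m n \<phi> (l(j := Suc (l j))) r) (at (r j))"
    by (rule has_vector_derivative_radial_moment[OF \<phi> j n])
  show "radial_moment m n \<phi> l (r(j := t)) = F (r(j := t))" if "t \<in> {0<..}" for t
    using that F[OF open_orthant_upd[OF r j]] by simp
qed (use open_orthant_pos[OF r j] in auto)

lemma funpow_partial_deriv_radial_moment:
  assumes \<phi>: "radially_integrable m P \<phi>" and j: "j < m"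
    and n: "\<And>i. i < m \<Longrightarrow> n i \<ge> 1" "\<And>i. i < m \<Longrightarrow> n i - 1 + (l(j := l j + a)) i \<le> P i"
    and F: "\<And>r. r \<in> open_orthant m \<Longrightarrow> F r = radial_moment m n \<phi> l r"
    and r: "r \<in> open_orthant m"
  shows "(partial_deriv j ^^ a) F r = radial_moment m n \<phi> (l(j := l j + a)) r"
  using n(2) r
proof (induction a arbitrary: r)
  case 0
  then show ?case using F by simp
next
  case (Suc a)
  have le: "n i - 1 + (l(j := l j + a)) i \<le> P i" if "i < m" for i
    using Suc.prems(1)[OF that] by (cases "i = j") auto
  have "((\<lambda>t. (partial_deriv j ^^ a) F (r(j := t))) has_vector_derivative
    radial_moment m n \<phi> ((l(j := l j + a))(j := Suc ((l(j := l j + a)) j))) r) (at (r j))"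
  proof (rule has_vector_derivative_eq_radial_moment[OF \<phi> j n(1) _ _ Suc.prems(2)])
    show "n i - 1 + ((l(j := l j + a))(j := Suc ((l(j := l j + a)) j))) i \<le> P i" if "i < m" for i
      using Suc.prems(1)[OF that] by simp
    show "(partial_deriv j ^^ a) F r = radial_moment m n \<phi> (l(j := l j + a)) r" if "r \<in> open_orthant m" for r
      using le that by (rule Suc.IH)
  qed
  from vector_derivative_at[OF this] show ?case
    unfolding funpow.simps comp_def partial_deriv_def[of j "(partial_deriv j ^^ a) F" r]
    by (simp only: fun_upd_upd fun_upd_same add_Suc_right)
qed

text \<open>After \<open>q\<close> stages only the coordinates below \<open>q\<close> have been
  differentiated, hence the truncated multi-index.\<close>

lemma mixed_deriv_radial_moment:
  assumes \<phi>: "radially_integrable m P \<phi>" and "q \<le> m"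
    and n: "\<And>i. i < m \<Longrightarrow> n i \<ge> 1" "\<And>i. i < m \<Longrightarrow> n i - 1 + l i \<le> P i"
    and F: "\<And>r. r \<in> open_orthant m \<Longrightarrow> F r = radial_moment m n \<phi> (\<lambda>_. 0) r"
    and r: "r \<in> open_orthant m"
  shows "mixed_deriv q l F r = radial_moment m n \<phi> (\<lambda>i. if i < q then l i else 0) r"
  using \<open>q \<le> m\<close> r
proof (induction q arbitrary: r)
  case 0
  then show ?case using F by simp
next
  case (Suc q)
  let ?l = "\<lambda>i. if i < q then l i else 0"
  have upd: "?l(q := ?l q + l q) = (\<lambda>i. if i < Suc q then l i else 0)"
    by (auto simp: less_Suc_eq)
  have "(partial_deriv q ^^ l q) (mixed_deriv q l F) r = radial_moment m n \<phi> (?l(q := ?l q + l q)) r"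
  proof (rule funpow_partial_deriv_radial_moment[OF \<phi> _ n(1) _ _ Suc.prems(2)])
    show "n i - 1 + (?l(q := ?l q + l q)) i \<le> P i" if "i < m" for i
      using n(2)[OF that] unfolding upd by simp
  qed (use Suc in auto)
  then show ?case unfolding upd by simp
qed

lemma mixed_differentiable_on_radial_moment:
  assumes \<phi>: "radially_integrable m P \<phi>"
    and n: "\<And>i. i < m \<Longrightarrow> n i \<ge> 1" "\<And>i. i < m \<Longrightarrow> n i - 1 + l i \<le> P i"
    and F: "\<And>r. r \<in> open_orthant m \<Longrightarrow> F r = radial_moment m n \<phi> (\<lambda>_. 0) r"
  shows "mixed_differentiable_on m l F (open_orthant m)"
  unfolding mixed_differentiable_on_def
proof (intro ballI allI impI)
  fix r j a assume r: "r \<in> open_orthant m" and j: "j < m" and a: "a < l j"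
  let ?l = "\<lambda>i. if i < j then l i else 0"
  have le: "n i - 1 + (?l(j := ?l j + b)) i \<le> P i" if "i < m" "b \<le> l j" for i b
    using n(2)[OF that(1)] that by auto
  have "((\<lambda>t. (partial_deriv j ^^ a) (mixed_deriv j l F) (r(j := t))) has_vector_derivative
    radial_moment m n \<phi> ((?l(j := ?l j + a))(j := Suc ((?l(j := ?l j + a)) j))) r) (at (r j))"
  proof (rule has_vector_derivative_eq_radial_moment[OF \<phi> j n(1) _ _ r])
    show "(partial_deriv j ^^ a) (mixed_deriv j l F) r = radial_moment m n \<phi> (?l(j := ?l j + a)) r"
      if "r \<in> open_orthant m" for r
      using a j that by (intro funpow_partial_deriv_radial_moment[OF \<phi> j n(1)] le
        mixed_deriv_radial_moment[OF \<phi> _ n F]) auto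
    show "n i - 1 + ((?l(j := ?l j + a))(j := Suc ((?l(j := ?l j + a)) j))) i \<le> P i" if "i < m" for i
      using le[OF that, of "Suc a"] a by auto
  qed
  then show "(\<lambda>t. (partial_deriv j ^^ a) (mixed_deriv j l F) (r(j := t))) differentiable at (r j)"
    by (rule differentiableI_vector)
qed

subsection \<open>Multiradial Fourier transforms\<close>

text \<open>Preimages under \<open>f\<close> and \<open>g\<close> differ inside a null set, so the
  almost-everywhere equality itself makes \<open>f\<close> measurable for the completion. This is
  how a transform of a Lebesgue measurable function becomes an integral of a Borel function over the
  uncompleted product.\<close>

lemma integral_completion_cong_AE:
  fixes f g :: "'a \<Rightarrow> 'b::{banach, second_countable_topology}"
  assumes g: "g \<in> borel_measurable M" and AE: "AE x in M. f x = g x"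
  shows "integral\<^sup>L (completion M) f = integral\<^sup>L M g"
proof -
  obtain N where N: "N \<in> null_sets M" "{x \<in> space M. f x \<noteq> g x} \<subseteq> N"
    using AE by (auto elim!: AE_E3 simp: eventually_ae_filter)
  have f: "f \<in> borel_measurable (completion M)"
  proof (rule measurableI)
    fix A :: "'b set" assume A: "A \<in> sets borel"
    have eq: "f -` A \<inter> space M = (g -` A \<inter> space M - N) \<union> (f -` A \<inter> space M \<inter> N)"
      using N(2) by auto
    have "g -` A \<inter> space M - N \<in> sets (completion M)"
      using measurable_sets[OF g A] N(1) by (intro sets_completionI_sets) auto
    moreover have "f -` A \<inter> space M \<inter> N \<in> sets (completion M)"
      by (rule null_sets_completion[OF N(1)]) auto
    ultimately show "f -` A \<inter> space (completion M) \<in> sets (completion M)"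
      unfolding space_completion by (subst eq) (rule sets.Un)
  qed simp
  have "integral\<^sup>L (completion M) f = integral\<^sup>L (completion M) g"
    by (rule integral_cong_AE[OF f measurable_completion[OF g] AE_completion[OF AE]])
  then show ?thesis using integral_completion[OF g] by simp
qed

lemma completion_ex_borel_measurable_complex:
  fixes g :: "'a \<Rightarrow> complex"
  assumes g: "g \<in> borel_measurable (completion M)"
  obtains g' where "g' \<in> borel_measurable M" "AE x in M. g x = g' x"
proof -
  obtain a where a: "a \<in> borel_measurable M" "AE x in M. Re (g x) = a x"
    using completion_ex_borel_measurable_real[of "\<lambda>x. Re (g x)" M] g by auto
  obtain b where b: "b \<in> borel_measurable M" "AE x in M. Im (g x) = b x"
    using completion_ex_borel_measurable_real[of "\<lambda>x. Im (g x)" M] g by auto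
  show ?thesis
  proof
    show "(\<lambda>x. complex_of_real (a x) + \<i> * complex_of_real (b x)) \<in> borel_measurable M"
      using a b by measurable
    show "AE x in M. g x = complex_of_real (a x) + \<i> * complex_of_real (b x)"
      using a(2) b(2) by eventually_elim (auto simp: complex_eq_iff)
  qed
qed

text \<open>The law of the radii is dominated by a weighted Lebesgue measure, so it charges no
  Lebesgue null set. Thus a change of the profile on a null set of radii changes the multiradial
  function only on a null set.\<close>

lemma AE_block_norms:
  assumes n: "\<And>j. j < m \<Longrightarrow> n j \<ge> 1"
    and AE: "AE s in (\<Pi>\<^sub>M j\<in>{..<m}. lborel :: real measure). Q s"
  shows "AE x in (\<Pi>\<^sub>M j\<in>{..<m}. \<Pi>\<^sub>M i\<in>{..<n j}. lborel). Q (block_norms m n x)"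
proof -
  let ?L = "\<Pi>\<^sub>M j\<in>{..<m}. lborel :: real measure"
  let ?M = "\<Pi>\<^sub>M j\<in>{..<m}. \<Pi>\<^sub>M i\<in>{..<n j}. (lborel :: real measure)"
  obtain N where N: "N \<in> null_sets ?L" "{s \<in> space ?L. \<not> Q s} \<subseteq> N"
    using AE by (auto simp: eventually_ae_filter)
  have [measurable]: "N \<in> sets ?L" using N by auto
  have norms: "block_norms m n \<in> ?M \<rightarrow>\<^sub>M ?L"
    unfolding block_norms_def[abs_def] by (rule measurable_radii) auto
  let ?f = "indicator N :: _ \<Rightarrow> ennreal"
  have blk: "radial_block (radial_weight (n j - 1)) (\<Pi>\<^sub>M i\<in>{..<n j}. lborel) (\<lambda>x. L2_set x {..<n j}) (\<lambda>_. 1)" if "j \<in> {..<m}" for j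
    using n[of j] that by (intro radial_block_PiM[where C=1 and a=0]) auto
  obtain C where C: "\<And>f. f \<in> borel_measurable ?L \<Longrightarrow>
      (\<integral>\<^sup>+x. f (\<lambda>j\<in>{..<m}. L2_set (x j) {..<n j}) * ennreal (norm (\<Prod>j<m. 1 :: complex)) \<partial>?M) \<le>
      C * (\<integral>\<^sup>+s. f s * (\<Prod>j<m. radial_weight (n j - 1) (s j)) \<partial>?L)"
    using nn_integral_PiM_radial_block[where I="{..<m}" and M="\<lambda>j. \<Pi>\<^sub>M i\<in>{..<n j}. lborel" and
       W="\<lambda>j. radial_weight (n j - 1)" and p="\<lambda>j x. L2_set x {..<n j}" and u="\<lambda>_ _. 1", OF finite_lessThan sigma_finite_PiM_lborel]
      blk measurable_radial_weight by blast
  have "(\<integral>\<^sup>+x. ?f (block_norms m n x) \<partial>?M) \<le> C * (\<integral>\<^sup>+s. ?f s * (\<Prod>j<m. radial_weight (n j - 1) (s j)) \<partial>?L)"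
    using C[of ?f] by (simp add: block_norms_def)
  also have "(\<integral>\<^sup>+s. ?f s * (\<Prod>j<m. radial_weight (n j - 1) (s j)) \<partial>?L) = (\<integral>\<^sup>+s. 0 \<partial>?L)"
    by (intro nn_integral_cong_AE) (rule AE_mp[OF AE_not_in[OF N(1)] AE_I2], simp)
  finally have "(\<integral>\<^sup>+x. ?f (block_norms m n x) \<partial>?M) = 0" by simp
  then have "AE x in ?M. ?f (block_norms m n x) = 0"
    using norms by (subst (asm) nn_integral_0_iff_AE) auto
  then show ?thesis
  proof (rule AE_mp[OF _ AE_I2[OF impI]])
    fix x assume "x \<in> space ?M" "?f (block_norms m n x) = 0"
    with N(2) measurable_space[OF norms] show "Q (block_norms m n x)"
      by (auto simp: indicator_def split: if_splits)
  qed
qed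

text \<open>Two replacements are made at once: \<open>\<phi>'\<close> by a Borel profile that agrees
  with it almost everywhere on the orthant, and each frequency block by the point at distance
  \<open>r j\<close> on its axis 0.\<close>

lemma fourier_multiradial:
  assumes \<phi>: "radially_integrable m P \<phi>"
    and n: "\<And>j. j < m \<Longrightarrow> n j \<ge> 1" "\<And>j. j < m \<Longrightarrow> n j - 1 \<le> P j"
    and AE: "AE s in (\<Pi>\<^sub>M j\<in>{..<m}. lborel :: real measure). s \<in> closed_orthant m \<longrightarrow> \<phi>' s = \<phi> s"
    and r: "\<And>j. j < m \<Longrightarrow> r j = block_norms m n \<xi> j"
  shows "fourier m n (multiradial m n \<phi>') \<xi> = radial_moment m n \<phi> (\<lambda>_. 0) r"
proof -
  let ?R = "\<lambda>j. \<Pi>\<^sub>M i\<in>{..<n j}. (lborel :: real measure)"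
  let ?M = "\<Pi>\<^sub>M j\<in>{..<m}. ?R j"
  define e where "e t = exp (- 2 * complex_of_real pi * \<i> * complex_of_real t)" for t
  have e_meas: "e \<in> borel_measurable borel" unfolding e_def by measurable
  have e_norm: "norm (e t) = 1" for t unfolding e_def by (rule norm_exp_imaginary)
  have e_sum: "e (\<Sum>j<m. f j) = (\<Prod>j<m. e (f j))" for f
    unfolding e_def by (simp add: sum_distrib_left exp_sum)
  \<comment> \<open>The exponential of the total phase factors over the blocks: \<open>u\<close> is
    the plane wave with the given frequency, \<open>v\<close> the one with the rotated frequency,
    and the blocks are then exchanged.\<close>
  define u where "u j x = e (\<Sum>i<n j. x i * \<xi> j i)" for j and x :: "nat \<Rightarrow> real"
  define v where "v j x = e (r j * x 0)" for j and x :: "nat \<Rightarrow> real"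
  have u_blk: "radial_block (radial_weight (P j)) (?R j) (\<lambda>x. L2_set x {..<n j}) (u j)" if j: "j < m" for j
  proof (rule radial_block_PiM[where C=1 and a=0])
    have "(\<lambda>x. \<Sum>i<n j. x i * \<xi> j i) \<in> borel_measurable (?R j)"
      by (intro borel_measurable_sum borel_measurable_times measurable_PiM_lborel_coord) auto
    then show "u j \<in> borel_measurable (?R j)"
      unfolding u_def by (rule measurable_compose[OF _ e_meas])
  qed (use n[OF j] in \<open>auto simp: u_def e_norm\<close>)
  have v_blk: "radial_block (radial_weight (P j)) (?R j) (\<lambda>x. L2_set x {..<n j}) (v j)" if j: "j < m" for j
  proof (rule radial_block_PiM[where C=1 and a=0])
    have "(\<lambda>x. r j * x 0) \<in> borel_measurable (?R j)"
      using n(1)[OF j] by (intro borel_measurable_times measurable_PiM_lborel_coord) auto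
    then show "v j \<in> borel_measurable (?R j)"
      unfolding v_def by (rule measurable_compose[OF _ e_meas])
  qed (use n[OF j] in \<open>auto simp: v_def e_norm\<close>)
  have uv: "(LINT x|?R j. h (L2_set x {..<n j}) * u j x) = (LINT x|?R j. h (L2_set x {..<n j}) * v j x)"
    if j: "j < m" and h: "h \<in> borel_measurable borel" for j h
    using integral_radial_plane_wave[OF n(1)[OF j] h e_meas, of "\<xi> j"] r[OF j] j
    unfolding u_def v_def by (simp add: block_norms_def)
  have "fourier m n (multiradial m n \<phi>') \<xi> = (LINT x|?M. \<phi> (\<lambda>j\<in>{..<m}. L2_set (x j) {..<n j}) * (\<Prod>j<m. u j (x j)))"
    unfolding fourier_def block_lebesgue_def
  proof (rule integral_completion_cong_AE)
    show "(\<lambda>x. \<phi> (\<lambda>j\<in>{..<m}. L2_set (x j) {..<n j}) * (\<Prod>j<m. u j (x j))) \<in> borel_measurable ?M"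
      using u_blk \<phi> by (intro measurable_block_integrand) (auto simp: radial_block_def radially_integrable_def)
    have "AE x in ?M. block_norms m n x \<in> closed_orthant m \<longrightarrow> \<phi>' (block_norms m n x) = \<phi> (block_norms m n x)"
      using n(1) AE by (rule AE_block_norms)
    then show "AE x in ?M. multiradial m n \<phi>' x * exp (- 2 * complex_of_real pi * \<i> * complex_of_real (\<Sum>j<m. \<Sum>i<n j. x j i * \<xi> j i)) =
      \<phi> (\<lambda>j\<in>{..<m}. L2_set (x j) {..<n j}) * (\<Prod>j<m. u j (x j))"
    proof eventually_elim
      case (elim x)
      have "block_norms m n x \<in> closed_orthant m"
        by (auto simp: block_norms_def closed_orthant_def)
      with elim show ?case
        unfolding multiradial_def u_def e_sum[symmetric] by (simp add: block_norms_def e_def)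
    qed
  qed
  also have "\<dots> = (LINT x|?M. \<phi> (\<lambda>j\<in>{..<m}. L2_set (x j) {..<n j}) * (\<Prod>j<m. v j (x j)))"
    using \<phi> u_blk v_blk uv
    by (intro integral_PiM_blocks_eq[where W="\<lambda>j. radial_weight (P j)"])
       (auto simp: sigma_finite_PiM_lborel radially_integrable_def)
  also have "\<dots> = radial_moment m n \<phi> (\<lambda>_. 0) r"
    unfolding radial_moment_def v_def e_def block_norms_def by simp
  finally show ?thesis .
qed

lemma multiradial_fourier_eq_radial_moment:
  assumes \<phi>: "radially_integrable m P \<phi>"
    and n: "\<And>j. j < m \<Longrightarrow> n j \<ge> 1" "\<And>j. j < m \<Longrightarrow> n j - 1 \<le> P j"
    and AE: "AE s in (\<Pi>\<^sub>M j\<in>{..<m}. lborel :: real measure). s \<in> closed_orthant m \<longrightarrow> \<phi>' s = \<phi> s"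
    and r: "r \<in> open_orthant m"
  shows "multiradial_fourier m n \<phi>' r = radial_moment m n \<phi> (\<lambda>_. 0) r"
  unfolding multiradial_fourier_def
proof (rule the_equality)
  show "\<forall>\<xi>\<in>space (block_lebesgue m n). (\<forall>j<m. r j = block_norms m n \<xi> j) \<longrightarrow>
    fourier m n (multiradial m n \<phi>') \<xi> = radial_moment m n \<phi> (\<lambda>_. 0) r"
    using fourier_multiradial[OF \<phi> n AE] by blast
  fix c assume c: "\<forall>\<xi>\<in>space (block_lebesgue m n). (\<forall>j<m. r j = block_norms m n \<xi> j) \<longrightarrow>
    fourier m n (multiradial m n \<phi>') \<xi> = c"
  \<comment> \<open>The frequencies with norms \<open>r\<close> must form a nonempty set, since
    otherwise every \<open>c\<close> would satisfy the condition. This witness puts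
    \<open>r j\<close> on the axis 0 of each block.\<close>
  define \<xi> where "\<xi> = (\<lambda>j\<in>{..<m}. \<lambda>i\<in>{..<n j}. if i = 0 then r j else 0)"
  have "\<xi> \<in> space (block_lebesgue m n)"
    by (auto simp: \<xi>_def block_lebesgue_def space_PiM)
  moreover have "r j = block_norms m n \<xi> j" if j: "j < m" for j
  proof -
    have "(\<Sum>i<n j. (\<xi> j i)\<^sup>2) = (\<Sum>i<n j. if i = 0 then (r j)\<^sup>2 else 0)"
      using j by (intro sum.cong) (auto simp: \<xi>_def)
    also have "\<dots> = (r j)\<^sup>2" using n(1)[OF j] by (subst sum.delta) auto
    finally show ?thesis
      using j open_orthant_pos[OF r j] by (simp add: block_norms_def L2_set_def)
  qed
  ultimately show "c = radial_moment m n \<phi> (\<lambda>_. 0) r"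
    using c fourier_multiradial[OF \<phi> n AE, of r \<xi>] by metis
qed

text \<open>Both parities are handled together through \<open>b\<close>. Each high-dimensional block
  is exchanged for its kernel in dimension \<open>b\<close>; the product of the kernels expands into
  a sum over multi-indices, and each term is a moment. The weight \<open>2 * k j + 1\<close> covers
  the radial density \<open>2 * k j + b - 1\<close> on one side and the growth
  \<open>b - 1 + k j\<close> on the other.\<close>

lemma radial_moment_dimension_reduction:
  assumes \<phi>: "radially_integrable m (\<lambda>j. 2 * k j + 1) \<phi>"
    and k: "\<And>j. j < m \<Longrightarrow> k j \<ge> 1" and b: "b = 1 \<or> b = 2" and r: "r \<in> open_orthant m"
  shows "radial_moment m (\<lambda>j. 2 * k j + b) \<phi> (\<lambda>_. 0) r =
    complex_of_real (1 / (2 * pi) ^ (\<Sum>j<m. k j)) *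
      (\<Sum>l\<in>(\<Pi>\<^sub>E j\<in>{..<m}. {1..k j}).
        complex_of_real (\<Prod>j<m. coeff (k j) (l j) * (1 / r j ^ (2 * k j - l j))) * radial_moment m (\<lambda>_. b) \<phi> l r)"
proof -
  let ?P = "\<lambda>j. 2 * k j + 1"
  let ?R = "\<lambda>n. \<Pi>\<^sub>M i\<in>{..<n}. (lborel :: real measure)"
  let ?W = "\<lambda>j. radial_weight (?P j)"
  define u where "u j x = radial_kernel 0 (r j) (x 0)" for j and x :: "nat \<Rightarrow> real"
  define w where "w j l x = (- 2 * complex_of_real pi * \<i> * complex_of_real (x 0)) ^ l *
    exp (- 2 * complex_of_real pi * \<i> * complex_of_real (r j * x 0))" for j l and x :: "nat \<Rightarrow> real"
  define a where "a j l = complex_of_real (coeff (k j) l * (1 / r j ^ (2 * k j - l)))" for j l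
  define v where "v j x = radial_kernel (k j) (r j) (x 0) / complex_of_real ((2 * pi) ^ k j)" for j and x :: "nat \<Rightarrow> real"
  have e_meas: "(\<lambda>y. exp (- 2 * complex_of_real pi * \<i> * complex_of_real (r j * y))) \<in> borel_measurable borel" for j
    by measurable
  have v_sum: "v j x = (\<Sum>l=1..k j. a j l * w j l x) / complex_of_real ((2 * pi) ^ k j)" if "j < m" for j x
    using k[OF that] unfolding v_def radial_kernel_def a_def w_def
    by (simp add: sum_distrib_right mult.assoc)
  have u_blk: "radial_block (?W j) (?R (2 * k j + b)) (\<lambda>x. L2_set x {..<2 * k j + b}) (u j)" if "j < m" for j
    using radial_block_moment[of "2 * k j + b" 0 "?P j" "radial_kernel 0 (r j)"] b k[OF that]
    unfolding u_def by auto
  have v_blk: "radial_block (?W j) (?R b) (\<lambda>x. L2_set x {..<b}) (v j)" if j: "j < m" for j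
  proof -
    obtain C where C: "\<And>y. norm (radial_kernel (k j) (r j) y) \<le> C * (1 + \<bar>y\<bar>) ^ k j"
      using norm_radial_kernel_le by blast
    have C0: "C \<ge> 0" using order_trans[OF norm_ge_zero C[of 0]] by simp
    show ?thesis
    proof (rule radial_block_PiM[where a="k j" and C="C / (2 * pi) ^ k j"])
      fix x :: "nat \<Rightarrow> real"
      have "norm (radial_kernel (k j) (r j) (x 0)) \<le> C * (1 + L2_set x {..<b}) ^ k j"
        using b C0 by (intro order_trans[OF C] mult_left_mono power_mono add_left_mono abs_le_L2_set) auto
      then show "norm (v j x) \<le> C / (2 * pi) ^ k j * (1 + L2_set x {..<b}) ^ k j"
        unfolding v_def by (simp add: norm_divide norm_mult norm_power divide_right_mono)
    next
      show "v j \<in> borel_measurable (?R b)"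
        unfolding v_def using b
        by (intro borel_measurable_divide measurable_compose[OF measurable_PiM_lborel_coord measurable_radial_kernel]) auto
    qed (use b k[OF j] in auto)
  qed
  have eq: "(LINT x|?R (2 * k j + b). h (L2_set x {..<2 * k j + b}) * u j x) = (LINT x|?R b. h (L2_set x {..<b}) * v j x)"
    if j: "j < m" and h: "h \<in> borel_measurable borel" and fin: "(\<integral>\<^sup>+s. ennreal (norm (h s)) * ?W j s \<partial>lborel) < \<infinity>" for j h
  proof -
    have fin': "(\<integral>\<^sup>+s. ennreal (norm (h s)) * radial_weight (2 * k j) s \<partial>lborel) < \<infinity>"
      by (rule le_less_trans[OF _ fin]) (auto intro!: nn_integral_mono mult_left_mono radial_weight_mono)
    have "(LINT x|?R b. h (L2_set x {..<b}) * v j x) =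
      (LINT x|?R b. h (L2_set x {..<b}) * radial_kernel (k j) (r j) (x 0)) / complex_of_real ((2 * pi) ^ k j)"
      unfolding v_def times_divide_eq_right by (rule integral_divide_zero)
    then show ?thesis
      using b integral_block_odd[OF open_orthant_pos[OF r j] h fin'] integral_block_even[OF open_orthant_pos[OF r j] h fin]
      unfolding u_def by (elim disjE) (simp_all only:)
  qed
  \<comment> \<open>Separate integrability of the terms lets the sum be taken out of the integral;
    it holds because \<open>l j \<le> k j\<close>.\<close>
  have w_int: "integrable (\<Pi>\<^sub>M j\<in>{..<m}. ?R b) (\<lambda>x. \<phi> (block_norms m (\<lambda>_. b) x) * (\<Prod>j<m. w j (l j) (x j)))"
    if "l \<in> (\<Pi>\<^sub>E j\<in>{..<m}. {1..k j})" for l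
  proof (rule integrable_radially_integrable[OF \<phi>, where n="\<lambda>_. b" and u="\<lambda>j. w j (l j)"])
    fix j assume "j < m"
    then have "l j \<le> k j" using PiE_mem[OF that, of j] by simp
    then have "b \<ge> 1" "b - 1 + l j \<le> ?P j" using b by auto
    then show "radial_block (?W j) (?R b) (\<lambda>x. L2_set x {..<b}) (w j (l j))"
      unfolding w_def
      by (rule radial_block_moment[where e="\<lambda>y. exp (- 2 * complex_of_real pi * \<i> * complex_of_real (r j * y))"])
         (rule e_meas, simp only: norm_exp_imaginary order_refl)
  qed
  have "radial_moment m (\<lambda>j. 2 * k j + b) \<phi> (\<lambda>_. 0) r =
    (LINT x|(\<Pi>\<^sub>M j\<in>{..<m}. ?R (2 * k j + b)). \<phi> (\<lambda>j\<in>{..<m}. L2_set (x j) {..<2 * k j + b}) * (\<Prod>j<m. u j (x j)))"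
    unfolding radial_moment_def u_def block_norms_def radial_kernel_def by simp
  also have "\<dots> = (LINT x|(\<Pi>\<^sub>M j\<in>{..<m}. ?R b). \<phi> (\<lambda>j\<in>{..<m}. L2_set (x j) {..<b}) * (\<Prod>j<m. v j (x j)))"
    using \<phi> u_blk v_blk eq
    by (intro integral_PiM_blocks_eq[where W="?W"]) (auto simp: sigma_finite_PiM_lborel radially_integrable_def)
  also have "\<dots> = (LINT x|(\<Pi>\<^sub>M j\<in>{..<m}. ?R b). complex_of_real (1 / (2 * pi) ^ (\<Sum>j<m. k j)) *
    (\<Sum>l\<in>(\<Pi>\<^sub>E j\<in>{..<m}. {1..k j}). (\<Prod>j<m. a j (l j)) * (\<phi> (block_norms m (\<lambda>_. b) x) * (\<Prod>j<m. w j (l j) (x j)))))"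
  proof (intro Bochner_Integration.integral_cong refl)
    fix x :: "nat \<Rightarrow> nat \<Rightarrow> real"
    have "(\<Prod>j<m. v j (x j)) = (\<Prod>j<m. \<Sum>l=1..k j. a j l * w j l (x j)) / complex_of_real ((2 * pi) ^ (\<Sum>j<m. k j))"
      by (simp add: v_sum prod_dividef power_sum)
    also have "(\<Prod>j<m. \<Sum>l=1..k j. a j l * w j l (x j)) =
      (\<Sum>l\<in>(\<Pi>\<^sub>E j\<in>{..<m}. {1..k j}). (\<Prod>j<m. a j (l j)) * (\<Prod>j<m. w j (l j) (x j)))"
      by (subst prod_sum_PiE) (auto simp: prod.distrib)
    finally show "\<phi> (\<lambda>j\<in>{..<m}. L2_set (x j) {..<b}) * (\<Prod>j<m. v j (x j)) =
      complex_of_real (1 / (2 * pi) ^ (\<Sum>j<m. k j)) *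
      (\<Sum>l\<in>(\<Pi>\<^sub>E j\<in>{..<m}. {1..k j}). (\<Prod>j<m. a j (l j)) * (\<phi> (block_norms m (\<lambda>_. b) x) * (\<Prod>j<m. w j (l j) (x j))))"
      by (simp add: block_norms_def sum_distrib_left sum_divide_distrib mult_ac)
  qed
  also have "\<dots> = complex_of_real (1 / (2 * pi) ^ (\<Sum>j<m. k j)) *
    (\<Sum>l\<in>(\<Pi>\<^sub>E j\<in>{..<m}. {1..k j}). LINT x|(\<Pi>\<^sub>M j\<in>{..<m}. ?R b).
      (\<Prod>j<m. a j (l j)) * (\<phi> (block_norms m (\<lambda>_. b) x) * (\<Prod>j<m. w j (l j) (x j))))"
    unfolding integral_mult_right_zero[of _ "complex_of_real (1 / (2 * pi) ^ (\<Sum>j<m. k j))"]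
    by (rule arg_cong[where f="(*) _"], rule Bochner_Integration.integral_sum) (intro integrable_mult_right w_int)
  also have "\<dots> = complex_of_real (1 / (2 * pi) ^ (\<Sum>j<m. k j)) *
      (\<Sum>l\<in>(\<Pi>\<^sub>E j\<in>{..<m}. {1..k j}).
        complex_of_real (\<Prod>j<m. coeff (k j) (l j) * (1 / r j ^ (2 * k j - l j))) * radial_moment m (\<lambda>_. b) \<phi> l r)"
  proof (intro arg_cong[where f="(*) _"] sum.cong refl)
    fix l
    show "(LINT x|(\<Pi>\<^sub>M j\<in>{..<m}. ?R b). (\<Prod>j<m. a j (l j)) * (\<phi> (block_norms m (\<lambda>_. b) x) * (\<Prod>j<m. w j (l j) (x j)))) =
      complex_of_real (\<Prod>j<m. coeff (k j) (l j) * (1 / r j ^ (2 * k j - l j))) * radial_moment m (\<lambda>_. b) \<phi> l r"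
      unfolding radial_moment_def w_def a_def of_real_prod by (rule integral_mult_right_zero)
  qed
  finally show ?thesis .
qed

theorem theorem1p1:
  fixes m :: nat and k :: "nat \<Rightarrow> nat" and \<phi> :: "(nat \<Rightarrow> real) \<Rightarrow> complex"
  assumes "m \<ge> 1"
    and "\<And>j. j < m \<Longrightarrow> k j \<ge> 1"
    and "set_borel_measurable (completion (\<Pi>\<^sub>M j\<in>{..<m}. (lborel :: real measure)))
           (closed_orthant m) \<phi>"
    and "(\<integral>\<^sup>+ r\<in>closed_orthant m. ennreal ((\<Prod>j<m. (1 + r j) ^ (2 * k j + 1)) * cmod (\<phi> r))
           \<partial>completion (\<Pi>\<^sub>M j\<in>{..<m}. (lborel :: real measure))) < \<infinity>"
  shows "(\<forall>l\<in>(\<Pi>\<^sub>E j\<in>{..<m}. {1..k j}).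
           mixed_differentiable_on m l (multiradial_fourier m (\<lambda>_. 1) \<phi>) (open_orthant m) \<and>
           mixed_differentiable_on m l (multiradial_fourier m (\<lambda>_. 2) \<phi>) (open_orthant m)) \<and>
         (\<forall>r\<in>open_orthant m.
           multiradial_fourier m (\<lambda>j. 2 * k j + 1) \<phi> r =
             complex_of_real (1 / (2 * pi) ^ (\<Sum>j<m. k j)) *
             (\<Sum>l\<in>(\<Pi>\<^sub>E j\<in>{..<m}. {1..k j}).
                complex_of_real (\<Prod>j<m. coeff (k j) (l j) * (1 / r j ^ (2 * k j - l j))) *
                mixed_deriv m l (multiradial_fourier m (\<lambda>_. 1) \<phi>) r)) \<and>
         (\<forall>r\<in>open_orthant m.
           multiradial_fourier m (\<lambda>j. 2 * k j + 2) \<phi> r =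
             complex_of_real (1 / (2 * pi) ^ (\<Sum>j<m. k j)) *
             (\<Sum>l\<in>(\<Pi>\<^sub>E j\<in>{..<m}. {1..k j}).
                complex_of_real (\<Prod>j<m. coeff (k j) (l j) * (1 / r j ^ (2 * k j - l j))) *
                mixed_deriv m l (multiradial_fourier m (\<lambda>_. 2) \<phi>) r))"
proof -
  let ?L = "\<Pi>\<^sub>M j\<in>{..<m}. (lborel :: real measure)"
  let ?P = "\<lambda>j. 2 * k j + 1"
  \<comment> \<open>A Borel representative of the function cut off outside the orthant;
    \<open>\<psi>\<close> therefore vanishes almost everywhere there, and both integrands compared
    below are zero off the orthant.\<close>
  obtain \<psi> where \<psi>: "\<psi> \<in> borel_measurable ?L" "AE s in ?L. indicator (closed_orthant m) s *\<^sub>R \<phi> s = \<psi> s"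
    using assms(3) unfolding set_borel_measurable_def by (rule completion_ex_borel_measurable_complex)
  have AE: "AE s in ?L. s \<in> closed_orthant m \<longrightarrow> \<phi> s = \<psi> s"
    using \<psi>(2) by eventually_elim auto
  have "(\<integral>\<^sup>+s. ennreal (norm (\<psi> s)) * (\<Prod>j<m. radial_weight (?P j) (s j)) \<partial>?L) =
    (\<integral>\<^sup>+ r\<in>closed_orthant m. ennreal ((\<Prod>j<m. (1 + r j) ^ (2 * k j + 1)) * cmod (\<phi> r)) \<partial>?L)"
  proof (rule nn_integral_cong_AE, rule AE_mp[OF \<psi>(2) AE_I2[OF impI]])
    fix s assume "s \<in> space ?L" and s: "indicator (closed_orthant m) s *\<^sub>R \<phi> s = \<psi> s"
    show "ennreal (norm (\<psi> s)) * (\<Prod>j<m. radial_weight (?P j) (s j)) =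
      ennreal ((\<Prod>j<m. (1 + s j) ^ (2 * k j + 1)) * cmod (\<phi> s)) * indicator (closed_orthant m) s"
    proof (cases "s \<in> closed_orthant m")
      case True
      then have pos: "s j \<ge> 0" if "j < m" for j using that by (auto simp: closed_orthant_def)
      have "(\<Prod>j<m. radial_weight (?P j) (s j)) = (\<Prod>j<m. ennreal ((1 + s j) ^ (2 * k j + 1)))"
        using pos by (intro prod.cong) (auto simp: radial_weight_def)
      also have "\<dots> = ennreal (\<Prod>j<m. (1 + s j) ^ (2 * k j + 1))"
        using pos by (intro prod_ennreal) auto
      finally have "(\<Prod>j<m. radial_weight (?P j) (s j)) = ennreal (\<Prod>j<m. (1 + s j) ^ (2 * k j + 1))" .
      moreover have "\<phi> s = \<psi> s" using s True by simp
      moreover have "(\<Prod>j<m. (1 + s j) ^ (2 * k j + 1)) \<ge> 0" using pos by (intro prod_nonneg) auto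
      ultimately show ?thesis
        using True by (simp only: ennreal_mult norm_ge_zero mult.commute indicator_simps mult_1_left)
    next
      case False
      then show ?thesis using s by simp
    qed
  qed
  then have \<psi>_int: "radially_integrable m ?P \<psi>"
    using \<psi>(1) assms(4) by (simp add: radially_integrable_def nn_integral_completion)
  \<comment> \<open>The bound on \<open>n\<close> is \<open>n j - 1 \<le> 2 * k j + 1\<close>, so
    one statement serves the dimensions 1, 2, \<open>2 * k j + 1\<close> and
    \<open>2 * k j + 2\<close>.\<close>
  have F: "multiradial_fourier m n \<phi> r = radial_moment m n \<psi> (\<lambda>_. 0) r"
    if "\<And>j. j < m \<Longrightarrow> 1 \<le> n j \<and> n j \<le> 2 * k j + 2" "r \<in> open_orthant m" for n r
    by (rule multiradial_fourier_eq_radial_moment[OF \<psi>_int _ _ AE that(2)]) (use that(1) in force)+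
  \<comment> \<open>The exponent budget for the derivatives: in dimension at most 2 the density
    takes at most one power and the order of differentiation at most \<open>k i\<close>.\<close>
  have deg: "b - 1 + l i \<le> ?P i" if "l \<in> (\<Pi>\<^sub>E j\<in>{..<m}. {1..k j})" "b = 1 \<or> b = 2" "i < m" for l b i
  proof -
    have "l i \<le> k i" using PiE_mem[OF that(1), of i] that(3) by simp
    then show ?thesis using that(2) by auto
  qed
  have diff: "mixed_differentiable_on m l (multiradial_fourier m (\<lambda>_. b) \<phi>) (open_orthant m)"
    if "l \<in> (\<Pi>\<^sub>E j\<in>{..<m}. {1..k j})" "b = 1 \<or> b = 2" for l b
    by (rule mixed_differentiable_on_radial_moment[OF \<psi>_int, where n="\<lambda>_. b"])
       (use that(2) in fastforce, rule deg[OF that], assumption, rule F, use that(2) in auto)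
  have deriv: "mixed_deriv m l (multiradial_fourier m (\<lambda>_. b) \<phi>) r = radial_moment m (\<lambda>_. b) \<psi> l r"
    if l: "l \<in> (\<Pi>\<^sub>E j\<in>{..<m}. {1..k j})" and b: "b = 1 \<or> b = 2" and r: "r \<in> open_orthant m" for l b r
  proof -
    have "mixed_deriv m l (multiradial_fourier m (\<lambda>_. b) \<phi>) r = radial_moment m (\<lambda>_. b) \<psi> (\<lambda>i. if i < m then l i else 0) r"
      by (rule mixed_deriv_radial_moment[OF \<psi>_int order_refl, where n="\<lambda>_. b"])
         (use b in fastforce, rule deg[OF l b], assumption, rule F, use b r in auto)
    also have "\<dots> = radial_moment m (\<lambda>_. b) \<psi> l r"
      unfolding radial_moment_def by (intro Bochner_Integration.integral_cong refl arg_cong2[where f="(*)"] prod.cong) auto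
    finally show ?thesis .
  qed
  have formula: "multiradial_fourier m (\<lambda>j. 2 * k j + b) \<phi> r =
      complex_of_real (1 / (2 * pi) ^ (\<Sum>j<m. k j)) *
        (\<Sum>l\<in>(\<Pi>\<^sub>E j\<in>{..<m}. {1..k j}).
           complex_of_real (\<Prod>j<m. coeff (k j) (l j) * (1 / r j ^ (2 * k j - l j))) *
           mixed_deriv m l (multiradial_fourier m (\<lambda>_. b) \<phi>) r)"
    if b: "b = 1 \<or> b = 2" and r: "r \<in> open_orthant m" for b r
  proof -
    have "multiradial_fourier m (\<lambda>j. 2 * k j + b) \<phi> r = radial_moment m (\<lambda>j. 2 * k j + b) \<psi> (\<lambda>_. 0) r"
      using b r by (intro F) auto
    also note radial_moment_dimension_reduction[OF \<psi>_int assms(2) b r]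
    finally show ?thesis
      using deriv[OF _ b r] by (simp cong: sum.cong)
  qed
  show ?thesis
    by (intro conjI ballI; (rule diff formula; (assumption | simp)))
qed

end
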